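(* Let $R$ be a noetherian graded commutative ring, $\mathsf{T}$ an essentially small $R$-linear triangulated category, and $\mathsf{S}$ a thick subcategory of $\mathsf{T}$. Then the following conditions are equivalent for an object $X$ in $\mathsf{T}$: (1) $X$ belongs to $\mathsf{S}$. (2) $X_{\mathfrak p}$ belongs to $\operatorname{\mathsf{Thick}}(\mathsf{S}_{\mathfrak p})$ for each $\mathfrak p\in\operatorname{Spec} R$. (3) $X(\mathfrak p)$ belongs to $\operatorname{\mathsf{Thick}}(\mathsf{S}_{\mathfrak p})$ for each $\mathfrak p\in\operatorname{Spec} R$.
   Context: A graded commutative ring $R$ is $\mathbb{Z}$-graded with $rs=(-1)^{|r||s|}sr$ for homogeneous $r,s$. $\operatorname{Spec}R$ is the set of homogeneous prime ideals. A triangulated category $\mathsf{T}$ with suspension $\Sigma$ is $R$-linear if there is a given homomorphism of graded rings $R\to Z^*(\mathsf{T})$, where $Z^*(\mathsf{T})=\bigoplus_{n\in\mathbb{Z}}\{\eta\colon \mathrm{Id}_{\mathsf{T}}\to\Sigma^n\mid \eta\Sigma=(-1)^n\Sigma\eta\}$ is the graded centre. Then $\operatorname{Hom}^*_{\mathsf{T}}(X,Y)=\bigoplus_{n}\operatorname{Hom}_{\mathsf{T}}(X,\Sigma^nY)$ is a graded $R$-module, and $\operatorname{End}^*_{\mathsf{T}}(X)=\operatorname{Hom}^*_{\mathsf{T}}(X,X)$. The action restricts to triangulated subcategories and passes to Verdier quotients. $\operatorname{\mathsf{Thick}}(-)$ denotes the smallest thick subcategory containing the given objects. Localisation: for $\mathfrak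 p\in\operatorname{Spec}R$, $\mathsf{T}_{\mathfrak p}$ is the Verdier quotient of $\mathsf{T}$ by the thick subcategory $\{X\in\mathsf{T}\mid \operatorname{End}^*_{\mathsf{T}}(X)_{\mathfrak q}=0 \text{ for all } \mathfrak q\in\operatorname{Spec}R,\ \mathfrak q\subseteq\mathfrak p\}$, and $X_{\mathfrak p}$ is the image of $X$ in $\mathsf{T}_{\mathfrak p}$; there is a natural isomorphism $\operatorname{Hom}^*_{\mathsf{T}}(X,Y)_{\mathfrak p}\cong\operatorname{Hom}^*_{\mathsf{T}_{\mathfrak p}}(X_{\mathfrak p},Y_{\mathfrak p})$. For a triangulated subcategory $\mathsf{S}\subseteq\mathsf{T}$ (with the induced $R$-action) the induced functor $\mathsf{S}_{\mathfrak p}\to\mathsf{T}_{\mathfrak p}$ is exact and fully faithful, and $\mathsf{S}_{\mathfrak p}$ is viewed as a triangulated subcategory of $\mathsf{T}_{\mathfrak p}$; $\operatorname{\mathsf{Thick}}(\mathsf{S}_{\mathfrak p})$ is formed in $\mathsf{T}_{\mathfrak p}$. Koszul objects: for $r\in R$ homogeneous of degree $d$, $X/\!\!/r$ is the cone of $X\xrightarrow{r}\Sigma^dX$. For a finitely generated homogeneous ideal $\mathfrak a$, choose homogeneous generators $r_1,\dots,r_n$, put $X_0=X$, $X_i=X_{i-1}/\!\!/r_i$, and $X/\!\!/\mathfrak a=X_n$; this depends on the choice of generators, but the thick subcategory it generates does not. Set $X(\mathfrak p)=(X_{\mathfrak p})/\!\!/\mathfrak p$, an object of $\mathsf{T}_{\mathfrak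 p}$. *)

theory Defs
  imports "HOL-Algebra.Ring_Divisibility"
begin

section \<open>Graded commutative rings\<close>

text \<open>A \<open>\<int>\<close>-graded ring is a ring \<open>R\<close> with additive subgroups \<open>G n\<close> (the homogeneous elements of degree
  \<open>n\<close>) of which it is the internal direct sum. Such an \<open>R\<close> is commutative only up to sign,
  so the notions below that the library states for \<^locale>\<open>cring\<close> are restated for \<^locale>\<open>ring\<close>.\<close>

definition homogeneous_decomposition ::
    "('r, 'k) ring_scheme \<Rightarrow> (int \<Rightarrow> 'r set) \<Rightarrow> 'r \<Rightarrow> (int \<Rightarrow> 'r) \<Rightarrow> bool" where
  "homogeneous_decomposition R G x c \<longleftrightarrow>
     (\<forall>n. c n \<in> G n) \<and> finite {n. c n \<noteq> \<zero>\<^bsub>R\<^esub>} \<and> x = finsum R c {n. c n \<noteq> \<zero>\<^bsub>R\<^esub>}"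

locale graded_comm_ring = ring R for R (structure) +
  fixes G :: "int \<Rightarrow> 'a set"
  assumes degree_subgroup: "additive_subgroup (G n) R"
    and degree_one: "\<one> \<in> G 0"
    and degree_mult: "\<lbrakk>r \<in> G m; s \<in> G n\<rbrakk> \<Longrightarrow> r \<otimes> s \<in> G (m + n)"
    and direct_sum: "x \<in> carrier R \<Longrightarrow> \<exists>!c. homogeneous_decomposition R G x c"
    and graded_commute: "\<lbrakk>r \<in> G m; s \<in> G n\<rbrakk> \<Longrightarrow>
      r \<otimes> s = (if even (m * n) then s \<otimes> r else \<ominus> (s \<otimes> r))"

definition homogeneous_ideal ::
    "('r, 'k) ring_scheme \<Rightarrow> (int \<Rightarrow> 'r set) \<Rightarrow> 'r set \<Rightarrow> bool" where
  "homogeneous_ideal R G I \<longleftrightarrow>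
     ideal I R \<and> (\<forall>x\<in>I. \<forall>c. homogeneous_decomposition R G x c \<longrightarrow> (\<forall>n. c n \<in> I))"

text \<open>Noetherian in the graded sense. For graded commutative rings this agrees with
  \<^locale>\<open>noetherian_ring\<close>, which asks for finite generation of all two-sided ideals.\<close>

locale noetherian_graded_comm_ring = graded_comm_ring +
  assumes homogeneous_finitely_gen:
    "homogeneous_ideal R G I \<Longrightarrow> \<exists>A \<subseteq> carrier R. finite A \<and> I = Idl A"

definition Spec :: "('r, 'k) ring_scheme \<Rightarrow> (int \<Rightarrow> 'r set) \<Rightarrow> 'r set set" where
  "Spec R G = {P. homogeneous_ideal R G P \<and> P \<noteq> carrier R \<and>
     (\<forall>a\<in>carrier R. \<forall>b\<in>carrier R. a \<otimes>\<^bsub>R\<^esub> b \<in> P \<longrightarrow> a \<in> P \<or> b \<in> P)}"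


section \<open>Localisation of graded modules\<close>

text \<open>The part of a graded module that its localisations depend on as graded sets with zero:
  \<open>GAct M d r n\<close> is multiplication by \<open>r \<in> G d\<close> as a map from degree \<open>n\<close> to degree \<open>n + d\<close>.\<close>

record ('r, 'x) graded_module =
  GComp :: "int \<Rightarrow> 'x set"
  GZero :: "int \<Rightarrow> 'x"
  GAct :: "int \<Rightarrow> 'r \<Rightarrow> int \<Rightarrow> 'x \<Rightarrow> 'x"

text \<open>A triple \<open>(d, s, m)\<close> stands for the left fraction \<open>s\<inverse> m\<close> of degree \<open>n\<close>, where
  \<open>s\<close> is homogeneous of degree \<open>d\<close> outside \<open>P\<close>. Two fractions are identified
  if they can be expanded to a common one (the Ore condition avoids signs).\<close>

definition fractions :: "(int \<Rightarrow> 'r set) \<Rightarrow> 'r set \<Rightarrow> ('r, 'x) graded_module \<Rightarrow> int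
    \<Rightarrow> (int \<times> 'r \<times> 'x) set" where
  "fractions G P M n = {(d, s, m). s \<in> G d \<and> s \<notin> P \<and> m \<in> GComp M (n + d)}"

definition fraction_rel :: "('r, 'k) ring_scheme \<Rightarrow> (int \<Rightarrow> 'r set) \<Rightarrow> 'r set
    \<Rightarrow> ('r, 'x) graded_module \<Rightarrow> int \<Rightarrow> ((int \<times> 'r \<times> 'x) \<times> (int \<times> 'r \<times> 'x)) set" where
  "fraction_rel R G P M n =
     {((d, s, m), (d', s', m')). (d, s, m) \<in> fractions G P M n \<and> (d', s', m') \<in> fractions G P M n \<and>
        (\<exists>e e'. \<exists>a\<in>G e. \<exists>b\<in>G e'. e + d = e' + d' \<and> a \<otimes>\<^bsub>R\<^esub> s = b \<otimes>\<^bsub>R\<^esub> s' \<and> a \<otimes>\<^bsub>R\<^esub> s \<notin> P \<and>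
           GAct M e a (n + d) m = GAct M e' b (n + d') m')}"

definition localisation_at :: "('r, 'k) ring_scheme \<Rightarrow> (int \<Rightarrow> 'r set) \<Rightarrow> 'r set
    \<Rightarrow> ('r, 'x) graded_module \<Rightarrow> int \<Rightarrow> (int \<times> 'r \<times> 'x) set set" where
  "localisation_at R G P M n = fractions G P M n // fraction_rel R G P M n"

definition localisation_zero :: "('r, 'k) ring_scheme \<Rightarrow> (int \<Rightarrow> 'r set) \<Rightarrow> 'r set
    \<Rightarrow> ('r, 'x) graded_module \<Rightarrow> int \<Rightarrow> (int \<times> 'r \<times> 'x) set" where
  "localisation_zero R G P M n = fraction_rel R G P M n `` {(0, \<one>\<^bsub>R\<^esub>, GZero M n)}"

definition localisation_vanishes :: "('r, 'k) ring_scheme \<Rightarrow> (int \<Rightarrow> 'r set) \<Rightarrow> 'r set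
    \<Rightarrow> ('r, 'x) graded_module \<Rightarrow> bool" where
  "localisation_vanishes R G P M \<longleftrightarrow>
     (\<forall>n. localisation_at R G P M n = {localisation_zero R G P M n})"


section \<open>Additive categories with suspension\<close>

text \<open>The operations \<open>Cmp\<close> (written in the order of function composition) and \<open>Add\<close> are meaningful on
  composable and on parallel morphisms, respectively. All categories here are small.\<close>

record ('o, 'm) suspended_category =
  Ob :: "'o set"
  Ar :: "'m set"
  Dom :: "'m \<Rightarrow> 'o"
  Cod :: "'m \<Rightarrow> 'o"
  Idn :: "'o \<Rightarrow> 'm"
  Cmp :: "'m \<Rightarrow> 'm \<Rightarrow> 'm"
  Add :: "'m \<Rightarrow> 'm \<Rightarrow> 'm"
  Zer :: "'o \<Rightarrow> 'o \<Rightarrow> 'm"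
  SOb :: "'o \<Rightarrow> 'o"
  SAr :: "'m \<Rightarrow> 'm"

definition Hom :: "('o, 'm, 'z) suspended_category_scheme \<Rightarrow> 'o \<Rightarrow> 'o \<Rightarrow> 'm set" where
  "Hom C X Y = {f \<in> Ar C. Dom C f = X \<and> Cod C f = Y}"

definition hom_group :: "('o, 'm, 'z) suspended_category_scheme \<Rightarrow> 'o \<Rightarrow> 'o \<Rightarrow> 'm monoid" where
  "hom_group C X Y = \<lparr>carrier = Hom C X Y, monoid.mult = Add C, one = Zer C X Y\<rparr>"

definition Neg :: "('o, 'm, 'z) suspended_category_scheme \<Rightarrow> 'm \<Rightarrow> 'm" where
  "Neg C f = inv\<^bsub>hom_group C (Dom C f) (Cod C f)\<^esub> f"

definition iso_arrow :: "('o, 'm, 'z) suspended_category_scheme \<Rightarrow> 'm \<Rightarrow> bool" where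
  "iso_arrow C f \<longleftrightarrow> f \<in> Ar C \<and> (\<exists>g \<in> Hom C (Cod C f) (Dom C f).
     Cmp C g f = Idn C (Dom C f) \<and> Cmp C f g = Idn C (Cod C f))"

definition zero_object :: "('o, 'm, 'z) suspended_category_scheme \<Rightarrow> 'o \<Rightarrow> bool" where
  "zero_object C Z \<longleftrightarrow> Z \<in> Ob C \<and> (\<forall>X\<in>Ob C. Hom C X Z = {Zer C X Z} \<and> Hom C Z X = {Zer C Z X})"

definition direct_sum_of :: "('o, 'm, 'z) suspended_category_scheme \<Rightarrow> 'o \<Rightarrow> 'o \<Rightarrow> 'o \<Rightarrow> bool" where
  "direct_sum_of C X\<^sub>1 X\<^sub>2 Y \<longleftrightarrow> X\<^sub>1 \<in> Ob C \<and> X\<^sub>2 \<in> Ob C \<and> Y \<in> Ob C \<and>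
     (\<exists>i\<^sub>1 \<in> Hom C X\<^sub>1 Y. \<exists>i\<^sub>2 \<in> Hom C X\<^sub>2 Y. \<exists>p\<^sub>1 \<in> Hom C Y X\<^sub>1. \<exists>p\<^sub>2 \<in> Hom C Y X\<^sub>2.
        Cmp C p\<^sub>1 i\<^sub>1 = Idn C X\<^sub>1 \<and> Cmp C p\<^sub>2 i\<^sub>2 = Idn C X\<^sub>2 \<and>
        Cmp C p\<^sub>1 i\<^sub>2 = Zer C X\<^sub>2 X\<^sub>1 \<and> Cmp C p\<^sub>2 i\<^sub>1 = Zer C X\<^sub>1 X\<^sub>2 \<and>
        Add C (Cmp C i\<^sub>1 p\<^sub>1) (Cmp C i\<^sub>2 p\<^sub>2) = Idn C Y)"

locale additive_category =
  fixes C :: "('o, 'm, 'z) suspended_category_scheme"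
  assumes dom_cod: "f \<in> Ar C \<Longrightarrow> Dom C f \<in> Ob C \<and> Cod C f \<in> Ob C"
    and idn_hom: "X \<in> Ob C \<Longrightarrow> Idn C X \<in> Hom C X X"
    and cmp_hom: "\<lbrakk>f \<in> Hom C X Y; g \<in> Hom C Y Z\<rbrakk> \<Longrightarrow> Cmp C g f \<in> Hom C X Z"
    and cmp_idn: "f \<in> Hom C X Y \<Longrightarrow> Cmp C f (Idn C X) = f \<and> Cmp C (Idn C Y) f = f"
    and cmp_assoc: "\<lbrakk>f \<in> Hom C W X; g \<in> Hom C X Y; h \<in> Hom C Y Z\<rbrakk>
      \<Longrightarrow> Cmp C h (Cmp C g f) = Cmp C (Cmp C h g) f"
    and hom_comm_group: "\<lbrakk>X \<in> Ob C; Y \<in> Ob C\<rbrakk> \<Longrightarrow> comm_group (hom_group C X Y)"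
    and cmp_add_right: "\<lbrakk>f \<in> Hom C X Y; f' \<in> Hom C X Y; g \<in> Hom C Y Z\<rbrakk>
      \<Longrightarrow> Cmp C g (Add C f f') = Add C (Cmp C g f) (Cmp C g f')"
    and cmp_add_left: "\<lbrakk>f \<in> Hom C X Y; g \<in> Hom C Y Z; g' \<in> Hom C Y Z\<rbrakk>
      \<Longrightarrow> Cmp C (Add C g g') f = Add C (Cmp C g f) (Cmp C g' f)"
    and zero_object_exists: "\<exists>Z. zero_object C Z"
    and direct_sums_exist: "\<lbrakk>X \<in> Ob C; Y \<in> Ob C\<rbrakk> \<Longrightarrow> \<exists>Z. direct_sum_of C X Y Z"

text \<open>The suspension is an automorphism of categories, so that its integer powers are functors and
  \<open>\<eta>\<Sigma> = (-1)\<^sup>n\<Sigma>\<eta>\<close> below makes sense without coherence isomorphisms.\<close>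

locale additive_category_with_suspension = additive_category +
  assumes susp_ob_bij: "bij_betw (SOb C) (Ob C) (Ob C)"
    and susp_ar_bij: "bij_betw (SAr C) (Ar C) (Ar C)"
    and susp_hom: "f \<in> Hom C X Y \<Longrightarrow> SAr C f \<in> Hom C (SOb C X) (SOb C Y)"
    and susp_idn: "X \<in> Ob C \<Longrightarrow> SAr C (Idn C X) = Idn C (SOb C X)"
    and susp_cmp: "\<lbrakk>f \<in> Hom C X Y; g \<in> Hom C Y Z\<rbrakk>
      \<Longrightarrow> SAr C (Cmp C g f) = Cmp C (SAr C g) (SAr C f)"
    and susp_add: "\<lbrakk>f \<in> Hom C X Y; g \<in> Hom C X Y\<rbrakk>
      \<Longrightarrow> SAr C (Add C f g) = Add C (SAr C f) (SAr C g)"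

definition int_iterate :: "('a \<Rightarrow> 'a) \<Rightarrow> 'a set \<Rightarrow> int \<Rightarrow> 'a \<Rightarrow> 'a" where
  "int_iterate f A n = (if n \<ge> 0 then f ^^ nat n else inv_into A f ^^ nat (- n))"

abbreviation SOb_pow :: "('o, 'm, 'z) suspended_category_scheme \<Rightarrow> int \<Rightarrow> 'o \<Rightarrow> 'o" where
  "SOb_pow C n \<equiv> int_iterate (SOb C) (Ob C) n"

abbreviation SAr_pow :: "('o, 'm, 'z) suspended_category_scheme \<Rightarrow> int \<Rightarrow> 'm \<Rightarrow> 'm" where
  "SAr_pow C n \<equiv> int_iterate (SAr C) (Ar C) n"


section \<open>Triangulated categories and thick subcategories\<close>

definition candidate_triangle ::
    "('o, 'm, 'z) suspended_category_scheme \<Rightarrow> 'm \<times> 'm \<times> 'm \<Rightarrow> bool" where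
  "candidate_triangle C = (\<lambda>(u, v, w). \<exists>X Y Z. u \<in> Hom C X Y \<and> v \<in> Hom C Y Z \<and> w \<in> Hom C Z (SOb C X))"

definition triangle_morphism :: "('o, 'm, 'z) suspended_category_scheme
    \<Rightarrow> 'm \<times> 'm \<times> 'm \<Rightarrow> 'm \<times> 'm \<times> 'm \<Rightarrow> 'm \<times> 'm \<times> 'm \<Rightarrow> bool" where
  "triangle_morphism C = (\<lambda>(a, b, c) (u, v, w) (u', v', w').
     a \<in> Hom C (Dom C u) (Dom C u') \<and> b \<in> Hom C (Dom C v) (Dom C v') \<and>
     c \<in> Hom C (Dom C w) (Dom C w') \<and>
     Cmp C b u = Cmp C u' a \<and> Cmp C c v = Cmp C v' b \<and> Cmp C (SAr C a) w = Cmp C w' c)"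

definition triangles_isomorphic :: "('o, 'm, 'z) suspended_category_scheme
    \<Rightarrow> 'm \<times> 'm \<times> 'm \<Rightarrow> 'm \<times> 'm \<times> 'm \<Rightarrow> bool" where
  "triangles_isomorphic C t t' \<longleftrightarrow> (\<exists>a b c. triangle_morphism C (a, b, c) t t' \<and>
     iso_arrow C a \<and> iso_arrow C b \<and> iso_arrow C c)"

record ('o, 'm) triangulated = "('o, 'm) suspended_category" +
  Tri :: "('m \<times> 'm \<times> 'm) set"

locale triangulated_category = additive_category_with_suspension T
  for T :: "('o, 'm, 'z) triangulated_scheme" +
  assumes tri_candidate: "t \<in> Tri T \<Longrightarrow> candidate_triangle T t"
    and TR1_identity: "\<lbrakk>X \<in> Ob T; zero_object T Z\<rbrakk>
      \<Longrightarrow> (Idn T X, Zer T X Z, Zer T Z (SOb T X)) \<in> Tri T"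
    and TR1_iso: "\<lbrakk>t \<in> Tri T; candidate_triangle T t'; triangles_isomorphic T t t'\<rbrakk> \<Longrightarrow> t' \<in> Tri T"
    and TR1_cone: "u \<in> Ar T \<Longrightarrow> \<exists>v w. (u, v, w) \<in> Tri T"
    and TR2: "candidate_triangle T (u, v, w)
      \<Longrightarrow> (u, v, w) \<in> Tri T \<longleftrightarrow> (v, w, Neg T (SAr T u)) \<in> Tri T"
    and TR3: "\<lbrakk>(u, v, w) \<in> Tri T; (u', v', w') \<in> Tri T;
        a \<in> Hom T (Dom T u) (Dom T u'); b \<in> Hom T (Cod T u) (Cod T u');
        Cmp T b u = Cmp T u' a\<rbrakk>
      \<Longrightarrow> \<exists>c. triangle_morphism T (a, b, c) (u, v, w) (u', v', w')"
    and TR4: "\<lbrakk>(u, i, i') \<in> Tri T; (v, j, j') \<in> Tri T; (Cmp T v u, k, k') \<in> Tri T; Cod T u = Dom T v\<rbrakk>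
      \<Longrightarrow> \<exists>f \<in> Hom T (Cod T i) (Cod T k). \<exists>g \<in> Hom T (Cod T k) (Cod T j).
            (f, g, Cmp T (SAr T i) j') \<in> Tri T \<and>
            Cmp T f i = Cmp T k v \<and> Cmp T k' f = i' \<and>
            Cmp T g k = j \<and> Cmp T j' g = Cmp T (SAr T u) k'"

text \<open>Thick subcategories are full and closed under isomorphism, hence given by sets of objects.\<close>

definition thick :: "('o, 'm, 'z) triangulated_scheme \<Rightarrow> 'o set \<Rightarrow> bool" where
  "thick T S \<longleftrightarrow> S \<subseteq> Ob T \<and> (\<exists>Z\<in>S. zero_object T Z) \<and>
     (\<forall>X\<in>Ob T. X \<in> S \<longleftrightarrow> SOb T X \<in> S) \<and>
     (\<forall>f. iso_arrow T f \<and> Dom T f \<in> S \<longrightarrow> Cod T f \<in> S) \<and>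
     (\<forall>u v w. (u, v, w) \<in> Tri T \<longrightarrow>
        (Dom T u \<in> S \<and> Cod T u \<in> S \<longrightarrow> Cod T v \<in> S) \<and>
        (Cod T u \<in> S \<and> Cod T v \<in> S \<longrightarrow> Dom T u \<in> S) \<and>
        (Dom T u \<in> S \<and> Cod T v \<in> S \<longrightarrow> Cod T u \<in> S)) \<and>
     (\<forall>X X' Y. direct_sum_of T X X' Y \<and> Y \<in> S \<longrightarrow> X \<in> S \<and> X' \<in> S)"

definition Thick :: "('o, 'm, 'z) triangulated_scheme \<Rightarrow> 'o set \<Rightarrow> 'o set" where
  "Thick T A = \<Inter> {S. thick T S \<and> A \<subseteq> S}"

definition full_subcategory ::
    "('o, 'm, 'z) triangulated_scheme \<Rightarrow> 'o set \<Rightarrow> ('o, 'm, 'z) triangulated_scheme" where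
  "full_subcategory T S = T\<lparr>
     Ob := S,
     Ar := {f \<in> Ar T. Dom T f \<in> S \<and> Cod T f \<in> S},
     Tri := {(u, v, w) \<in> Tri T. Dom T u \<in> S \<and> Cod T u \<in> S \<and> Cod T v \<in> S}\<rparr>"


section \<open>Verdier quotients\<close>

text \<open>Morphisms \<open>X \<rightarrow> Y\<close> in the quotient of \<open>T\<close> by \<open>N\<close> are equivalence classes of roofs
  \<open>(s, f)\<close>, standing for \<open>f \<circ> s\<inverse>\<close>, with \<open>s : W \<rightarrow> X\<close>, \<open>f : W \<rightarrow> Y\<close> and cone of \<open>s\<close> in \<open>N\<close>.\<close>

definition cone_in :: "('o, 'm, 'z) triangulated_scheme \<Rightarrow> 'o set \<Rightarrow> 'm set" where
  "cone_in T N = {s \<in> Ar T. \<exists>v w. (s, v, w) \<in> Tri T \<and> Cod T v \<in> N}"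

definition roofs :: "('o, 'm, 'z) triangulated_scheme \<Rightarrow> 'o set \<Rightarrow> ('m \<times> 'm) set" where
  "roofs T N = {(s, f). s \<in> cone_in T N \<and> f \<in> Ar T \<and> Dom T s = Dom T f}"

definition roof_rel ::
    "('o, 'm, 'z) triangulated_scheme \<Rightarrow> 'o set \<Rightarrow> (('m \<times> 'm) \<times> ('m \<times> 'm)) set" where
  "roof_rel T N = {((s, f), (s', f')). (s, f) \<in> roofs T N \<and> (s', f') \<in> roofs T N \<and>
     Cod T s = Cod T s' \<and> Cod T f = Cod T f' \<and>
     (\<exists>W. \<exists>a \<in> Hom T W (Dom T s). \<exists>b \<in> Hom T W (Dom T s').
        Cmp T s a = Cmp T s' b \<and> Cmp T s a \<in> cone_in T N \<and> Cmp T f a = Cmp T f' b)}"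

definition roof_class ::
    "('o, 'm, 'z) triangulated_scheme \<Rightarrow> 'o set \<Rightarrow> 'm \<times> 'm \<Rightarrow> ('m \<times> 'm) set" where
  "roof_class T N x = roof_rel T N `` {x}"

text \<open>Composition and addition are given by unions over all representatives and all choices of a
  square (a common denominator); the classes united all agree.\<close>

definition roof_comp :: "('o, 'm, 'z) triangulated_scheme \<Rightarrow> 'o set
    \<Rightarrow> ('m \<times> 'm) set \<Rightarrow> ('m \<times> 'm) set \<Rightarrow> ('m \<times> 'm) set" where
  "roof_comp T N d c = \<Union> {roof_class T N (Cmp T s a, Cmp T g b) | s f t g a b.
     (s, f) \<in> c \<and> (t, g) \<in> d \<and> a \<in> cone_in T N \<and> b \<in> Ar T \<and> Dom T a = Dom T b \<and>
     Cod T a = Dom T f \<and> Cod T b = Dom T t \<and> Cmp T f a = Cmp T t b}"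

definition roof_add :: "('o, 'm, 'z) triangulated_scheme \<Rightarrow> 'o set
    \<Rightarrow> ('m \<times> 'm) set \<Rightarrow> ('m \<times> 'm) set \<Rightarrow> ('m \<times> 'm) set" where
  "roof_add T N c d = \<Union> {roof_class T N (s, Add T f g) | s f g. (s, f) \<in> c \<and> (s, g) \<in> d}"

definition quotient_arrow :: "('o, 'm, 'z) triangulated_scheme \<Rightarrow> 'o set \<Rightarrow> 'm \<Rightarrow> ('m \<times> 'm) set" where
  "quotient_arrow T N f = roof_class T N (Idn T (Dom T f), f)"

definition quotient_category ::
    "('o, 'm, 'z) triangulated_scheme \<Rightarrow> 'o set \<Rightarrow> ('o, ('m \<times> 'm) set) suspended_category" where
  "quotient_category T N = \<lparr>
     Ob = Ob T,
     Ar = roofs T N // roof_rel T N,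
     Dom = (\<lambda>c. THE X. \<forall>(s, f) \<in> c. Cod T s = X),
     Cod = (\<lambda>c. THE Y. \<forall>(s, f) \<in> c. Cod T f = Y),
     Idn = (\<lambda>X. quotient_arrow T N (Idn T X)),
     Cmp = roof_comp T N,
     Add = roof_add T N,
     Zer = (\<lambda>X Y. quotient_arrow T N (Zer T X Y)),
     SOb = SOb T,
     SAr = (\<lambda>c. map_prod (SAr T) (SAr T) ` c)\<rparr>"

definition quotient_triangles ::
    "('o, 'm, 'z) triangulated_scheme \<Rightarrow> 'o set \<Rightarrow> (('m \<times> 'm) set \<times> ('m \<times> 'm) set \<times> ('m \<times> 'm) set) set" where
  "quotient_triangles T N = {t. candidate_triangle (quotient_category T N) t \<and>
     (\<exists>(u, v, w) \<in> Tri T. triangles_isomorphic (quotient_category T N)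
        (quotient_arrow T N u, quotient_arrow T N v, quotient_arrow T N w) t)}"

definition Verdier_quotient ::
    "('o, 'm, 'z) triangulated_scheme \<Rightarrow> 'o set \<Rightarrow> ('o, ('m \<times> 'm) set) triangulated" where
  "Verdier_quotient T N =
     suspended_category.extend (quotient_category T N) (triangulated.fields (quotient_triangles T N))"


section \<open>Actions of graded rings and localisation\<close>

text \<open>The degree \<open>n\<close> component of the graded centre.\<close>

definition graded_centre :: "('o, 'm, 'z) suspended_category_scheme \<Rightarrow> int \<Rightarrow> ('o \<Rightarrow> 'm) set" where
  "graded_centre C n = {\<eta>.
     (\<forall>X\<in>Ob C. \<eta> X \<in> Hom C X (SOb_pow C n X)) \<and>
     (\<forall>X Y. \<forall>f \<in> Hom C X Y. Cmp C (\<eta> Y) f = Cmp C (SAr_pow C n f) (\<eta> X)) \<and>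
     (\<forall>X\<in>Ob C. \<eta> (SOb C X) = (if even n then SAr C (\<eta> X) else Neg C (SAr C (\<eta> X))))}"

text \<open>\<open>\<phi> n\<close> is the degree \<open>n\<close> component of a homomorphism of graded rings from \<open>R\<close> to the graded
  centre. The product of \<open>\<eta>\<close> and \<open>\<zeta>\<close> of degree \<open>n\<close> in the graded centre is
  \<open>\<Sigma>\<^sup>n\<eta> \<circ> \<zeta>\<close>, so that evaluation at \<open>X\<close> is a homomorphism to the graded endomorphism ring of \<open>X\<close>.\<close>

locale linear_triangulated_category = graded_comm_ring R G + triangulated_category T
  for R :: "('r, 'k) ring_scheme" (structure) and G and T :: "('o, 'm, 'z) triangulated_scheme" +
  fixes \<phi> :: "int \<Rightarrow> 'r \<Rightarrow> 'o \<Rightarrow> 'm"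
  assumes action_centre: "r \<in> G n \<Longrightarrow> \<phi> n r \<in> graded_centre T n"
    and action_add: "\<lbrakk>r \<in> G n; s \<in> G n; X \<in> Ob T\<rbrakk> \<Longrightarrow> \<phi> n (r \<oplus> s) X = Add T (\<phi> n r X) (\<phi> n s X)"
    and action_mult: "\<lbrakk>r \<in> G m; s \<in> G n; X \<in> Ob T\<rbrakk>
      \<Longrightarrow> \<phi> (m + n) (r \<otimes> s) X = Cmp T (SAr_pow T n (\<phi> m r X)) (\<phi> n s X)"
    and action_one: "X \<in> Ob T \<Longrightarrow> \<phi> 0 \<one> X = Idn T X"

definition Hom_star :: "('o, 'm, 'z) suspended_category_scheme \<Rightarrow> (int \<Rightarrow> 'r \<Rightarrow> 'o \<Rightarrow> 'm)
    \<Rightarrow> 'o \<Rightarrow> 'o \<Rightarrow> ('r, 'm) graded_module" where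
  "Hom_star C \<phi> X Y = \<lparr>
     GComp = (\<lambda>n. Hom C X (SOb_pow C n Y)),
     GZero = (\<lambda>n. Zer C X (SOb_pow C n Y)),
     GAct = (\<lambda>d r n f. Cmp C (SAr_pow C n (\<phi> d r Y)) f)\<rparr>"

abbreviation End_star :: "('o, 'm, 'z) suspended_category_scheme \<Rightarrow> (int \<Rightarrow> 'r \<Rightarrow> 'o \<Rightarrow> 'm)
    \<Rightarrow> 'o \<Rightarrow> ('r, 'm) graded_module" where
  "End_star C \<phi> X \<equiv> Hom_star C \<phi> X X"

definition local_kernel :: "('r, 'k) ring_scheme \<Rightarrow> (int \<Rightarrow> 'r set)
    \<Rightarrow> ('o, 'm, 'z) triangulated_scheme \<Rightarrow> (int \<Rightarrow> 'r \<Rightarrow> 'o \<Rightarrow> 'm) \<Rightarrow> 'r set \<Rightarrow> 'o set" where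
  "local_kernel R G T \<phi> P =
     {X \<in> Ob T. \<forall>Q \<in> Spec R G. Q \<subseteq> P \<longrightarrow> localisation_vanishes R G Q (End_star T \<phi> X)}"

text \<open>\<open>T\<^sub>P\<close> has the same objects as \<open>T\<close>, the image of \<open>X\<close> being \<open>X\<close> itself; likewise the functor
  \<open>S\<^sub>P \<rightarrow> T\<^sub>P\<close> for a triangulated subcategory \<open>S\<close> is the identity on objects.\<close>

definition local_category :: "('r, 'k) ring_scheme \<Rightarrow> (int \<Rightarrow> 'r set)
    \<Rightarrow> ('o, 'm, 'z) triangulated_scheme \<Rightarrow> (int \<Rightarrow> 'r \<Rightarrow> 'o \<Rightarrow> 'm) \<Rightarrow> 'r set
    \<Rightarrow> ('o, ('m \<times> 'm) set) triangulated" where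
  "local_category R G T \<phi> P = Verdier_quotient T (local_kernel R G T \<phi> P)"

definition local_action :: "('r, 'k) ring_scheme \<Rightarrow> (int \<Rightarrow> 'r set)
    \<Rightarrow> ('o, 'm, 'z) triangulated_scheme \<Rightarrow> (int \<Rightarrow> 'r \<Rightarrow> 'o \<Rightarrow> 'm) \<Rightarrow> 'r set
    \<Rightarrow> int \<Rightarrow> 'r \<Rightarrow> 'o \<Rightarrow> ('m \<times> 'm) set" where
  "local_action R G T \<phi> P n r X = quotient_arrow T (local_kernel R G T \<phi> P) (\<phi> n r X)"


section \<open>Koszul objects\<close>

text \<open>Cones, and generators of an ideal, are not unique, so \<open>X//r\<close> and \<open>X//\<aa>\<close> are rendered as the set of all
  objects arising from some choice. A generator is listed together with its degree.\<close>

inductive Koszul :: "('o, 'm, 'z) triangulated_scheme \<Rightarrow> (int \<Rightarrow> 'r \<Rightarrow> 'o \<Rightarrow> 'm)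
    \<Rightarrow> 'o \<Rightarrow> (int \<times> 'r) list \<Rightarrow> 'o \<Rightarrow> bool"
  for T \<phi> where
  Koszul_Nil: "X \<in> Ob T \<Longrightarrow> Koszul T \<phi> X [] X"
| Koszul_Cons: "\<lbrakk>X \<in> Ob T; (\<phi> d r X, v, w) \<in> Tri T; Koszul T \<phi> (Cod T v) rs Y\<rbrakk>
    \<Longrightarrow> Koszul T \<phi> X ((d, r) # rs) Y"

definition Koszul_objects :: "('r, 'k) ring_scheme \<Rightarrow> (int \<Rightarrow> 'r set)
    \<Rightarrow> ('o, 'm, 'z) triangulated_scheme \<Rightarrow> (int \<Rightarrow> 'r \<Rightarrow> 'o \<Rightarrow> 'm) \<Rightarrow> 'o \<Rightarrow> 'r set \<Rightarrow> 'o set" where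
  "Koszul_objects R G T \<phi> X I = {Y. \<exists>rs. (\<forall>(d, r) \<in> set rs. r \<in> G d) \<and>
     I = genideal R (snd ` set rs) \<and> Koszul T \<phi> X rs Y}"

definition local_Koszul_objects :: "('r, 'k) ring_scheme \<Rightarrow> (int \<Rightarrow> 'r set)
    \<Rightarrow> ('o, 'm, 'z) triangulated_scheme \<Rightarrow> (int \<Rightarrow> 'r \<Rightarrow> 'o \<Rightarrow> 'm) \<Rightarrow> 'o \<Rightarrow> 'r set \<Rightarrow> 'o set" where
  "local_Koszul_objects R G T \<phi> X P =
     Koszul_objects R G (local_category R G T \<phi> P) (local_action R G T \<phi> P) X P"

end

theory Submission
  imports Defs
begin

text \<open>
  Suppose \<open>X\<close> satisfies the local condition at every prime but is not in \<open>S\<close>. Call an arrow null if it vanishes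
  in \<open>T/S\<close>. For each \<open>Y\<close> let \<open>I(Y)\<close> be the homogeneous ideal generated by the homogeneous elements that act
  nilpotently on \<open>Y\<close> in \<open>T/S\<close>. As \<open>R\<close> is noetherian, there is a \<open>Y\<close> in \<open>Thick(X)\<close>, not in \<open>S\<close>, with \<open>I(Y)\<close>
  maximal. If \<open>r\<close> is homogeneous and not in \<open>I(Y)\<close>, then \<open>I(Y//r)\<close> is strictly larger, so \<open>Y//r\<close> is in \<open>S\<close>: every
  homogeneous element acts on \<open>Y\<close> in \<open>T/S\<close> either nilpotently or invertibly. Hence \<open>P = I(Y)\<close> is prime.
  The objects \<open>Z\<close> with \<open>Hom(\<Sigma>\<^sup>n Y, Z) = 0\<close> in \<open>T/S\<close> for all \<open>n\<close> form a thick subcategory \<open>V\<close> of \<open>T\<close>. It contains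
  \<open>S\<close> and, since the elements outside \<open>P\<close> are invertible on \<open>Y\<close>, also the kernel of \<open>T \<rightarrow> T\<^sub>P\<close>; so it is thick
  in \<open>T\<^sub>P\<close>. If \<open>r\<close> is in \<open>P\<close> and \<open>Z//r\<close> is in \<open>V\<close>, then \<open>r\<close> acts both bijectively and locally nilpotently on these
  Hom groups, so \<open>Z\<close> is in \<open>V\<close>. Thus the local condition at \<open>P\<close> puts first \<open>X(P)\<close>, then \<open>X\<close>, and finally \<open>Y\<close>
  itself into \<open>V\<close>, which means that \<open>Y\<close> is in \<open>S\<close>.
\<close>

section \<open>Additive categories with suspension\<close>

text \<open>The obstacle is that the quotients are awkward to compute in: a composite of roofs is a
  union of classes, and neither \<open>T/S\<close> nor \<open>T_P\<close> is shown to be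
  triangulated, or even a category. So \<open>T/S\<close> is never formed; its vanishing and
  invertible arrows are encoded in \<open>T\<close> by \<open>null_mod\<close> and
  \<open>cone_in\<close>. About \<open>T_P\<close> three transfer results carry the argument:
  triangles map to triangles (\<open>image_Tri\<close>), thick subcategories of \<open>T\<close>
  containing the kernel stay thick (\<open>thick_Verdier\<close>), and an arrow whose image has a
  cone in such a subcategory already has one in \<open>T\<close>
  (\<open>cone_in_if_quotient_cone\<close>). The ideal grows on passing to \<open>Y//r\<close>
  because \<open>Y//r\<close> is an extension of two suspensions of \<open>Y\<close>, so that if a
  power of an element is null on \<open>Y\<close>, the square of that power is null on
  \<open>Y//r\<close>; and \<open>r\<close> itself squares to zero there. Primality holds because
  invertible elements are closed under products, whereas an element both nilpotent and invertible on
  \<open>Y\<close> would put \<open>Y\<close> into \<open>S\<close>. The ring commutes only up to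
  sign, so radicals are handled without a binomial formula.\<close>

lemma Hom_DomD: "f \<in> Hom C X Y \<Longrightarrow> Dom C f = X"
  and Hom_CodD: "f \<in> Hom C X Y \<Longrightarrow> Cod C f = Y"
  and Hom_ArD: "f \<in> Hom C X Y \<Longrightarrow> f \<in> Ar C"
  by (simp_all add: Hom_def)

lemma Ar_HomI: "f \<in> Ar C \<Longrightarrow> f \<in> Hom C (Dom C f) (Cod C f)"
  by (simp add: Hom_def)

lemma iso_arrow_iff:
  "f \<in> Hom C X Y \<Longrightarrow>
    iso_arrow C f \<longleftrightarrow> (\<exists>g \<in> Hom C Y X. Cmp C g f = Idn C X \<and> Cmp C f g = Idn C Y)"
  by (auto simp: iso_arrow_def Hom_def)

lemma thick_susp: "\<lbrakk>thick T U; X \<in> Ob T\<rbrakk> \<Longrightarrow> SOb T X \<in> U \<longleftrightarrow> X \<in> U"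
  unfolding thick_def by blast

lemma thick_coneD:
  "\<lbrakk>thick T U; (u, v, w) \<in> Tri T; Dom T u \<in> U; Cod T u \<in> U\<rbrakk> \<Longrightarrow> Cod T v \<in> U"
  unfolding thick_def by metis

context additive_category
begin

abbreviation comp_infix (infixr "\<cdot>" 70) where "g \<cdot> f \<equiv> Cmp C g f"

lemma hom_obD: "f \<in> Hom C X Y \<Longrightarrow> X \<in> Ob C" "f \<in> Hom C X Y \<Longrightarrow> Y \<in> Ob C"
  using dom_cod by (auto simp: Hom_def)

lemma cmp_idn_right [simp]: "f \<in> Hom C X Y \<Longrightarrow> f \<cdot> Idn C X = f"
  and cmp_idn_left [simp]: "f \<in> Hom C X Y \<Longrightarrow> Idn C Y \<cdot> f = f"
  by (simp_all add: cmp_idn)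

lemma zer_hom: "\<lbrakk>X \<in> Ob C; Y \<in> Ob C\<rbrakk> \<Longrightarrow> Zer C X Y \<in> Hom C X Y"
  using group.is_monoid[OF comm_group.axioms(2)[OF hom_comm_group], THEN monoid.one_closed]
  by (fastforce simp: hom_group_def)

lemma neg_in_group: "f \<in> Hom C X Y \<Longrightarrow> Neg C f = inv\<^bsub>hom_group C X Y\<^esub> f"
  by (auto simp: Neg_def Hom_def)


lemma hom_group_sel [simp]:
  "carrier (hom_group C X Y) = Hom C X Y" "monoid.mult (hom_group C X Y) = Add C"
  "one (hom_group C X Y) = Zer C X Y"
  by (simp_all add: hom_group_def)

lemma hom_group_if_hom: "f \<in> Hom C X Y \<Longrightarrow> comm_group (hom_group C X Y)"
  using hom_comm_group hom_obD by blast

lemma add_hom: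
  assumes "f \<in> Hom C X Y" "g \<in> Hom C X Y"
  shows "Add C f g \<in> Hom C X Y"
proof -
  interpret H: comm_group "hom_group C X Y" using assms hom_group_if_hom by blast
  show ?thesis using H.m_closed assms by simp
qed

lemma add_assoc:
  assumes "f \<in> Hom C X Y" "g \<in> Hom C X Y" "h \<in> Hom C X Y"
  shows "Add C (Add C f g) h = Add C f (Add C g h)"
proof -
  interpret H: comm_group "hom_group C X Y" using assms hom_group_if_hom by blast
  show ?thesis using H.m_assoc assms by simp
qed

lemma add_comm:
  assumes "f \<in> Hom C X Y" "g \<in> Hom C X Y"
  shows "Add C f g = Add C g f"
proof -
  interpret H: comm_group "hom_group C X Y" using assms hom_group_if_hom by blast
  show ?thesis using H.m_comm assms by simp
qed

lemma add_zer:
  assumes "f \<in> Hom C X Y"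
  shows "Add C f (Zer C X Y) = f" "Add C (Zer C X Y) f = f"
proof -
  interpret H: comm_group "hom_group C X Y" using assms hom_group_if_hom by blast
  show "Add C f (Zer C X Y) = f" "Add C (Zer C X Y) f = f" using H.r_one H.l_one assms by simp_all
qed

lemma neg_hom:
  assumes "f \<in> Hom C X Y"
  shows "Neg C f \<in> Hom C X Y"
proof -
  interpret H: comm_group "hom_group C X Y" using assms hom_group_if_hom by blast
  show ?thesis using H.inv_closed neg_in_group assms by simp
qed

lemma add_neg:
  assumes "f \<in> Hom C X Y"
  shows "Add C f (Neg C f) = Zer C X Y" "Add C (Neg C f) f = Zer C X Y"
proof -
  interpret H: comm_group "hom_group C X Y" using assms hom_group_if_hom by blast
  show "Add C f (Neg C f) = Zer C X Y" "Add C (Neg C f) f = Zer C X Y"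
    using H.r_inv H.l_inv neg_in_group assms by simp_all
qed

lemma neg_unique:
  assumes "f \<in> Hom C X Y" "g \<in> Hom C X Y" "Add C f g = Zer C X Y"
  shows "g = Neg C f"
proof -
  interpret H: comm_group "hom_group C X Y" using assms hom_group_if_hom by blast
  show ?thesis using H.inv_equality[of g f] neg_in_group[of f X Y] assms add_comm[of f X Y g] by simp
qed

lemma neg_neg: "f \<in> Hom C X Y \<Longrightarrow> Neg C (Neg C f) = f"
  by (metis add_neg(2) neg_hom neg_unique)

lemma neg_zer:
  assumes "X \<in> Ob C" "Y \<in> Ob C"
  shows "Neg C (Zer C X Y) = Zer C X Y"
  by (metis add_zer(1) assms neg_unique zer_hom)

lemma eq_if_diff_zer:
  assumes "f \<in> Hom C X Y" "g \<in> Hom C X Y" "Add C f (Neg C g) = Zer C X Y"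
  shows "f = g"
  by (metis assms neg_hom neg_neg neg_unique)

text \<open>The way to see that an additive map preserves zero: it sends zero to an arrow equal to
  its own double.\<close>

lemma zer_if_add_self:
  assumes "f \<in> Hom C X Y" "Add C f f = f"
  shows "f = Zer C X Y"
  by (metis add_assoc add_neg(1) add_zer(1) assms neg_hom)

lemma cmp_zer_right:
  assumes "g \<in> Hom C Y Z" "X \<in> Ob C"
  shows "g \<cdot> Zer C X Y = Zer C X Z"
proof -
  have z: "Zer C X Y \<in> Hom C X Y" using assms hom_obD(1) zer_hom by blast
  then have "Add C (g \<cdot> Zer C X Y) (g \<cdot> Zer C X Y) = g \<cdot> Zer C X Y"
    using cmp_add_right[OF z z assms(1)] add_zer[OF z] by simp
  then show ?thesis using zer_if_add_self cmp_hom[OF z assms(1)] by blast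
qed

lemma cmp_zer_left:
  assumes "f \<in> Hom C X Y" "Z \<in> Ob C"
  shows "Zer C Y Z \<cdot> f = Zer C X Z"
proof -
  have z: "Zer C Y Z \<in> Hom C Y Z" using assms hom_obD(2) zer_hom by blast
  then have "Add C (Zer C Y Z \<cdot> f) (Zer C Y Z \<cdot> f) = Zer C Y Z \<cdot> f"
    using cmp_add_left[OF assms(1) z z] add_zer[OF z] by simp
  then show ?thesis using zer_if_add_self cmp_hom[OF assms(1) z] by blast
qed

lemma cmp_neg_right:
  assumes "f \<in> Hom C X Y" "g \<in> Hom C Y Z"
  shows "g \<cdot> Neg C f = Neg C (g \<cdot> f)"
  using neg_unique[OF cmp_hom[OF assms] cmp_hom[OF neg_hom[OF assms(1)] assms(2)]]
    cmp_add_right[OF assms(1) neg_hom[OF assms(1)] assms(2)] add_neg[OF assms(1)]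
    cmp_zer_right[OF assms(2) hom_obD(1)[OF assms(1)]] by simp

lemma cmp_neg_left:
  assumes "f \<in> Hom C X Y" "g \<in> Hom C Y Z"
  shows "Neg C g \<cdot> f = Neg C (g \<cdot> f)"
  using neg_unique[OF cmp_hom[OF assms] cmp_hom[OF assms(1) neg_hom[OF assms(2)]]]
    cmp_add_left[OF assms(1,2) neg_hom[OF assms(2)]] add_neg[OF assms(2)]
    cmp_zer_left[OF assms(1) hom_obD(2)[OF assms(2)]] by simp

lemma hom_from_zero: "\<lbrakk>zero_object C Z; f \<in> Hom C Z X\<rbrakk> \<Longrightarrow> f = Zer C Z X"
  and hom_to_zero: "\<lbrakk>zero_object C Z; f \<in> Hom C X Z\<rbrakk> \<Longrightarrow> f = Zer C X Z"
  using hom_obD by (fastforce simp: zero_object_def)+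

lemma zero_object_iff: "zero_object C Z \<longleftrightarrow> Z \<in> Ob C \<and> Idn C Z = Zer C Z Z"
proof
  assume "zero_object C Z"
  then show "Z \<in> Ob C \<and> Idn C Z = Zer C Z Z"
    using hom_to_zero[of Z _ Z] idn_hom[of Z] by (auto simp: zero_object_def)
next
  assume Z: "Z \<in> Ob C \<and> Idn C Z = Zer C Z Z"
  have "f = Zer C X Z" if "f \<in> Hom C X Z" for f X
    using Z cmp_idn_left[OF that] cmp_zer_left[OF that] by simp
  moreover have "f = Zer C Z X" if "f \<in> Hom C Z X" for f X
    using Z cmp_idn_right[OF that] cmp_zer_right[OF that] by simp
  ultimately show "zero_object C Z"
    using Z zer_hom by (auto simp: zero_object_def)
qed

end

section \<open>Integer powers of a bijection\<close>

lemma int_iterate_in: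
  assumes "bij_betw f A A" "x \<in> A"
  shows "int_iterate f A n x \<in> A"
proof -
  have f: "f y \<in> A" "inv_into A f y \<in> A" if "y \<in> A" for y
    using that assms(1) bij_betwE bij_betw_inv_into by blast+
  have "(f ^^ k) x \<in> A \<and> (inv_into A f ^^ k) x \<in> A" for k
    using assms(2) f by (induction k) auto
  then show ?thesis by (simp add: int_iterate_def)
qed

lemma int_iterate_0 [simp]: "int_iterate f A 0 = id"
  by (simp add: int_iterate_def fun_eq_iff)

lemma int_iterate_1 [simp]: "int_iterate f A 1 = f"
  by (simp add: int_iterate_def)

lemma int_iterate_Suc:
  assumes "bij_betw f A A" "x \<in> A"
  shows "int_iterate f A (n + 1) x = f (int_iterate f A n x)"
proof (cases "n \<ge> 0")
  case True
  then have "nat (n + 1) = Suc (nat n)" by simp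
  then show ?thesis using True by (simp add: int_iterate_def)
next
  case False
  then have *: "nat (- n) = Suc (nat (- (n + 1)))" by simp
  \<comment> \<open>For \<open>n = -1\<close> the exponent \<open>n + 1\<close> falls under the
    nonnegative branch of the definition; there both branches are the identity.\<close>
  have "int_iterate f A (n + 1) x = (inv_into A f ^^ nat (- (n + 1))) x"
    using False by (cases "n + 1 = 0") (auto simp: int_iterate_def)
  moreover have "(inv_into A f ^^ nat (- (n + 1))) x \<in> A"
    using int_iterate_in[OF assms, of "n + 1"] calculation by simp
  ultimately show ?thesis
    using False * assms(1) by (simp add: int_iterate_def bij_betw_def f_inv_into_f)
qed

lemma int_iterate_add:
  assumes "bij_betw f A A" "x \<in> A"
  shows "int_iterate f A (m + n) x = int_iterate f A m (int_iterate f A n x)"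
proof (induction m rule: int_induct[where k = 0])
  case (step1 i)
  then show ?case
    using int_iterate_Suc[OF assms, of "i + n"] int_iterate_Suc[OF assms(1) int_iterate_in[OF assms], of i n]
    by (simp add: algebra_simps)
next
  case (step2 i)
  have "f (int_iterate f A (i - 1 + n) x) = f (int_iterate f A (i - 1) (int_iterate f A n x))"
    using step2 int_iterate_Suc[OF assms, of "i - 1 + n"]
      int_iterate_Suc[OF assms(1) int_iterate_in[OF assms], of "i - 1" n]
    by (simp add: algebra_simps)
  then show ?case
    using assms int_iterate_in[OF assms(1)] by (metis bij_betw_inv_into_left)
qed simp

context additive_category_with_suspension
begin

abbreviation susp_ob where "susp_ob \<equiv> SOb_pow C"
abbreviation susp_ar where "susp_ar \<equiv> SAr_pow C"

lemma susp_pow_ob: "X \<in> Ob C \<Longrightarrow> susp_ob n X \<in> Ob C"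
  using int_iterate_in susp_ob_bij by metis

lemma susp_ob_add: "X \<in> Ob C \<Longrightarrow> susp_ob (m + n) X = susp_ob m (susp_ob n X)"
  using int_iterate_add susp_ob_bij by metis

lemma susp_ob_Suc: "X \<in> Ob C \<Longrightarrow> susp_ob (n + 1) X = SOb C (susp_ob n X)"
  using int_iterate_Suc susp_ob_bij by metis

lemma susp_ar_add: "f \<in> Hom C X Y \<Longrightarrow> susp_ar (m + n) f = susp_ar m (susp_ar n f)"
  using int_iterate_add susp_ar_bij Hom_ArD by metis

lemma susp_ar_Suc: "f \<in> Hom C X Y \<Longrightarrow> susp_ar (n + 1) f = SAr C (susp_ar n f)"
  using int_iterate_Suc susp_ar_bij Hom_ArD by metis

text \<open>\<open>SAr C\<close> is only assumed to permute the set of all arrows. Injectivity of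
  the suspension on objects recovers the ends of a desuspended arrow.\<close>

lemma susp_hom_iff:
  assumes "f \<in> Ar C" "X \<in> Ob C" "Y \<in> Ob C"
  shows "SAr C f \<in> Hom C (SOb C X) (SOb C Y) \<longleftrightarrow> f \<in> Hom C X Y"
proof
  assume "SAr C f \<in> Hom C (SOb C X) (SOb C Y)"
  moreover have "SAr C f \<in> Hom C (SOb C (Dom C f)) (SOb C (Cod C f))"
    using susp_hom Ar_HomI assms(1) by metis
  ultimately have "SOb C X = SOb C (Dom C f)" "SOb C Y = SOb C (Cod C f)"
    by (auto simp: Hom_def)
  then have "X = Dom C f" "Y = Cod C f"
    using assms dom_cod susp_ob_bij by (metis bij_betw_inv_into_left)+
  then show "f \<in> Hom C X Y" using assms(1) by (simp add: Hom_def)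
qed (rule susp_hom)

lemma desuspend_ob:
  assumes "X \<in> Ob C"
  obtains X' where "X' \<in> Ob C" "SOb C X' = X"
  using assms susp_ob_bij by (metis bij_betw_imp_surj_on imageE)

lemma desuspend_ar:
  assumes "f \<in> Hom C (SOb C X) (SOb C Y)" "X \<in> Ob C" "Y \<in> Ob C"
  obtains f' where "f' \<in> Hom C X Y" "SAr C f' = f"
proof -
  obtain f' where f': "f' \<in> Ar C" "SAr C f' = f"
    using Hom_ArD[OF assms(1)] susp_ar_bij by (metis bij_betw_imp_surj_on imageE)
  then show thesis using that susp_hom_iff assms by metis
qed

lemma susp_inj:
  "\<lbrakk>f \<in> Hom C X Y; g \<in> Hom C X' Y'; SAr C f = SAr C g\<rbrakk> \<Longrightarrow> f = g"
  using susp_ar_bij by (metis Hom_ArD bij_betw_inv_into_left)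

lemma susp_zer:
  assumes "X \<in> Ob C" "Y \<in> Ob C"
  shows "SAr C (Zer C X Y) = Zer C (SOb C X) (SOb C Y)"
  by (metis add_zer(1) assms susp_add susp_hom zer_hom zer_if_add_self)

lemma susp_zer_iff:
  assumes "f \<in> Hom C X Y"
  shows "SAr C f = Zer C (SOb C X) (SOb C Y) \<longleftrightarrow> f = Zer C X Y"
  by (metis assms hom_obD susp_inj susp_zer zer_hom)

lemma susp_neg:
  assumes "f \<in> Hom C X Y"
  shows "SAr C (Neg C f) = Neg C (SAr C f)"
  using neg_unique[OF susp_hom[OF assms] susp_hom[OF neg_hom[OF assms]]]
    susp_add[OF assms neg_hom[OF assms]] add_neg[OF assms] susp_zer hom_obD[OF assms] by simp

lemma susp_ob_ob: "X \<in> Ob C \<Longrightarrow> SOb C X \<in> Ob C"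
  using susp_ob_bij bij_betwE by blast

lemma susp_zero_object:
  assumes "X \<in> Ob C"
  shows "zero_object C (SOb C X) \<longleftrightarrow> zero_object C X"
  using assms susp_zer_iff[OF idn_hom[OF assms]] by (simp add: zero_object_iff susp_idn susp_ob_ob)

lemma susp_pow_hom:
  assumes "f \<in> Hom C X Y"
  shows "susp_ar n f \<in> Hom C (susp_ob n X) (susp_ob n Y)"
proof (induction n rule: int_induct[where k = 0])
  case (step1 i)
  then show ?case
    using susp_hom susp_ar_Suc[OF assms] susp_ob_Suc hom_obD[OF assms] by metis
next
  case (step2 i)
  \<comment> \<open>The hypothesis at \<open>i\<close> is read as a statement about the suspension
    of the arrow at \<open>i - 1\<close>; \<open>susp_hom_iff\<close> then removes that
    suspension.\<close>
  have "SAr C (susp_ar (i - 1) f) \<in> Hom C (SOb C (susp_ob (i - 1) X)) (SOb C (susp_ob (i - 1) Y))"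
    using step2 susp_ar_Suc[OF assms, of "i - 1"] susp_ob_Suc[of _ "i - 1"] hom_obD[OF assms] by simp
  moreover have "susp_ar (i - 1) f \<in> Ar C"
    using int_iterate_in[OF susp_ar_bij Hom_ArD[OF assms]] .
  ultimately show ?case
    using susp_hom_iff susp_pow_ob hom_obD[OF assms] by metis
qed (simp add: assms)

lemma susp_pow_cmp:
  assumes "f \<in> Hom C X Y" "g \<in> Hom C Y Z"
  shows "susp_ar n (g \<cdot> f) = susp_ar n g \<cdot> susp_ar n f"
proof (induction n rule: int_induct[where k = 0])
  case (step1 i)
  then show ?case
    using susp_ar_Suc[OF assms(1)] susp_ar_Suc[OF assms(2)] susp_ar_Suc[OF cmp_hom[OF assms]]
      susp_cmp[OF susp_pow_hom[OF assms(1)] susp_pow_hom[OF assms(2)]] by simp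
next
  case (step2 i)
  have "SAr C (susp_ar (i - 1) (g \<cdot> f)) = SAr C (susp_ar (i - 1) g \<cdot> susp_ar (i - 1) f)"
    using step2 susp_ar_Suc[OF assms(1), of "i - 1"] susp_ar_Suc[OF assms(2), of "i - 1"]
      susp_ar_Suc[OF cmp_hom[OF assms], of "i - 1"]
      susp_cmp[OF susp_pow_hom[OF assms(1), of "i - 1"] susp_pow_hom[OF assms(2), of "i - 1"]]
    by simp
  then show ?case
    by (rule susp_inj[OF susp_pow_hom[OF cmp_hom[OF assms]]
          cmp_hom[OF susp_pow_hom[OF assms(1)] susp_pow_hom[OF assms(2)]]])
qed simp

lemma susp_pow_zer:
  assumes "X \<in> Ob C" "Y \<in> Ob C"
  shows "susp_ar n (Zer C X Y) = Zer C (susp_ob n X) (susp_ob n Y)"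
proof (induction n rule: int_induct[where k = 0])
  case (step1 i)
  then show ?case
    using susp_ar_Suc assms susp_zer susp_ob_Suc susp_pow_ob zer_hom by metis
next
  case (step2 i)
  then show ?case
    using susp_ar_Suc[OF zer_hom[OF assms], of "i - 1"] susp_ob_Suc[of _ "i - 1"] assms
      susp_zer_iff[OF susp_pow_hom[OF zer_hom[OF assms]], of "i - 1"] by simp
qed simp

end

section \<open>Triangles and thick subcategories\<close>

context triangulated_category
begin

abbreviation tri_comp (infixr "\<cdot>" 70) where "g \<cdot> f \<equiv> Cmp T g f"

definition triangle :: "'o \<Rightarrow> 'o \<Rightarrow> 'o \<Rightarrow> 'm \<Rightarrow> 'm \<Rightarrow> 'm \<Rightarrow> bool" where
  "triangle X Y Z u v w \<longleftrightarrow> u \<in> Hom T X Y \<and> v \<in> Hom T Y Z \<and> w \<in> Hom T Z (SOb T X) \<and> (u, v, w) \<in> Tri T"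

lemma triangleD:
  assumes "triangle X Y Z u v w"
  shows "u \<in> Hom T X Y" "v \<in> Hom T Y Z" "w \<in> Hom T Z (SOb T X)" "(u, v, w) \<in> Tri T"
    "X \<in> Ob T" "Y \<in> Ob T" "Z \<in> Ob T"
  using assms hom_obD by (auto simp: triangle_def)

lemma triangle_if_Tri: "(u, v, w) \<in> Tri T \<Longrightarrow> triangle (Dom T u) (Cod T u) (Cod T v) u v w"
  using tri_candidate by (fastforce simp: triangle_def candidate_triangle_def Hom_def)

lemma triangle_if_Tri_hom: "\<lbrakk>(u, v, w) \<in> Tri T; u \<in> Hom T X Y\<rbrakk> \<Longrightarrow> triangle X Y (Cod T v) u v w"
  using triangle_if_Tri Hom_DomD Hom_CodD by metis

lemma cone_exists:
  assumes "u \<in> Hom T X Y"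
  obtains Z v w where "triangle X Y Z u v w"
  using assms TR1_cone Hom_ArD triangle_if_Tri_hom by metis

lemma triangle_rotate_iff:
  assumes "u \<in> Hom T X Y" "v \<in> Hom T Y Z" "w \<in> Hom T Z (SOb T X)"
  shows "triangle X Y Z u v w \<longleftrightarrow> triangle Y Z (SOb T X) v w (Neg T (SAr T u))"
  using assms TR2[of u v w] neg_hom[OF susp_hom[OF assms(1)]]
  by (auto simp: triangle_def candidate_triangle_def)

lemma triangle_rotate:
  "triangle X Y Z u v w \<Longrightarrow> triangle Y Z (SOb T X) v w (Neg T (SAr T u))"
  using triangle_rotate_iff[of u X Y v Z w] triangleD(1-3)[of X Y Z u v w] by blast

text \<open>Rotating backwards works on the nose because the suspension is bijective on objects and
  arrows; negating \<open>m\<close> before desuspending produces the sign in TR2.\<close>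

lemma triangle_unrotate:
  assumes "triangle Y Z X' v w m"
  obtains X u where "X \<in> Ob T" "SOb T X = X'" "triangle X Y Z u v w" "m = Neg T (SAr T u)"
proof -
  note t = triangleD[OF assms]
  obtain X where X: "X \<in> Ob T" "SOb T X = X'"
    using desuspend_ob t(7) by blast
  have "Neg T m \<in> Hom T (SOb T X) (SOb T Y)"
    using neg_hom t X by blast
  then obtain u where u: "u \<in> Hom T X Y" "SAr T u = Neg T m"
    using desuspend_ar X t by blast
  then have m: "m = Neg T (SAr T u)"
    using neg_neg t(3) by metis
  then have "triangle X Y Z u v w"
    using triangle_rotate_iff[OF u(1) t(1)] X t assms by blast
  then show thesis using that X m by blast
qed

lemma fibre_exists:
  assumes "v \<in> Hom T Y Z"
  obtains X u w where "triangle X Y Z u v w"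
  using assms cone_exists triangle_unrotate by metis

lemma triangle_fibre:
  assumes "triangle X Y Z u v w"
  obtains Z' e where "Z' \<in> Ob T" "SOb T Z' = Z" "triangle Z' X Y e u v" "w = Neg T (SAr T e)"
  using assms triangle_unrotate by metis

lemma a_zero_object:
  obtains Z where "zero_object T Z" "Z \<in> Ob T"
  using zero_object_exists zero_object_iff by blast

lemma triangle_idn:
  assumes "X \<in> Ob T" "zero_object T Z"
  shows "triangle X X Z (Idn T X) (Zer T X Z) (Zer T Z (SOb T X))"
  using assms TR1_identity idn_hom zer_hom susp_ob_ob zero_object_iff by (simp add: triangle_def)

text \<open>Its rotation is the identity triangle with zero object \<open>SOb T Z\<close>, the sign
  being invisible on a zero arrow.\<close>

lemma triangle_from_zero:
  assumes "X \<in> Ob T" "zero_object T Z"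
  shows "triangle Z X X (Zer T Z X) (Idn T X) (Zer T X (SOb T Z))"
proof -
  have Z: "Z \<in> Ob T" "zero_object T (SOb T Z)"
    using assms zero_object_iff susp_zero_object by blast+
  then have "Neg T (SAr T (Zer T Z X)) = Zer T (SOb T Z) (SOb T X)"
    using assms by (simp add: susp_zer neg_zer susp_ob_ob)
  then show ?thesis
    using triangle_rotate_iff[of "Zer T Z X" Z X "Idn T X" X "Zer T X (SOb T Z)"]
      triangle_idn[OF assms(1) Z(2)] assms(1) Z(1) zer_hom idn_hom susp_ob_ob by simp
qed

lemma triangle_map:
  assumes "triangle X Y Z u v w" "triangle X' Y' Z' u' v' w'"
    and "a \<in> Hom T X X'" "b \<in> Hom T Y Y'" "b \<cdot> u = u' \<cdot> a"
  obtains c where "c \<in> Hom T Z Z'" "c \<cdot> v = v' \<cdot> b" "SAr T a \<cdot> w = w' \<cdot> c"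
proof -
  note t = triangleD[OF assms(1)] and t' = triangleD[OF assms(2)]
  have d: "Dom T u = X" "Dom T u' = X'" "Cod T u = Y" "Cod T u' = Y'" "Dom T w = Z" "Dom T w' = Z'"
    using t t' by (auto simp: Hom_def)
  obtain c where "triangle_morphism T (a, b, c) (u, v, w) (u', v', w')"
    using TR3[OF t(4) t'(4), of a b] assms(3-5) d by auto
  then show thesis using that d by (auto simp: triangle_morphism_def)
qed

text \<open>The pair (identity, \<open>u\<close>) maps the identity triangle of \<open>X\<close> to
  this one. The third component starts at a zero object, and its square gives the claim.\<close>

lemma triangle_comp_zero:
  assumes "triangle X Y Z u v w"
  shows "v \<cdot> u = Zer T X Z"
proof -
  note t = triangleD[OF assms]
  obtain O' where O: "zero_object T O'" "O' \<in> Ob T" by (rule a_zero_object)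
  have "u \<cdot> Idn T X = u \<cdot> Idn T X" ..
  from triangle_map[OF triangle_idn[OF t(5) O(1)] assms idn_hom[OF t(5)] t(1) this]
  obtain c where c: "c \<in> Hom T O' Z" "c \<cdot> Zer T X O' = v \<cdot> u" by blast
  then show ?thesis using cmp_zer_right t(5) by metis
qed

text \<open>TR3 for a morphism into the triangle \<open>0 -> W -> W\<close>: the completing arrow is
  the factorisation.\<close>

lemma factor_cone:
  assumes "triangle X Y Z u v w" "f \<in> Hom T Y W" "f \<cdot> u = Zer T X W"
  obtains g where "g \<in> Hom T Z W" "f = g \<cdot> v"
proof -
  note t = triangleD[OF assms(1)]
  have W: "W \<in> Ob T" using assms(2) hom_obD by blast
  obtain O' where O: "zero_object T O'" "O' \<in> Ob T" by (rule a_zero_object)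
  have "f \<cdot> u = Zer T O' W \<cdot> Zer T X O'"
    using assms(3) cmp_zer_left[OF zer_hom[OF t(5) O(2)] W] by simp
  from triangle_map[OF assms(1) triangle_from_zero[OF W O(1)] zer_hom[OF t(5) O(2)] assms(2) this]
  obtain c where "c \<in> Hom T Z W" "c \<cdot> v = Idn T W \<cdot> f" by blast
  then show thesis using that assms(2) by simp
qed

text \<open>TR3 supplies only the third component of a morphism, so both triangles are rotated once
  to make the wanted arrow third. It arrives suspended, with the same sign on both sides.\<close>

lemma factor_fibre:
  assumes "triangle X Y Z u v w" "f \<in> Hom T W Y" "v \<cdot> f = Zer T W Z"
  obtains g where "g \<in> Hom T W X" "f = u \<cdot> g"
proof -
  note t = triangleD[OF assms(1)]
  have W: "W \<in> Ob T" using assms(2) hom_obD by blast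
  obtain O' where O: "zero_object T O'" "O' \<in> Ob T" by (rule a_zero_object)
  have "Zer T O' Z \<cdot> Zer T W O' = v \<cdot> f"
    using assms(3) cmp_zer_left[OF zer_hom[OF W O(2)] t(7)] by simp
  from triangle_map[OF triangle_rotate[OF triangle_idn[OF W O(1)]] triangle_rotate[OF assms(1)]
      assms(2) zer_hom[OF O(2) t(7)] this]
  obtain c where c: "c \<in> Hom T (SOb T W) (SOb T X)"
    "SAr T f \<cdot> Neg T (SAr T (Idn T W)) = Neg T (SAr T u) \<cdot> c" by blast
  obtain g where g: "g \<in> Hom T W X" "SAr T g = c"
    using desuspend_ar c(1) W t(5) by blast
  note iW = idn_hom[OF W]
  have "Neg T (SAr T f) = Neg T (SAr T (u \<cdot> g))"
    using c(2) g(2) cmp_neg_right[OF susp_hom[OF iW] susp_hom[OF assms(2)]]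
      cmp_neg_left[OF c(1) susp_hom[OF t(1)]] susp_cmp[OF g(1) t(1)]
      susp_cmp[OF iW assms(2)] assms(2) by simp
  then have "Neg T (Neg T (SAr T f)) = Neg T (Neg T (SAr T (u \<cdot> g)))"
    by (rule arg_cong)
  then have "SAr T f = SAr T (u \<cdot> g)"
    using neg_neg[OF susp_hom[OF assms(2)]] neg_neg[OF susp_hom[OF cmp_hom[OF g(1) t(1)]]] by simp
  then show thesis
    using that g(1) susp_inj assms(2) cmp_hom[OF g(1) t(1)] by blast
qed

lemma triangle_iso:
  assumes "triangle X Y Z u v w" "u' \<in> Hom T X' Y'" "v' \<in> Hom T Y' Z'" "w' \<in> Hom T Z' (SOb T X')"
    and "a \<in> Hom T X X'" "b \<in> Hom T Y Y'" "c \<in> Hom T Z Z'"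
    and "iso_arrow T a" "iso_arrow T b" "iso_arrow T c"
    and "b \<cdot> u = u' \<cdot> a" "c \<cdot> v = v' \<cdot> b" "SAr T a \<cdot> w = w' \<cdot> c"
  shows "triangle X' Y' Z' u' v' w'"
proof -
  note t = triangleD[OF assms(1)]
  have d: "Dom T u = X" "Dom T u' = X'" "Dom T v = Y" "Dom T v' = Y'" "Dom T w = Z" "Dom T w' = Z'"
    using t assms(2-4) by (auto simp: Hom_def)
  have "triangles_isomorphic T (u, v, w) (u', v', w')"
    unfolding triangles_isomorphic_def
    using assms d by (intro exI[of _ a] exI[of _ b] exI[of _ c]) (simp add: triangle_morphism_def)
  moreover have "candidate_triangle T (u', v', w')"
    using assms(2-4) by (auto simp: candidate_triangle_def)
  ultimately show ?thesis
    using TR1_iso t(4) assms(2-4) by (simp add: triangle_def)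
qed

section \<open>Retracts and a criterion for thickness\<close>

definition retract :: "'o \<Rightarrow> 'o \<Rightarrow> bool" where
  "retract X Y \<longleftrightarrow> (\<exists>i \<in> Hom T X Y. \<exists>p \<in> Hom T Y X. p \<cdot> i = Idn T X)"

text \<open>The complement is the cone of \<open>i\<close>. The idempotent \<open>Idn - i p\<close>
  kills \<open>i\<close>, hence is \<open>j k\<close> with \<open>k\<close> the arrow to the cone;
  the equations for \<open>j\<close> hold after composing with \<open>k\<close>, which is epic
  because \<open>i\<close> splits. Thickness is defined by summands, while the arguments below
  produce retracts.\<close>

lemma split_mono_complement:
  assumes i: "i \<in> Hom T X Y" and p: "p \<in> Hom T Y X" and pi: "p \<cdot> i = Idn T X"
  obtains X' where "direct_sum_of T X X' Y"
proof -
  note X = hom_obD(1)[OF i] and Y = hom_obD(2)[OF i]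
  obtain X' k w where tri: "triangle X Y X' i k w" using cone_exists i by blast
  note t = triangleD[OF tri]
  note iY = idn_hom[OF Y] and ip = cmp_hom[OF p i] and nip = neg_hom[OF cmp_hom[OF p i]]
  let ?e = "Add T (Idn T Y) (Neg T (i \<cdot> p))"
  have e: "?e \<in> Hom T Y Y" using add_hom iY nip by blast
  have ipi: "(i \<cdot> p) \<cdot> i = i" using cmp_assoc[OF i p i] pi i by simp
  have pip: "p \<cdot> (i \<cdot> p) = p" using cmp_assoc[OF p i p] pi p by simp
  have "?e \<cdot> i = Zer T X Y"
    using cmp_add_left[OF i iY nip] cmp_neg_left[OF i ip] ipi add_neg[OF i] i by simp
  then obtain j where j: "j \<in> Hom T X' Y" "?e = j \<cdot> k" using factor_cone[OF tri e] by blast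
  have epi: "f = g"
    if f: "f \<in> Hom T X' W" and g: "g \<in> Hom T X' W" and fk: "f \<cdot> k = g \<cdot> k" for f g W
  proof -
    let ?d = "Add T f (Neg T g)"
    have "?d \<cdot> k = Zer T Y W"
      using cmp_add_left[OF t(2) f neg_hom[OF g]] cmp_neg_left[OF t(2) g]
        fk add_neg[OF cmp_hom[OF t(2) g]] by simp
    then obtain h where h: "h \<in> Hom T (SOb T X) W" "?d = h \<cdot> w"
      using factor_cone[OF triangle_rotate[OF tri] add_hom[OF f neg_hom[OF g]]] by blast
    \<comment> \<open>the connecting map vanishes because it is killed by the split mono \<open>SAr T i\<close>\<close>
    have "Neg T (SAr T i) \<cdot> w = Zer T X' (SOb T Y)"
      using triangle_comp_zero[OF triangle_rotate[OF triangle_rotate[OF tri]]] .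
    then have "Neg T (SAr T i \<cdot> w) = Zer T X' (SOb T Y)"
      using cmp_neg_left[OF t(3) susp_hom[OF i]] by simp
    then have "SAr T i \<cdot> w = Zer T X' (SOb T Y)"
      using neg_neg[OF cmp_hom[OF t(3) susp_hom[OF i]]] neg_zer t(7) susp_ob_ob Y by metis
    then have "SAr T p \<cdot> SAr T i \<cdot> w = Zer T X' (SOb T X)"
      using cmp_zer_right[OF susp_hom[OF p] t(7)] by simp
    moreover have "SAr T p \<cdot> SAr T i = Idn T (SOb T X)"
      using susp_cmp[OF i p, symmetric] pi susp_idn[OF X] by simp
    ultimately have "w = Zer T X' (SOb T X)"
      using cmp_assoc[OF t(3) susp_hom[OF i] susp_hom[OF p]] cmp_idn_left[OF t(3)] by simp
    then have "?d = Zer T X' W"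
      using h cmp_zer_right t(7) by metis
    then show ?thesis using eq_if_diff_zer f g by blast
  qed
  have ki: "k \<cdot> i = Zer T X X'" using triangle_comp_zero[OF tri] .
  have "k \<cdot> ?e = k"
    using cmp_add_right[OF iY nip t(2)] cmp_neg_right[OF ip t(2)] cmp_assoc[OF p i t(2)] ki
      cmp_zer_left[OF p t(7)] neg_zer[OF Y t(7)] add_zer[OF t(2)] t(2) by simp
  then have "(k \<cdot> j) \<cdot> k = Idn T X' \<cdot> k"
    using j cmp_assoc[OF t(2) j(1) t(2)] t(2) by simp
  then have kj: "k \<cdot> j = Idn T X'"
    using epi cmp_hom[OF j(1) t(2)] idn_hom[OF t(7)] by blast
  have "p \<cdot> ?e = Zer T Y X"
    using cmp_add_right[OF iY nip p] cmp_neg_right[OF ip p] pip p add_neg[OF p] by simp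
  then have "(p \<cdot> j) \<cdot> k = Zer T X' X \<cdot> k"
    using j cmp_assoc[OF t(2) j(1) p] cmp_zer_left[OF t(2) X] by simp
  then have pj: "p \<cdot> j = Zer T X' X"
    using epi cmp_hom[OF j(1) p] zer_hom[OF t(7) X] by blast
  have "Add T (i \<cdot> p) (j \<cdot> k) = Idn T Y"
    using j(2)[symmetric] add_comm[OF ip e] add_assoc[OF iY nip ip] add_neg[OF ip] add_zer[OF iY] by simp
  then have "direct_sum_of T X X' Y"
    unfolding direct_sum_of_def using i p t j pi kj pj ki by blast
  then show thesis using that by blast
qed

lemma thick_retract:
  assumes "thick T U" "retract X Y" "Y \<in> U"
  shows "X \<in> U"
proof -
  obtain X' where "direct_sum_of T X X' Y"
    using split_mono_complement assms(2) unfolding retract_def by metis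
  then show ?thesis using assms(1,3) unfolding thick_def by blast
qed

lemma thick_sub: "thick T U \<Longrightarrow> X \<in> U \<Longrightarrow> X \<in> Ob T"
  unfolding thick_def by blast

lemma thick_triangle:
  assumes "thick T U" "triangle X Y Z u v w"
  shows "\<lbrakk>X \<in> U; Y \<in> U\<rbrakk> \<Longrightarrow> Z \<in> U" "\<lbrakk>Y \<in> U; Z \<in> U\<rbrakk> \<Longrightarrow> X \<in> U" "\<lbrakk>X \<in> U; Z \<in> U\<rbrakk> \<Longrightarrow> Y \<in> U"
proof -
  note t = triangleD[OF assms(2)]
  have d: "Dom T u = X" "Cod T u = Y" "Cod T v = Z" using t by (auto simp: Hom_def)
  show "\<lbrakk>X \<in> U; Y \<in> U\<rbrakk> \<Longrightarrow> Z \<in> U" "\<lbrakk>Y \<in> U; Z \<in> U\<rbrakk> \<Longrightarrow> X \<in> U" "\<lbrakk>X \<in> U; Z \<in> U\<rbrakk> \<Longrightarrow> Y \<in> U"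
    using assms(1) t(4) d unfolding thick_def by metis+
qed

lemma zero_retract:
  assumes "zero_object T Z" "Y \<in> Ob T"
  shows "retract Z Y"
proof -
  have Z: "Z \<in> Ob T" "Idn T Z = Zer T Z Z" using assms(1) zero_object_iff by blast+
  then have "Zer T Y Z \<cdot> Zer T Z Y = Idn T Z"
    using cmp_zer_left[OF zer_hom[OF Z(1) assms(2)] Z(1)] by simp
  then show ?thesis using zer_hom Z(1) assms(2) unfolding retract_def by blast
qed

lemma thick_zero: "\<lbrakk>thick T U; zero_object T Z\<rbrakk> \<Longrightarrow> Z \<in> U"
  using zero_retract thick_retract thick_sub unfolding thick_def by blast

text \<open>Closure under isomorphisms and under summands are both instances of closure under
  retracts, and the other two triangle conditions are closure under extensions for rotated
  triangles.\<close>

lemma thickI: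
  assumes sub: "U \<subseteq> Ob T" and zero: "\<And>Z. zero_object T Z \<Longrightarrow> Z \<in> U"
    and susp: "\<And>X. X \<in> Ob T \<Longrightarrow> SOb T X \<in> U \<longleftrightarrow> X \<in> U"
    and retr: "\<And>X Y. \<lbrakk>retract X Y; Y \<in> U\<rbrakk> \<Longrightarrow> X \<in> U"
    and ext: "\<And>X Y Z u v w. \<lbrakk>triangle X Y Z u v w; X \<in> U; Z \<in> U\<rbrakk> \<Longrightarrow> Y \<in> U"
  shows "thick T U"
  unfolding thick_def
proof (intro conjI allI impI ballI)
  show "U \<subseteq> Ob T" by (rule sub)
  show "\<exists>Z\<in>U. zero_object T Z" using zero zero_object_exists by blast
  show "X \<in> U \<longleftrightarrow> SOb T X \<in> U" if "X \<in> Ob T" for X using susp that by blast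
next
  fix f assume f: "iso_arrow T f \<and> Dom T f \<in> U"
  then obtain g where "g \<in> Hom T (Cod T f) (Dom T f)" "f \<cdot> g = Idn T (Cod T f)" "f \<in> Ar T"
    by (auto simp: iso_arrow_def)
  then have "retract (Cod T f) (Dom T f)" using Ar_HomI[of f T] unfolding retract_def by blast
  then show "Cod T f \<in> U" using retr f by blast
next
  fix u v w assume "(u, v, w) \<in> Tri T"
  then have tri: "triangle (Dom T u) (Cod T u) (Cod T v) u v w" by (rule triangle_if_Tri)
  note t = triangleD[OF tri] and r = triangle_rotate[OF tri] and rr = triangle_rotate[OF triangle_rotate[OF tri]]
  show "Cod T v \<in> U" if "Dom T u \<in> U \<and> Cod T u \<in> U"
    using ext[OF r] susp[OF t(5)] that by blast
  show "Dom T u \<in> U" if "Cod T u \<in> U \<and> Cod T v \<in> U"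
    using ext[OF rr] susp[OF t(5)] susp[OF t(6)] that by blast
  show "Cod T u \<in> U" if "Dom T u \<in> U \<and> Cod T v \<in> U"
    using ext[OF tri] that by blast
next
  fix X X' Y assume d: "direct_sum_of T X X' Y \<and> Y \<in> U"
  then have "retract X Y" "retract X' Y" by (auto simp: direct_sum_of_def retract_def)
  then show "X \<in> U" "X' \<in> U" using retr d by blast+
qed

end

section \<open>Calculus of fractions modulo a thick subcategory\<close>

context triangulated_category
begin

lemma cone_inI: "\<lbrakk>triangle X Y Z s v w; Z \<in> U\<rbrakk> \<Longrightarrow> s \<in> cone_in T U"
  using triangleD[of X Y Z s v w] by (auto simp: cone_in_def Hom_def)

lemma cone_inE:
  assumes "s \<in> cone_in T U" "s \<in> Hom T X Y"
  obtains Z v w where "triangle X Y Z s v w" "Z \<in> U"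
  using assms triangle_if_Tri_hom unfolding cone_in_def by blast

lemma cone_in_hom: "s \<in> cone_in T U \<Longrightarrow> s \<in> Hom T (Dom T s) (Cod T s)"
  by (auto simp: cone_in_def Hom_def)

text \<open>Extracts from TR4 the triangle on the three cones, which is the source of
  two-out-of-three for \<open>cone_in\<close>.\<close>

lemma octahedron:
  assumes "triangle X Y A u i i'" "triangle Y Z B v j j'" "triangle X Z E (v \<cdot> u) k k'"
  obtains f g h where "triangle A E B f g h"
proof -
  note t = triangleD[OF assms(1)] and t' = triangleD[OF assms(2)] and t'' = triangleD[OF assms(3)]
  have "Cod T u = Dom T v" "Cod T i = A" "Cod T k = E" "Cod T j = B"
    using t t' t'' by (auto simp: Hom_def)
  then obtain f g where fg: "f \<in> Hom T A E" "g \<in> Hom T E B" "(f, g, SAr T i \<cdot> j') \<in> Tri T"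
    using TR4[OF t(4) t'(4) t''(4)] by auto
  then have "triangle A E B f g (SAr T i \<cdot> j')"
    using triangle_if_Tri_hom[OF fg(3,1)] Hom_CodD[OF fg(2)] by simp
  then show thesis using that by blast
qed

text \<open>By the calculus of fractions these are the arrows that vanish in \<open>T/U\<close>; the
  witness \<open>s\<close> lives in \<open>T\<close>, so no roof is mentioned.\<close>

definition null_mod :: "'o set \<Rightarrow> 'm \<Rightarrow> bool" where
  "null_mod U f \<longleftrightarrow> (\<exists>s \<in> cone_in T U. Cod T s = Dom T f \<and> f \<cdot> s = Zer T (Dom T s) (Cod T f))"

context
  fixes U assumes U: "thick T U"
begin

text \<open>By the octahedral axiom with one arrow an identity, membership does not depend on the chosen cone.\<close>

lemma cone_in_iff:
  assumes "triangle X Y Z s v w"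
  shows "s \<in> cone_in T U \<longleftrightarrow> Z \<in> U"
proof
  assume "s \<in> cone_in T U"
  then obtain Z' v' w' where tri': "triangle X Y Z' s v' w'" "Z' \<in> U"
    using cone_inE triangleD(1)[OF assms] by blast
  obtain O' where O: "zero_object T O'" "O' \<in> Ob T" by (rule a_zero_object)
  have "Idn T Y \<cdot> s = s" using triangleD(1)[OF assms] by simp
  then obtain f g h where "triangle Z Z' O' f g h"
    using octahedron[OF assms triangle_idn[OF triangleD(6)[OF assms] O(1)]] tri'(1) by metis
  then show "Z \<in> U"
    using thick_triangle(2)[OF U] tri'(2) thick_zero[OF U O(1)] by blast
qed (rule cone_inI[OF assms])

text \<open>The cones of \<open>f\<close>, of \<open>g\<close> and of the composite form a triangle,
  and membership in \<open>U\<close> is two-out-of-three on triangles.\<close>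

lemma cone_in_two_of_three:
  assumes "f \<in> Hom T X Y" "g \<in> Hom T Y Z"
  shows "\<lbrakk>f \<in> cone_in T U; g \<in> cone_in T U\<rbrakk> \<Longrightarrow> g \<cdot> f \<in> cone_in T U"
    and "\<lbrakk>f \<in> cone_in T U; g \<cdot> f \<in> cone_in T U\<rbrakk> \<Longrightarrow> g \<in> cone_in T U"
    and "\<lbrakk>g \<in> cone_in T U; g \<cdot> f \<in> cone_in T U\<rbrakk> \<Longrightarrow> f \<in> cone_in T U"
proof -
  obtain A i i' where A: "triangle X Y A f i i'" using cone_exists assms(1) by blast
  obtain B j j' where B: "triangle Y Z B g j j'" using cone_exists assms(2) by blast
  obtain E k k' where E: "triangle X Z E (g \<cdot> f) k k'" using cone_exists cmp_hom[OF assms] by blast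
  obtain a b c where "triangle A E B a b c" using octahedron[OF A B E] by blast
  note thick_triangle[OF U this]
  then show "\<lbrakk>f \<in> cone_in T U; g \<in> cone_in T U\<rbrakk> \<Longrightarrow> g \<cdot> f \<in> cone_in T U"
    "\<lbrakk>f \<in> cone_in T U; g \<cdot> f \<in> cone_in T U\<rbrakk> \<Longrightarrow> g \<in> cone_in T U"
    "\<lbrakk>g \<in> cone_in T U; g \<cdot> f \<in> cone_in T U\<rbrakk> \<Longrightarrow> f \<in> cone_in T U"
    using cone_in_iff[OF A] cone_in_iff[OF B] cone_in_iff[OF E] by blast+
qed

lemma cone_in_iso:
  assumes "f \<in> Hom T X Y" "iso_arrow T f"
  shows "f \<in> cone_in T U"
proof -
  note X = hom_obD(1)[OF assms(1)] and Y = hom_obD(2)[OF assms(1)]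
  obtain O' where O: "zero_object T O'" "O' \<in> Ob T" by (rule a_zero_object)
  have iso: "iso_arrow T (Idn T W)" if "W \<in> Ob T" for W
    using iso_arrow_iff[OF idn_hom[OF that]] idn_hom[OF that] by auto
  have SX: "SOb T X \<in> Ob T" using susp_ob_ob X by blast
  have "triangle X Y O' f (Zer T Y O') (Zer T O' (SOb T X))"
  proof (rule triangle_iso[OF triangle_idn[OF X O(1)], where a = "Idn T X" and b = f and c = "Idn T O'"])
    show "Idn T O' \<cdot> Zer T X O' = Zer T Y O' \<cdot> f"
      using cmp_zer_left[OF assms(1) O(2)] zer_hom[OF X O(2)] by simp
    show "SAr T (Idn T X) \<cdot> Zer T O' (SOb T X) = Zer T O' (SOb T X) \<cdot> Idn T O'"
      using susp_idn[OF X] zer_hom[OF O(2) SX] by simp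
  qed (use assms X Y O SX zer_hom idn_hom iso in simp_all)
  then show ?thesis using cone_inI thick_zero[OF U O(1)] by blast
qed

lemma cone_in_idn: "X \<in> Ob T \<Longrightarrow> Idn T X \<in> cone_in T U"
  using cone_in_iso[OF idn_hom] iso_arrow_iff[OF idn_hom] idn_hom cmp_idn_left by metis

text \<open>Negation is composition with the negated identity, which is its own inverse.\<close>

lemma cone_in_neg:
  assumes "f \<in> Hom T X Y"
  shows "Neg T f \<in> cone_in T U \<longleftrightarrow> f \<in> cone_in T U"
proof -
  have *: "Neg T g \<in> cone_in T U" if g: "g \<in> Hom T X Y" "g \<in> cone_in T U" for g
  proof -
    note i = idn_hom[OF hom_obD(2)[OF assms]]
    note n = neg_hom[OF i]
    have "Neg T (Idn T Y) \<cdot> Neg T (Idn T Y) = Idn T Y"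
      using cmp_neg_left[OF n i] cmp_neg_right[OF i i] i neg_neg[OF i] by simp
    then have "Neg T (Idn T Y) \<in> cone_in T U"
      using cone_in_iso[OF n] iso_arrow_iff[OF n] n by blast
    then show ?thesis
      using cone_in_two_of_three(1)[OF g(1) n g(2)] cmp_neg_left[OF g(1) i] g(1) by simp
  qed
  show ?thesis using *[OF assms] *[OF neg_hom[OF assms]] neg_neg[OF assms] by metis
qed

text \<open>Three rotations turn a triangle on \<open>f\<close> into one on
  \<open>Neg T (SAr T f)\<close> whose cone is the suspended cone.\<close>

lemma cone_in_susp:
  assumes "f \<in> Hom T X Y"
  shows "SAr T f \<in> cone_in T U \<longleftrightarrow> f \<in> cone_in T U"
proof -
  obtain Z v w where t: "triangle X Y Z f v w" using cone_exists assms by blast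
  show ?thesis
    using cone_in_iff[OF triangle_rotate[OF triangle_rotate[OF triangle_rotate[OF t]]]] cone_in_iff[OF t]
      cone_in_neg[OF susp_hom[OF assms]] thick_susp[OF U triangleD(7)[OF t]] by simp
qed

text \<open>A homotopy pullback: \<open>a\<close> is the fibre of \<open>f\<close> followed by the
  arrow \<open>k\<close> to the cone of \<open>t\<close>. Then \<open>k f a = 0\<close> lets
  \<open>f a\<close> factor through \<open>t\<close>, and the cone of \<open>a\<close> is that of
  \<open>t\<close>.\<close>

lemma ore:
  assumes "f \<in> Hom T X Y" "t \<in> Hom T Y' Y" "t \<in> cone_in T U"
  obtains X' a b where "a \<in> Hom T X' X" "a \<in> cone_in T U" "b \<in> Hom T X' Y'" "f \<cdot> a = t \<cdot> b"
proof -
  obtain Z k w where tri: "triangle Y' Y Z t k w" "Z \<in> U" using cone_inE assms(2,3) by blast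
  note k = triangleD(2)[OF tri(1)]
  obtain X' a h where tri': "triangle X' X Z a (k \<cdot> f) h"
    using fibre_exists cmp_hom[OF assms(1) k] by blast
  note a = triangleD(1)[OF tri']
  have "k \<cdot> (f \<cdot> a) = Zer T X' Z"
    using triangle_comp_zero[OF tri'] cmp_assoc[OF a assms(1) k] by simp
  then obtain b where "b \<in> Hom T X' Y'" "f \<cdot> a = t \<cdot> b"
    using factor_fibre[OF tri(1) cmp_hom[OF a assms(1)]] by blast
  then show thesis using that a cone_inI[OF tri' tri(2)] by blast
qed

text \<open>Being killed by \<open>t\<close>, the arrow \<open>f\<close> factors through the fibre
  of \<open>t\<close>, a desuspension of its cone and hence in \<open>U\<close>. The fibre of that
  factor is the required denominator.\<close>

lemma cancel_zero:
  assumes "f \<in> Hom T X Y" "t \<in> Hom T Y Z" "t \<in> cone_in T U" "t \<cdot> f = Zer T X Z"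
  obtains X' a where "a \<in> Hom T X' X" "a \<in> cone_in T U" "f \<cdot> a = Zer T X' Y"
proof -
  obtain A v w where tri: "triangle Y Z A t v w" "A \<in> U" using cone_inE assms(2,3) by blast
  obtain A' e where A: "A' \<in> Ob T" "SOb T A' = A" "triangle A' Y Z e t v"
    using triangle_fibre tri(1) by blast
  have AU: "A' \<in> U" using A tri(2) thick_susp[OF U] by blast
  obtain g where g: "g \<in> Hom T X A'" "f = e \<cdot> g" using factor_fibre[OF A(3) assms(1,4)] by blast
  obtain X' a h where tri': "triangle X' X A' a g h" using fibre_exists g(1) by blast
  note a = triangleD(1)[OF tri'] and e = triangleD(1)[OF A(3)]
  have "f \<cdot> a = Zer T X' Y"
    using g(2) cmp_assoc[OF a g(1) e] triangle_comp_zero[OF tri'] cmp_zer_right[OF e hom_obD(1)[OF a]]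
    by simp
  then show thesis using that a cone_inI[OF tri' AU] by blast
qed

lemma cancel:
  assumes f: "f \<in> Hom T X Y" and g: "g \<in> Hom T X Y" and t: "t \<in> Hom T Y Z" "t \<in> cone_in T U"
    and eq: "t \<cdot> f = t \<cdot> g"
  obtains X' a where "a \<in> Hom T X' X" "a \<in> cone_in T U" "f \<cdot> a = g \<cdot> a"
proof -
  note ng = neg_hom[OF g]
  have "t \<cdot> Add T f (Neg T g) = Zer T X Z"
    using cmp_add_right[OF f ng t(1)] cmp_neg_right[OF g t(1)] eq add_neg[OF cmp_hom[OF g t(1)]] by simp
  then obtain X' a where a: "a \<in> Hom T X' X" "a \<in> cone_in T U" "Add T f (Neg T g) \<cdot> a = Zer T X' Y"
    using cancel_zero[OF add_hom[OF f ng] t] by blast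
  have "Add T (f \<cdot> a) (Neg T (g \<cdot> a)) = Zer T X' Y"
    using a(3) cmp_add_left[OF a(1) f ng] cmp_neg_left[OF a(1) g] by simp
  then have "f \<cdot> a = g \<cdot> a" using eq_if_diff_zer cmp_hom[OF a(1) f] cmp_hom[OF a(1) g] by blast
  then show thesis using that a by blast
qed

text \<open>The identity of \<open>Y\<close> kills the zero arrow, so it factors through the cone
  and exhibits \<open>Y\<close> as a retract of it.\<close>

lemma in_if_zer_cone_in:
  assumes "Zer T X Y \<in> cone_in T U" "X \<in> Ob T" "Y \<in> Ob T"
  shows "Y \<in> U"
proof -
  obtain Z v w where tri: "triangle X Y Z (Zer T X Y) v w" "Z \<in> U"
    using cone_inE assms zer_hom by blast
  have "Idn T Y \<cdot> Zer T X Y = Zer T X Y" using zer_hom[OF assms(2,3)] by simp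
  then obtain p where "p \<in> Hom T Z Y" "Idn T Y = p \<cdot> v"
    using factor_cone[OF tri(1) idn_hom[OF assms(3)]] by blast
  then have "retract Y Z" using triangleD(2)[OF tri(1)] unfolding retract_def by metis
  then show ?thesis using thick_retract U tri(2) by blast
qed

section \<open>Arrows vanishing modulo a thick subcategory\<close>

lemma null_modI:
  assumes "s \<in> cone_in T U" "s \<in> Hom T W X" "f \<in> Hom T X Y" "f \<cdot> s = Zer T W Y"
  shows "null_mod U f"
  using assms unfolding null_mod_def by (auto simp: Hom_def)

lemma null_modE:
  assumes "null_mod U f" "f \<in> Hom T X Y"
  obtains W s where "s \<in> cone_in T U" "s \<in> Hom T W X" "f \<cdot> s = Zer T W Y"
  using assms cone_in_hom unfolding null_mod_def by (metis Hom_CodD Hom_DomD)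

lemma null_mod_zer: "\<lbrakk>X \<in> Ob T; Y \<in> Ob T\<rbrakk> \<Longrightarrow> null_mod U (Zer T X Y)"
  using null_modI[OF cone_in_idn idn_hom] zer_hom cmp_idn_right by blast

lemma null_mod_comp_left:
  assumes "null_mod U f" "f \<in> Hom T X Y" "g \<in> Hom T Y Z"
  shows "null_mod U (g \<cdot> f)"
proof -
  obtain W s where s: "s \<in> cone_in T U" "s \<in> Hom T W X" "f \<cdot> s = Zer T W Y"
    using null_modE assms(1,2) by blast
  then have "(g \<cdot> f) \<cdot> s = Zer T W Z"
    using cmp_assoc[OF s(2) assms(2,3)] cmp_zer_right[OF assms(3) hom_obD(1)[OF s(2)]] by simp
  then show ?thesis using null_modI s(1,2) cmp_hom[OF assms(2,3)] by blast
qed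

lemma null_mod_comp_right:
  assumes "null_mod U g" "f \<in> Hom T X Y" "g \<in> Hom T Y Z"
  shows "null_mod U (g \<cdot> f)"
proof -
  obtain W s where s: "s \<in> cone_in T U" "s \<in> Hom T W Y" "g \<cdot> s = Zer T W Z"
    using null_modE assms(1,3) by blast
  obtain X' a b where a: "a \<in> Hom T X' X" "a \<in> cone_in T U" "b \<in> Hom T X' W" "f \<cdot> a = s \<cdot> b"
    by (rule ore[OF assms(2) s(2,1)])
  have "(g \<cdot> f) \<cdot> a = Zer T X' Z"
    using cmp_assoc[OF a(1) assms(2,3)] a(4) cmp_assoc[OF a(3) s(2) assms(3)] s(3)
      cmp_zer_left[OF a(3) hom_obD(2)[OF assms(3)]] by simp
  then show ?thesis using null_modI a(1,2) cmp_hom[OF assms(2,3)] by blast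
qed

lemma null_mod_cancel_right:
  assumes "null_mod U (g \<cdot> s)" "s \<in> Hom T X Y" "g \<in> Hom T Y Z" "s \<in> cone_in T U"
  shows "null_mod U g"
proof -
  obtain W r where r: "r \<in> cone_in T U" "r \<in> Hom T W X" "(g \<cdot> s) \<cdot> r = Zer T W Z"
    using null_modE[OF assms(1) cmp_hom[OF assms(2,3)]] by blast
  then have "g \<cdot> (s \<cdot> r) = Zer T W Z" using cmp_assoc[OF r(2) assms(2,3)] by simp
  then show ?thesis
    using null_modI[OF cone_in_two_of_three(1)[OF r(2) assms(2) r(1) assms(4)] cmp_hom[OF r(2) assms(2)] assms(3)]
    by blast
qed

lemma null_mod_cancel_left:
  assumes "null_mod U (t \<cdot> g)" "g \<in> Hom T X Y" "t \<in> Hom T Y Z" "t \<in> cone_in T U"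
  shows "null_mod U g"
proof -
  obtain W r where r: "r \<in> cone_in T U" "r \<in> Hom T W X" "(t \<cdot> g) \<cdot> r = Zer T W Z"
    using null_modE[OF assms(1) cmp_hom[OF assms(2,3)]] by blast
  then have "t \<cdot> (g \<cdot> r) = Zer T W Z" using cmp_assoc[OF r(2) assms(2,3)] by simp
  then obtain W' a where a: "a \<in> Hom T W' W" "a \<in> cone_in T U" "(g \<cdot> r) \<cdot> a = Zer T W' Y"
    using cancel_zero[OF cmp_hom[OF r(2) assms(2)] assms(3,4)] by blast
  then have "null_mod U (g \<cdot> r)" using null_modI cmp_hom[OF r(2) assms(2)] by blast
  then show ?thesis using null_mod_cancel_right r(1,2) assms(2) by blast
qed

text \<open>Precomposing with the denominator that kills \<open>f\<close> turns the sum into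
  \<open>g s\<close>, so no common denominator has to be found.\<close>

lemma null_mod_add:
  assumes "null_mod U f" "null_mod U g" "f \<in> Hom T X Y" "g \<in> Hom T X Y"
  shows "null_mod U (Add T f g)"
proof -
  obtain W s where s: "s \<in> cone_in T U" "s \<in> Hom T W X" "f \<cdot> s = Zer T W Y"
    using null_modE assms(1,3) by blast
  note gs = cmp_hom[OF s(2) assms(4)]
  have "null_mod U (g \<cdot> s)" using null_mod_comp_right assms(2,4) s(2) by blast
  moreover have "Add T f g \<cdot> s = g \<cdot> s"
    using cmp_add_left[OF s(2) assms(3,4)] s(3) add_zer[OF gs] by simp
  ultimately show ?thesis
    using null_mod_cancel_right[OF _ s(2) add_hom[OF assms(3,4)] s(1)] by simp
qed

lemma null_mod_neg:
  assumes "f \<in> Hom T X Y"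
  shows "null_mod U (Neg T f) \<longleftrightarrow> null_mod U f"
proof -
  have *: "null_mod U (Neg T g)" if g: "null_mod U g" "g \<in> Hom T X Y" for g
  proof -
    obtain W s where s: "s \<in> cone_in T U" "s \<in> Hom T W X" "g \<cdot> s = Zer T W Y"
      using null_modE g by blast
    then have "Neg T g \<cdot> s = Zer T W Y"
      using cmp_neg_left[OF s(2) g(2)] neg_zer hom_obD s(2) g(2) by metis
    then show ?thesis using null_modI[OF s(1,2) neg_hom[OF g(2)]] by blast
  qed
  show ?thesis using *[OF _ assms] *[OF _ neg_hom[OF assms]] neg_neg[OF assms] by metis
qed

lemma null_mod_susp:
  assumes "f \<in> Hom T X Y"
  shows "null_mod U (SAr T f) \<longleftrightarrow> null_mod U f"
proof
  assume "null_mod U f"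
  then obtain W s where s: "s \<in> cone_in T U" "s \<in> Hom T W X" "f \<cdot> s = Zer T W Y"
    using null_modE assms by blast
  have "SAr T f \<cdot> SAr T s = Zer T (SOb T W) (SOb T Y)"
    using susp_cmp[OF s(2) assms, symmetric] s(3) susp_zer hom_obD(1)[OF s(2)] hom_obD(2)[OF assms] by simp
  then show "null_mod U (SAr T f)"
    using null_modI[OF _ susp_hom[OF s(2)] susp_hom[OF assms]] cone_in_susp[OF s(2)] s(1) by blast
next
  assume "null_mod U (SAr T f)"
  then obtain W s where s: "s \<in> cone_in T U" "s \<in> Hom T W (SOb T X)" "SAr T f \<cdot> s = Zer T W (SOb T Y)"
    using null_modE susp_hom[OF assms] by blast
  obtain V where V: "V \<in> Ob T" "SOb T V = W" using desuspend_ob hom_obD(1)[OF s(2)] by blast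
  obtain r where r: "r \<in> Hom T V X" "SAr T r = s"
    using desuspend_ar s(2) V hom_obD(1)[OF assms] by blast
  have "f \<cdot> r = Zer T V Y"
    using susp_cmp[OF r(1) assms] susp_zer_iff[OF cmp_hom[OF r(1) assms]] s(3) r(2) V(2) by simp
  then show "null_mod U f" using null_modI[OF _ r(1) assms] cone_in_susp[OF r(1)] r(2) s(1) by blast
qed

text \<open>The fibre of \<open>f\<close> is a denominator killing it, since its cone is
  \<open>Y\<close>.\<close>

lemma null_mod_if_target:
  assumes "f \<in> Hom T X Y" "Y \<in> U"
  shows "null_mod U f"
proof -
  obtain W s w where tri: "triangle W X Y s f w" using fibre_exists assms(1) by blast
  show ?thesis
    using null_modI[OF cone_inI[OF tri assms(2)] triangleD(1)[OF tri] assms(1) triangle_comp_zero[OF tri]] .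
qed

lemma null_mod_if_source:
  assumes "f \<in> Hom T X Y" "X \<in> U"
  shows "null_mod U f"
proof -
  note iX = idn_hom[OF hom_obD(1)[OF assms(1)]]
  have "null_mod U (f \<cdot> Idn T X)"
    by (rule null_mod_comp_left[OF null_mod_if_target[OF iX assms(2)] iX assms(1)])
  then show ?thesis using assms(1) by simp
qed

text \<open>An arrow both zero and invertible in \<open>T/U\<close> has zero objects of
  \<open>T/U\<close> as its ends. The clash of nilpotent with invertible actions, and the final
  contradiction, rest on this.\<close>

lemma in_if_null_mod_cone_in:
  assumes "null_mod U s" "s \<in> cone_in T U" "s \<in> Hom T X Y"
  shows "X \<in> U" "Y \<in> U"
proof -
  obtain W r where r: "r \<in> cone_in T U" "r \<in> Hom T W X" "s \<cdot> r = Zer T W Y"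
    using null_modE assms(1,3) by blast
  then have "Zer T W Y \<in> cone_in T U"
    using cone_in_two_of_three(1)[OF r(2) assms(3) r(1) assms(2)] by simp
  then show Y: "Y \<in> U" using in_if_zer_cone_in hom_obD r(2) assms(3) by blast
  obtain Z v w where "triangle X Y Z s v w" "Z \<in> U" using cone_inE assms(2,3) by blast
  then show "X \<in> U" using thick_triangle(2)[OF U] Y by blast
qed

text \<open>The hypotheses say that \<open>f\<close> becomes a split epimorphism and a monomorphism modulo \<open>U\<close>; the
  proof shows that the arrow from the fibre of \<open>f\<close> to \<open>X\<close> is null and that, precomposed with a
  suitable arrow, it becomes zero although that arrow still has cone in \<open>U\<close>.\<close>

lemma cone_in_if_epi_mono:
  assumes f: "f \<in> Hom T X Y" and q: "q \<in> Hom T A X" and fq: "f \<cdot> q \<in> cone_in T U"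
    and mono: "\<And>D n. \<lbrakk>n \<in> Hom T D X; f \<cdot> n = Zer T D Y\<rbrakk> \<Longrightarrow> null_mod U n"
  shows "f \<in> cone_in T U"
proof -
  obtain C i j where tri: "triangle X Y C f i j" using cone_exists f by blast
  obtain D j' where D: "D \<in> Ob T" "SOb T D = C" "triangle D X Y j' f i"
    using triangle_fibre tri by blast
  obtain Y' i' where Y': "Y' \<in> Ob T" "SOb T Y' = Y" "triangle Y' D X i' j' f" "i = Neg T (SAr T i')"
    using triangle_fibre D(3) by blast
  note i' = triangleD(1)[OF Y'(3)] and j' = triangleD(1)[OF D(3)] and i = triangleD(3)[OF D(3)]
  obtain E m where m: "m \<in> cone_in T U" "m \<in> Hom T E D" "j' \<cdot> m = Zer T E X"
    using null_modE[OF mono[OF j' triangle_comp_zero[OF D(3)]] j'] by blast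
  obtain n where n: "n \<in> Hom T E Y'" "m = i' \<cdot> n" using factor_fibre[OF Y'(3) m(2,3)] by blast
  obtain A' where A': "A' \<in> Ob T" "SOb T A' = A" using desuspend_ob hom_obD(1)[OF q] by blast
  obtain t where t: "t \<in> Hom T A' Y'" "SAr T t = f \<cdot> q"
    using desuspend_ar[of "f \<cdot> q" A' Y'] cmp_hom[OF q f] A' Y' by blast
  have tU: "t \<in> cone_in T U" using cone_in_susp[OF t(1)] t(2) fq by simp
  have "i \<cdot> (f \<cdot> q) = Zer T A C"
    using cmp_assoc[OF q f triangleD(2)[OF tri]] triangle_comp_zero[OF tri]
      cmp_zer_left[OF q triangleD(7)[OF tri]] by simp
  then have "Neg T (SAr T (i' \<cdot> t)) = Zer T A C"
    using Y'(4) t cmp_neg_left[OF susp_hom[OF t(1)] susp_hom[OF i']] susp_cmp[OF t(1) i'] by simp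
  then have "SAr T (i' \<cdot> t) = Zer T (SOb T A') (SOb T D)"
    using neg_neg[OF susp_hom[OF cmp_hom[OF t(1) i']]] neg_zer hom_obD(1)[OF q] triangleD(7)[OF tri]
      A'(2) D(2) by metis
  then have it: "i' \<cdot> t = Zer T A' D" using susp_zer_iff[OF cmp_hom[OF t(1) i']] by blast
  \<comment> \<open>\<open>m\<close> is \<open>i' n\<close>, and \<open>i'\<close> vanishes on
    \<open>t\<close>, which has cone in \<open>U\<close>. The Ore square lets \<open>n\<close> pass
    through \<open>t\<close>, so \<open>m a\<close> becomes zero while its cone stays in
    \<open>U\<close>.\<close>
  obtain E' a b where a: "a \<in> Hom T E' E" "a \<in> cone_in T U" "b \<in> Hom T E' A'" "n \<cdot> a = t \<cdot> b"
    by (rule ore[OF n(1) t(1) tU])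
  have "m \<cdot> a = Zer T E' D"
    using n(2) cmp_assoc[OF a(1) n(1) i'] a(4) cmp_assoc[OF a(3) t(1) i'] it
      cmp_zer_left[OF a(3) D(1)] by simp
  moreover have "m \<cdot> a \<in> cone_in T U" using cone_in_two_of_three(1)[OF a(1) m(2) a(2) m(1)] .
  ultimately have "D \<in> U" using in_if_zer_cone_in hom_obD(1)[OF a(1)] D(1) by metis
  then show ?thesis using cone_in_iff[OF tri] thick_susp[OF U D(1)] D(2) by simp
qed

text \<open>For extensions, an arrow \<open>f\<close> into the middle term dies in the third term
  only after a denominator \<open>s\<close>, and then lifts to the first term from the new source.
  Hence the sources must be closed under denominators.\<close>

lemma thick_right_orthogonal:
  assumes sub: "\<W> \<subseteq> Ob T"
    and pre: "\<And>W W' s. \<lbrakk>W \<in> \<W>; s \<in> Hom T W' W; s \<in> cone_in T U\<rbrakk> \<Longrightarrow> W' \<in> \<W>"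
    and susp: "\<And>W. W \<in> Ob T \<Longrightarrow> SOb T W \<in> \<W> \<longleftrightarrow> W \<in> \<W>"
  shows "thick T {Z \<in> Ob T. \<forall>W\<in>\<W>. \<forall>f \<in> Hom T W Z. null_mod U f}" (is "thick T ?V")
proof (rule thickI)
  show "?V \<subseteq> Ob T" by blast
  show "Z \<in> ?V" if "zero_object T Z" for Z
    using that null_mod_if_target thick_zero[OF U that] zero_object_iff by blast
  show "SOb T Z \<in> ?V \<longleftrightarrow> Z \<in> ?V" if Z: "Z \<in> Ob T" for Z
  proof
    assume V: "SOb T Z \<in> ?V"
    have "null_mod U f" if f: "W \<in> \<W>" "f \<in> Hom T W Z" for W f
      using V susp_hom[OF f(2)] null_mod_susp[OF f(2)] susp[OF hom_obD(1)[OF f(2)]] f(1) by blast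
    then show "Z \<in> ?V" using Z by blast
  next
    assume V: "Z \<in> ?V"
    have "null_mod U f" if f: "W \<in> \<W>" "f \<in> Hom T W (SOb T Z)" for W f
    proof -
      obtain W' where W': "W' \<in> Ob T" "SOb T W' = W" using desuspend_ob hom_obD(1)[OF f(2)] by blast
      obtain f' where f': "f' \<in> Hom T W' Z" "SAr T f' = f" using desuspend_ar f(2) W' Z by blast
      show ?thesis using V f' null_mod_susp[OF f'(1)] susp[OF W'(1)] W'(2) f(1) by blast
    qed
    then show "SOb T Z \<in> ?V" using susp_ob_ob[OF Z] by blast
  qed
  show "Y \<in> ?V" if r: "retract Y Z" "Z \<in> ?V" for Y Z
  proof -
    obtain i p where ip: "i \<in> Hom T Y Z" "p \<in> Hom T Z Y" "p \<cdot> i = Idn T Y"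
      using r(1) unfolding retract_def by blast
    have "null_mod U f" if f: "W \<in> \<W>" "f \<in> Hom T W Y" for W f
    proof -
      have "null_mod U (i \<cdot> f)" using r(2) f(1) cmp_hom[OF f(2) ip(1)] by blast
      then have "null_mod U (p \<cdot> (i \<cdot> f))" using null_mod_comp_left cmp_hom[OF f(2) ip(1)] ip(2) by blast
      then show ?thesis using cmp_assoc[OF f(2) ip(1,2)] ip(3) f(2) by simp
    qed
    then show ?thesis using hom_obD(1)[OF ip(1)] by blast
  qed
  show "Y \<in> ?V" if tri: "triangle X Y Z u v w" and X: "X \<in> ?V" and Z: "Z \<in> ?V" for X Y Z u v w
  proof -
    note u = triangleD(1)[OF tri] and v = triangleD(2)[OF tri]
    have "null_mod U f" if f: "W \<in> \<W>" "f \<in> Hom T W Y" for W f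
    proof -
      have "null_mod U (v \<cdot> f)" using Z f(1) cmp_hom[OF f(2) v] by blast
      then obtain W' s where s: "s \<in> cone_in T U" "s \<in> Hom T W' W" "(v \<cdot> f) \<cdot> s = Zer T W' Z"
        using null_modE cmp_hom[OF f(2) v] by blast
      then have "v \<cdot> (f \<cdot> s) = Zer T W' Z" using cmp_assoc[OF s(2) f(2) v] by simp
      then obtain g where g: "g \<in> Hom T W' X" "f \<cdot> s = u \<cdot> g"
        using factor_fibre[OF tri cmp_hom[OF s(2) f(2)]] by blast
      have "null_mod U g" using X g(1) pre[OF f(1) s(2,1)] by blast
      then have "null_mod U (f \<cdot> s)" using null_mod_comp_left g u by simp
      then show ?thesis using null_mod_cancel_right s(1,2) f(2) by blast
    qed
    then show ?thesis using triangleD(6)[OF tri] by blast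
  qed
qed

end

lemma cone_in_mono: "U \<subseteq> V \<Longrightarrow> cone_in T U \<subseteq> cone_in T V"
  by (auto simp: cone_in_def)

end

section \<open>Verdier quotients\<close>

context triangulated_category
begin

lemma cone_in_objects_iff:
  assumes "thick T U" "s \<in> Hom T X Y" "s \<in> cone_in T U"
  shows "X \<in> U \<longleftrightarrow> Y \<in> U"
proof -
  obtain Z v w where "triangle X Y Z s v w" "Z \<in> U" using cone_inE assms(2,3) by blast
  then show ?thesis using thick_triangle[OF assms(1)] by metis
qed

abbreviation "quot \<equiv> quotient_category T"

lemma quotient_sel [simp]:
  "Ob (quot N) = Ob T" "Idn (quot N) X = quotient_arrow T N (Idn T X)" "Cmp (quot N) = roof_comp T N"
  "Zer (quot N) X Y = quotient_arrow T N (Zer T X Y)" "SOb (quot N) = SOb T" "SAr (quot N) c = map_prod (SAr T) (SAr T) ` c"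
  "Ar (quot N) = roofs T N // roof_rel T N"
  by (simp_all add: quotient_category_def)

section \<open>The equivalence relation on roofs\<close>

definition roof :: "'o set \<Rightarrow> 'o \<Rightarrow> 'o \<Rightarrow> 'o \<Rightarrow> 'm \<Rightarrow> 'm \<Rightarrow> bool" where
  "roof N W X Y s f \<longleftrightarrow> s \<in> Hom T W X \<and> s \<in> cone_in T N \<and> f \<in> Hom T W Y"

context
  fixes N assumes N: "thick T N"
begin

lemma roofD:
  assumes "roof N W X Y s f"
  shows "s \<in> Hom T W X" "s \<in> cone_in T N" "f \<in> Hom T W Y" "X \<in> Ob T" "Y \<in> Ob T" "W \<in> Ob T"
  using assms hom_obD unfolding roof_def by blast+

lemma roofs_iff: "(s, f) \<in> roofs T N \<longleftrightarrow> (\<exists>W X Y. roof N W X Y s f)"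
  unfolding roofs_def roof_def by (auto simp: Hom_def cone_in_def)

lemma roof_unique: "\<lbrakk>roof N W X Y s f; roof N W' X' Y' s f\<rbrakk> \<Longrightarrow> W' = W \<and> X' = X \<and> Y' = Y"
  unfolding roof_def by (auto simp: Hom_def)

lemma roof_relI:
  assumes "roof N W X Y s f" "roof N W' X Y s' f'" "a \<in> Hom T V W" "b \<in> Hom T V W'"
    and "s \<cdot> a = s' \<cdot> b" "s \<cdot> a \<in> cone_in T N" "f \<cdot> a = f' \<cdot> b"
  shows "((s, f), (s', f')) \<in> roof_rel T N"
proof -
  have "(s, f) \<in> roofs T N" "(s', f') \<in> roofs T N" using assms(1,2) roofs_iff by blast+
  moreover have "Cod T s = Cod T s'" "Cod T f = Cod T f'" "Dom T s = W" "Dom T s' = W'"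
    using assms(1,2) unfolding roof_def by (auto simp: Hom_def)
  ultimately show ?thesis using assms(3-7) unfolding roof_rel_def by blast
qed

text \<open>The definition controls only the composite \<open>s a\<close>; two-out-of-three passes
  the condition on to both comparison arrows.\<close>

lemma roof_relE:
  assumes "((s, f), (s', f')) \<in> roof_rel T N"
  obtains W W' X Y V a b where "roof N W X Y s f" "roof N W' X Y s' f'" "a \<in> Hom T V W" "b \<in> Hom T V W'"
    "s \<cdot> a = s' \<cdot> b" "a \<in> cone_in T N" "b \<in> cone_in T N" "f \<cdot> a = f' \<cdot> b"
proof -
  obtain V a b where ab: "(s, f) \<in> roofs T N" "(s', f') \<in> roofs T N" "Cod T s = Cod T s'" "Cod T f = Cod T f'"
    "a \<in> Hom T V (Dom T s)" "b \<in> Hom T V (Dom T s')" "s \<cdot> a = s' \<cdot> b" "s \<cdot> a \<in> cone_in T N" "f \<cdot> a = f' \<cdot> b"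
    using assms unfolding roof_rel_def by blast
  obtain W X Y W' X' Y' where r: "roof N W X Y s f" "roof N W' X' Y' s' f'" using ab(1,2) roofs_iff by metis
  have d: "Dom T s = W" "Dom T s' = W'" "X' = X" "Y' = Y"
    using r ab(3,4) unfolding roof_def by (auto simp: Hom_def)
  have "a \<in> cone_in T N"
    using cone_in_two_of_three(3)[OF N _ roofD(1)[OF r(1)] roofD(2)[OF r(1)] ab(8)] ab(5) d by blast
  moreover have "b \<in> cone_in T N"
    using cone_in_two_of_three(3)[OF N _ roofD(1)[OF r(2)] roofD(2)[OF r(2)]] ab(6,7,8) d by metis
  ultimately show thesis using that r ab d by blast
qed

lemma roof_relE2:
  assumes "((s, f), (s', f')) \<in> roof_rel T N" "roof N W X Y s f" "roof N W' X' Y' s' f'"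
  obtains V a b where "a \<in> Hom T V W" "b \<in> Hom T V W'" "s \<cdot> a = s' \<cdot> b"
    "a \<in> cone_in T N" "b \<in> cone_in T N" "f \<cdot> a = f' \<cdot> b"
proof -
  obtain W1 W1' X1 Y1 V a b where "roof N W1 X1 Y1 s f" "roof N W1' X1 Y1 s' f'"
      "a \<in> Hom T V W1" "b \<in> Hom T V W1'" "s \<cdot> a = s' \<cdot> b" "a \<in> cone_in T N" "b \<in> cone_in T N"
      "f \<cdot> a = f' \<cdot> b"
    by (rule roof_relE[OF assms(1)])
  then show thesis using that roof_unique[OF assms(2)] roof_unique[OF assms(3)] by simp
qed

lemma roof_rel_refl: "roof N W X Y s f \<Longrightarrow> ((s, f), (s, f)) \<in> roof_rel T N"
  using roof_relI[OF _ _ idn_hom idn_hom] roofD cmp_idn_right by metis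

text \<open>Composition of roofs depends neither on the representatives nor on the chosen Ore
  squares; both choices are varied at once.\<close>

lemma roof_comp_rel:
  assumes r: "roof N W X Y s f" "roof N W' X Y s' f'" "((s, f), (s', f')) \<in> roof_rel T N"
    and r': "roof N W1 Y Z t g" "roof N W1' Y Z t' g'" "((t, g), (t', g')) \<in> roof_rel T N"
    and sq: "a \<in> Hom T V W" "a \<in> cone_in T N" "b \<in> Hom T V W1" "f \<cdot> a = t \<cdot> b"
    and sq': "a' \<in> Hom T V' W'" "a' \<in> cone_in T N" "b' \<in> Hom T V' W1'" "f' \<cdot> a' = t' \<cdot> b'"
  shows "((s \<cdot> a, g \<cdot> b), (s' \<cdot> a', g' \<cdot> b')) \<in> roof_rel T N"
proof -
  note h = roofD(1-3)[OF r(1)] roofD(1-3)[OF r(2)]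
  note h' = roofD(1-3)[OF r'(1)] roofD(1-3)[OF r'(2)]
  obtain U0 a0 b0 where ab0: "a0 \<in> Hom T U0 W" "b0 \<in> Hom T U0 W'" "s \<cdot> a0 = s' \<cdot> b0"
      "a0 \<in> cone_in T N" "b0 \<in> cone_in T N" "f \<cdot> a0 = f' \<cdot> b0"
    by (rule roof_relE2[OF r(3,1,2)])
  obtain U1 a1 b1 where ab1: "a1 \<in> Hom T U1 W1" "b1 \<in> Hom T U1 W1'" "t \<cdot> a1 = t' \<cdot> b1"
      "a1 \<in> cone_in T N" "b1 \<in> cone_in T N" "g \<cdot> a1 = g' \<cdot> b1"
    by (rule roof_relE2[OF r'(3,1,2)])
  \<comment> \<open>Two Ore squares put one object \<open>E\<close> over both given squares, by
    \<open>xz\<close> to \<open>V\<close> and \<open>x'\<close> to \<open>V'\<close>, compatibly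
    with the first equivalence.\<close>
  obtain D x y where xy: "x \<in> Hom T D V" "x \<in> cone_in T N" "y \<in> Hom T D U0" "a \<cdot> x = a0 \<cdot> y"
    by (rule ore[OF N sq(1) ab0(1,4)])
  obtain E z x' where z: "z \<in> Hom T E D" "z \<in> cone_in T N" "x' \<in> Hom T E V'" "(b0 \<cdot> y) \<cdot> z = a' \<cdot> x'"
    by (rule ore[OF N cmp_hom[OF xy(3) ab0(2)] sq'(1,2)])
  define xz where "xz = x \<cdot> z"
  have xz: "xz \<in> Hom T E V" "xz \<in> cone_in T N"
    unfolding xz_def using cmp_hom[OF z(1) xy(1)] cone_in_two_of_three(1)[OF N z(1) xy(1) z(2) xy(2)] by blast+
  define yz where "yz = y \<cdot> z"
  have yz: "yz \<in> Hom T E U0" unfolding yz_def using cmp_hom[OF z(1) xy(3)] .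
  have e1: "a \<cdot> xz = a0 \<cdot> yz"
    unfolding xz_def yz_def using cmp_assoc[OF z(1) xy(1) sq(1)] cmp_assoc[OF z(1) xy(3) ab0(1)] xy(4) by simp
  have e2: "b0 \<cdot> yz = a' \<cdot> x'"
    unfolding yz_def using cmp_assoc[OF z(1) xy(3) ab0(2)] z(4) by simp
  have s: "(s \<cdot> a) \<cdot> xz = (s' \<cdot> a') \<cdot> x'"
    using cmp_assoc[OF xz(1) sq(1) h(1)] e1 cmp_assoc[OF yz ab0(1) h(1)] ab0(3)
      cmp_assoc[OF yz ab0(2) h(4)] e2 cmp_assoc[OF z(3) sq'(1) h(4)] by simp
  have f: "(f \<cdot> a) \<cdot> xz = (f' \<cdot> a') \<cdot> x'"
    using cmp_assoc[OF xz(1) sq(1) h(3)] e1 cmp_assoc[OF yz ab0(1) h(3)] ab0(6)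
      cmp_assoc[OF yz ab0(2) h(6)] e2 cmp_assoc[OF z(3) sq'(1) h(6)] by simp
  have bxz: "b \<cdot> xz \<in> Hom T E W1" and bx': "b' \<cdot> x' \<in> Hom T E W1'"
    using cmp_hom xz(1) z(3) sq(3) sq'(3) by blast+
  have t: "t \<cdot> (b \<cdot> xz) = t' \<cdot> (b' \<cdot> x')"
    using f sq(4) sq'(4) cmp_assoc[OF xz(1) sq(3) h'(1)] cmp_assoc[OF z(3) sq'(3) h'(4)] by simp
  \<comment> \<open>Over \<open>F\<close> the arrow \<open>b xz\<close> passes through the apex
    \<open>U1\<close> of the second equivalence. Its primed counterpart does so only after
    composition with \<open>t'\<close>, so one more denominator \<open>m\<close> is taken to cancel
    \<open>t'\<close>.\<close>
  obtain F k l where kl: "k \<in> Hom T F E" "k \<in> cone_in T N" "l \<in> Hom T F U1" "(b \<cdot> xz) \<cdot> k = a1 \<cdot> l"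
    by (rule ore[OF N bxz ab1(1,4)])
  have "t' \<cdot> ((b' \<cdot> x') \<cdot> k) = t' \<cdot> (b1 \<cdot> l)"
    using cmp_assoc[OF kl(1) bx' h'(4)] t cmp_assoc[OF kl(1) bxz h'(1)] kl(4)
      cmp_assoc[OF kl(3) ab1(1) h'(1)] ab1(3) cmp_assoc[OF kl(3) ab1(2) h'(4)] by simp
  then obtain G m where m: "m \<in> Hom T G F" "m \<in> cone_in T N" "((b' \<cdot> x') \<cdot> k) \<cdot> m = (b1 \<cdot> l) \<cdot> m"
    using cancel[OF N cmp_hom[OF kl(1) bx'] cmp_hom[OF kl(3) ab1(2)] h'(4,5)] by blast
  define n where "n = k \<cdot> m"
  have n: "n \<in> Hom T G E" "n \<in> cone_in T N"
    unfolding n_def using cmp_hom[OF m(1) kl(1)] cone_in_two_of_three(1)[OF N m(1) kl(1) m(2) kl(2)] by blast+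
  note lm = cmp_hom[OF m(1) kl(3)]
  have "(b \<cdot> xz) \<cdot> n = a1 \<cdot> (l \<cdot> m)" "(b' \<cdot> x') \<cdot> n = b1 \<cdot> (l \<cdot> m)"
    unfolding n_def using kl(4) m(3) cmp_assoc[OF m(1) kl(1) bxz] cmp_assoc[OF m(1) kl(1) bx']
      cmp_assoc[OF m(1) kl(3) ab1(1)] cmp_assoc[OF m(1) kl(3) ab1(2)] by simp_all
  then have e3: "g \<cdot> ((b \<cdot> xz) \<cdot> n) = g' \<cdot> ((b' \<cdot> x') \<cdot> n)"
    using cmp_assoc[OF lm ab1(1) h'(3)] ab1(6) cmp_assoc[OF lm ab1(2) h'(6)] by simp
  have rr: "roof N V X Z (s \<cdot> a) (g \<cdot> b)" "roof N V' X Z (s' \<cdot> a') (g' \<cdot> b')"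
    unfolding roof_def using cmp_hom sq(1,3) sq'(1,3) h h' cone_in_two_of_three(1)[OF N sq(1) h(1) sq(2) h(2)]
      cone_in_two_of_three(1)[OF N sq'(1) h(4) sq'(2) h(5)] by blast+
  note sa = roofD(1-3)[OF rr(1)] and sa' = roofD(1-3)[OF rr(2)]
  show ?thesis
  proof (rule roof_relI[OF rr cmp_hom[OF n(1) xz(1)] cmp_hom[OF n(1) z(3)]])
    show "(s \<cdot> a) \<cdot> (xz \<cdot> n) = (s' \<cdot> a') \<cdot> (x' \<cdot> n)"
      using cmp_assoc[OF n(1) xz(1) sa(1)] s cmp_assoc[OF n(1) z(3) sa'(1)] by simp
    show "(s \<cdot> a) \<cdot> (xz \<cdot> n) \<in> cone_in T N"
      using cone_in_two_of_three(1)[OF N _ sa(1) _ sa(2)] cmp_hom[OF n(1) xz(1)]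
        cone_in_two_of_three(1)[OF N n(1) xz(1) n(2) xz(2)] by blast
    show "(g \<cdot> b) \<cdot> (xz \<cdot> n) = (g' \<cdot> b') \<cdot> (x' \<cdot> n)"
      using e3 cmp_assoc[OF n(1) xz(1) sq(3)] cmp_assoc[OF n(1) z(3) sq'(3)]
        cmp_assoc[OF cmp_hom[OF n(1) xz(1)] sq(3) h'(3)] cmp_assoc[OF cmp_hom[OF n(1) z(3)] sq'(3) h'(6)] by simp
  qed
qed

lemma roof_rel_sym:
  assumes "((s, f), (s', f')) \<in> roof_rel T N"
  shows "((s', f'), (s, f)) \<in> roof_rel T N"
proof -
  obtain W W' X Y V a b where 1: "roof N W X Y s f" "roof N W' X Y s' f'" "a \<in> Hom T V W" "b \<in> Hom T V W'"
    "s \<cdot> a = s' \<cdot> b" "a \<in> cone_in T N" "b \<in> cone_in T N" "f \<cdot> a = f' \<cdot> b"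
    by (rule roof_relE[OF assms])
  have "s' \<cdot> b \<in> cone_in T N"
    using cone_in_two_of_three(1)[OF N 1(4) roofD(1)[OF 1(2)] 1(7) roofD(2)[OF 1(2)]] .
  then show ?thesis by (rule roof_relI[OF 1(2,1,4,3) 1(5)[symmetric] _ 1(8)[symmetric]])
qed

text \<open>The comparison arrows \<open>b\<close> and \<open>a'\<close> into the apex of the middle
  roof are completed to an Ore square.\<close>

lemma roof_rel_trans:
  assumes "((s, f), (s', f')) \<in> roof_rel T N" "((s', f'), (s'', f'')) \<in> roof_rel T N"
  shows "((s, f), (s'', f'')) \<in> roof_rel T N"
proof -
  obtain W W' X Y V a b where 1: "roof N W X Y s f" "roof N W' X Y s' f'" "a \<in> Hom T V W" "b \<in> Hom T V W'"
    "s \<cdot> a = s' \<cdot> b" "a \<in> cone_in T N" "b \<in> cone_in T N" "f \<cdot> a = f' \<cdot> b"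
    by (rule roof_relE[OF assms(1)])
  obtain W'' W1 X1 Y1 where r'': "roof N W1 X1 Y1 s' f'" "roof N W'' X1 Y1 s'' f''"
    by (rule roof_relE[OF assms(2)])
  obtain V' a' b' where "a' \<in> Hom T V' W'" "b' \<in> Hom T V' W''"
    "s' \<cdot> a' = s'' \<cdot> b'" "a' \<in> cone_in T N" "b' \<in> cone_in T N" "f' \<cdot> a' = f'' \<cdot> b'"
    by (rule roof_relE2[OF assms(2) 1(2) r''(2)])
  moreover have "roof N W'' X Y s'' f''" using r'' roof_unique[OF 1(2)] by metis
  ultimately have 2: "roof N W'' X Y s'' f''" "a' \<in> Hom T V' W'" "b' \<in> Hom T V' W''"
    "s' \<cdot> a' = s'' \<cdot> b'" "a' \<in> cone_in T N" "f' \<cdot> a' = f'' \<cdot> b'" by blast+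
  obtain E x y where xy: "x \<in> Hom T E V" "x \<in> cone_in T N" "y \<in> Hom T E V'" "b \<cdot> x = a' \<cdot> y"
    by (rule ore[OF N 1(4) 2(2,5)])
  note h = roofD(1-3)[OF 1(1)] roofD(1-3)[OF 1(2)] roofD(1-3)[OF 2(1)]
  have e: "u \<cdot> (a \<cdot> x) = u'' \<cdot> (b' \<cdot> y)"
    if u: "u \<in> Hom T W A" "u' \<in> Hom T W' A" "u'' \<in> Hom T W'' A" "u \<cdot> a = u' \<cdot> b" "u' \<cdot> a' = u'' \<cdot> b'"
    for u u' u'' A
    using cmp_assoc[OF xy(1) 1(3) u(1)] u(4) cmp_assoc[OF xy(1) 1(4) u(2)] xy(4)
      cmp_assoc[OF xy(3) 2(2) u(2)] u(5) cmp_assoc[OF xy(3) 2(3) u(3)] by simp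
  have "a \<cdot> x \<in> cone_in T N" using cone_in_two_of_three(1)[OF N xy(1) 1(3) xy(2) 1(6)] .
  then have "s \<cdot> (a \<cdot> x) \<in> cone_in T N"
    using cone_in_two_of_three(1)[OF N cmp_hom[OF xy(1) 1(3)] h(1) _ h(2)] by blast
  then show ?thesis
    using roof_relI[OF 1(1) 2(1) cmp_hom[OF xy(1) 1(3)] cmp_hom[OF xy(3) 2(3)]]
      e[OF h(1,4,7) 1(5) 2(4)] e[OF h(3,6,9) 1(8) 2(6)] by blast
qed

lemma equiv_roof_rel: "equiv (roofs T N) (roof_rel T N)"
proof (rule equivI)
  show "roof_rel T N \<subseteq> roofs T N \<times> roofs T N" by (auto simp: roof_rel_def)
  show "refl_on (roofs T N) (roof_rel T N)"
    using roof_rel_refl roofs_iff by (auto simp: refl_on_def)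
  show "sym (roof_rel T N)" by (rule symI) (metis roof_rel_sym prod.collapse)
  show "trans (roof_rel T N)" by (rule transI) (metis roof_rel_trans prod.collapse)
qed

section \<open>Morphisms of the quotient and their composition\<close>

abbreviation "roof_cls s f \<equiv> roof_class T N (s, f)"

lemma roof_cls_eq_iff:
  assumes "roof N W X Y s f" "roof N W' X' Y' s' f'"
  shows "roof_cls s f = roof_cls s' f' \<longleftrightarrow> ((s, f), (s', f')) \<in> roof_rel T N"
  unfolding roof_class_def using eq_equiv_class_iff[OF equiv_roof_rel] assms roofs_iff by blast

lemma mem_roof_cls:
  assumes "roof N W X Y s f" "(s', f') \<in> roof_cls s f"
  obtains W' where "roof N W' X Y s' f'" "((s, f), (s', f')) \<in> roof_rel T N"
proof -
  have r: "((s, f), (s', f')) \<in> roof_rel T N" using assms(2) by (simp add: roof_class_def)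
  obtain W1 W' X1 Y1 V a b where "roof N W1 X1 Y1 s f" "roof N W' X1 Y1 s' f'"
    by (rule roof_relE[OF r])
  then show thesis using that r roof_unique[OF assms(1)] by metis
qed

lemma quotient_Dom_Cod:
  assumes "roof N W X Y s f"
  shows "Dom (quot N) (roof_cls s f) = X" "Cod (quot N) (roof_cls s f) = Y"
proof -
  have self: "(s, f) \<in> roof_cls s f" using roof_rel_refl[OF assms] by (simp add: roof_class_def)
  have "Cod T s' = X \<and> Cod T f' = Y" if "(s', f') \<in> roof_cls s f" for s' f'
    using mem_roof_cls[OF assms that] roofD(1,3) Hom_CodD by metis
  then show "Dom (quot N) (roof_cls s f) = X" "Cod (quot N) (roof_cls s f) = Y"
    using self unfolding quotient_category_def by (auto intro!: the_equality)
qed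

lemma quotient_Hom_iff: "c \<in> Hom (quot N) X Y \<longleftrightarrow> (\<exists>W s f. roof N W X Y s f \<and> c = roof_cls s f)"
proof
  assume c: "c \<in> Hom (quot N) X Y"
  then obtain s f where "(s, f) \<in> roofs T N" "c = roof_cls s f"
    unfolding Hom_def by (auto simp: quotient_def roof_class_def)
  then obtain W X' Y' where r: "roof N W X' Y' s f" using roofs_iff by blast
  then show "\<exists>W s f. roof N W X Y s f \<and> c = roof_cls s f"
    using quotient_Dom_Cod[OF r] c \<open>c = roof_cls s f\<close> unfolding Hom_def by blast
next
  assume "\<exists>W s f. roof N W X Y s f \<and> c = roof_cls s f"
  then obtain W s f where r: "roof N W X Y s f" "c = roof_cls s f" by blast
  then have "c \<in> Ar (quot N)" using roofs_iff quotientI by (fastforce simp: roof_class_def)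
  then show "c \<in> Hom (quot N) X Y" using r quotient_Dom_Cod[OF r(1)] by (simp add: Hom_def)
qed

lemma roof_idn: "f \<in> Hom T X Y \<Longrightarrow> roof N X X Y (Idn T X) f"
  unfolding roof_def using idn_hom cone_in_idn[OF N] hom_obD(1) by blast

lemma quotient_arrow_eq: "f \<in> Hom T X Y \<Longrightarrow> quotient_arrow T N f = roof_cls (Idn T X) f"
  by (simp add: quotient_arrow_def Hom_def)

lemma quotient_arrow_hom: "f \<in> Hom T X Y \<Longrightarrow> quotient_arrow T N f \<in> Hom (quot N) X Y"
  using quotient_arrow_eq roof_idn quotient_Hom_iff by metis

text \<open>By \<open>roof_comp_rel\<close> all classes in the union defining
  \<open>roof_comp\<close> coincide, so a single square computes the composite.\<close>

lemma roof_comp_eq: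
  assumes r: "roof N W X Y s f" "roof N W1 Y Z t g"
    and sq: "a \<in> Hom T V W" "a \<in> cone_in T N" "b \<in> Hom T V W1" "f \<cdot> a = t \<cdot> b"
  shows "roof_comp T N (roof_cls t g) (roof_cls s f) = roof_cls (s \<cdot> a) (g \<cdot> b)"
proof -
  note h = roofD(1-3)[OF r(1)] and h' = roofD(1-3)[OF r(2)]
  have rr: "roof N V X Z (s \<cdot> a) (g \<cdot> b)"
    unfolding roof_def using cmp_hom sq(1,3) h h' cone_in_two_of_three(1)[OF N sq(1) h(1) sq(2) h(2)] by blast
  have "roof_cls (s' \<cdot> a') (g' \<cdot> b') = roof_cls (s \<cdot> a) (g \<cdot> b)"
    if mem: "(s', f') \<in> roof_cls s f" "(t', g') \<in> roof_cls t g" and a'N: "a' \<in> cone_in T N"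
      and b'Ar: "b' \<in> Ar T" and dc: "Dom T a' = Dom T b'" "Cod T a' = Dom T f'" "Cod T b' = Dom T t'"
      and sq': "f' \<cdot> a' = t' \<cdot> b'"
    for s' f' t' g' a' b'
  proof -
    obtain W' where 1: "roof N W' X Y s' f'" "((s, f), (s', f')) \<in> roof_rel T N"
      using mem_roof_cls[OF r(1) mem(1)] by blast
    obtain W1' where 2: "roof N W1' Y Z t' g'" "((t, g), (t', g')) \<in> roof_rel T N"
      using mem_roof_cls[OF r(2) mem(2)] by blast
    have d: "Dom T f' = W'" "Dom T t' = W1'" using roofD 1(1) 2(1) Hom_DomD by metis+
    have a': "a' \<in> Hom T (Dom T a') W'" "b' \<in> Hom T (Dom T a') W1'"
      using cone_in_hom[OF a'N] Ar_HomI[OF b'Ar] dc d by simp_all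
    have "((s \<cdot> a, g \<cdot> b), (s' \<cdot> a', g' \<cdot> b')) \<in> roof_rel T N"
      using roof_comp_rel[OF r(1) 1 r(2) 2 sq a'(1) a'N a'(2) sq'] .
    moreover obtain V' where "roof N V' X Z (s' \<cdot> a') (g' \<cdot> b')"
      using mem_roof_cls[OF rr] calculation by (auto simp: roof_class_def)
    ultimately show ?thesis using roof_cls_eq_iff[OF rr] by metis
  qed
  moreover have "(s, f) \<in> roof_cls s f" "(t, g) \<in> roof_cls t g"
    using roof_rel_refl r by (auto simp: roof_class_def)
  moreover have "b \<in> Ar T" "Dom T a = Dom T b" "Cod T a = Dom T f" "Cod T b = Dom T t"
    using sq h h' by (auto simp: Hom_def)
  ultimately show ?thesis
    unfolding roof_comp_def using sq(2,4) by (intro equalityI Union_least Union_upper) blast+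
qed

lemma quotient_idn_left: "c \<in> Hom (quot N) X Y \<Longrightarrow> Cmp (quot N) (Idn (quot N) Y) c = c"
  and quotient_idn_right: "c \<in> Hom (quot N) X Y \<Longrightarrow> Cmp (quot N) c (Idn (quot N) X) = c"
proof -
  assume "c \<in> Hom (quot N) X Y"
  then obtain W s f where r: "roof N W X Y s f" "c = roof_cls s f"
    using quotient_Hom_iff[of c X Y] by metis
  note h = roofD[OF r(1)]
  note i = idn_hom[OF h(4)] idn_hom[OF h(5)] idn_hom[OF h(6)]
  have "roof_comp T N (roof_cls (Idn T Y) (Idn T Y)) c = roof_cls (s \<cdot> Idn T W) (Idn T Y \<cdot> f)"
    unfolding r(2)
    by (rule roof_comp_eq[OF r(1) roof_idn[OF i(2)] i(3) cone_in_idn[OF N h(6)] h(3)]) (use h in simp)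
  then show "Cmp (quot N) (Idn (quot N) Y) c = c" using r(2) h quotient_arrow_eq[OF i(2)] by simp
  have "roof_comp T N c (roof_cls (Idn T X) (Idn T X)) = roof_cls (Idn T X \<cdot> s) (f \<cdot> Idn T W)"
    unfolding r(2)
    by (rule roof_comp_eq[OF roof_idn[OF i(1)] r(1) h(1,2) i(3)]) (use h in simp)
  then show "Cmp (quot N) c (Idn (quot N) X) = c" using r(2) h quotient_arrow_eq[OF i(1)] by simp
qed

text \<open>A common expansion with the identity roof gives \<open>f x = s x\<close>, an arrow with
  cone in \<open>N\<close>; two-out-of-three cancels \<open>x\<close>.\<close>

lemma cone_in_if_roof_cls_eq_idn:
  assumes "roof N W X X s f" "roof_cls s f = Idn (quot N) X"
  shows "f \<in> cone_in T N"
proof -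
  note h = roofD[OF assms(1)]
  note i = idn_hom[OF h(4)]
  have "((s, f), (Idn T X, Idn T X)) \<in> roof_rel T N"
    using assms roof_cls_eq_iff[OF assms(1) roof_idn[OF i]] quotient_arrow_eq[OF i] by simp
  then obtain V x y where xy: "x \<in> Hom T V W" "y \<in> Hom T V X" "s \<cdot> x = Idn T X \<cdot> y"
      "x \<in> cone_in T N" "f \<cdot> x = Idn T X \<cdot> y"
    using roof_relE2[OF _ assms(1) roof_idn[OF i]] by metis
  have "f \<cdot> x \<in> cone_in T N"
    using cone_in_two_of_three(1)[OF N xy(1) h(1) xy(4) h(2)] xy(3,5) by simp
  then show ?thesis using cone_in_two_of_three(2)[OF N xy(1) h(3) xy(4)] by blast
qed

lemma roof_comp_square:
  assumes "roof N W X Y s f" "roof N W1 Y Z t g"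
  obtains V a b where "a \<in> Hom T V W" "a \<in> cone_in T N" "b \<in> Hom T V W1" "f \<cdot> a = t \<cdot> b"
    "roof N V X Z (s \<cdot> a) (g \<cdot> b)" "Cmp (quot N) (roof_cls t g) (roof_cls s f) = roof_cls (s \<cdot> a) (g \<cdot> b)"
proof -
  note h = roofD(1-3)[OF assms(1)] and h' = roofD(1-3)[OF assms(2)]
  obtain V a b where sq: "a \<in> Hom T V W" "a \<in> cone_in T N" "b \<in> Hom T V W1" "f \<cdot> a = t \<cdot> b"
    by (rule ore[OF N h(3) h'(1,2)])
  have "roof N V X Z (s \<cdot> a) (g \<cdot> b)"
    unfolding roof_def using cmp_hom sq(1,3) h h' cone_in_two_of_three(1)[OF N sq(1) h(1) sq(2) h(2)] by blast
  then show thesis using that sq roof_comp_eq[OF assms sq] by simp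
qed

text \<open>Saturation of \<open>cone_in T N\<close>. One composite with the inverse shows that some
  \<open>f q'\<close> has cone in \<open>N\<close>, the other that \<open>f\<close> is monic up to
  null arrows; both are read off explicit squares and fed to
  \<open>cone_in_if_epi_mono\<close>.\<close>

lemma cone_in_if_iso_roof:
  assumes r: "roof N W X Y s f" and iso: "iso_arrow (quot N) (roof_cls s f)"
  shows "f \<in> cone_in T N"
proof -
  have "roof_cls s f \<in> Hom (quot N) X Y" using r quotient_Hom_iff by blast
  then obtain c where c: "c \<in> Hom (quot N) Y X" "Cmp (quot N) c (roof_cls s f) = Idn (quot N) X" "Cmp (quot N) (roof_cls s f) c = Idn (quot N) Y"
    using iso iso_arrow_iff[of "roof_cls s f" "quot N" X Y] by auto
  then obtain W' t h where r': "roof N W' Y X t h" "c = roof_cls t h"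
    using quotient_Hom_iff[of c Y X] by metis
  note sf = roofD[OF r] and th = roofD[OF r'(1)]
  obtain V p q where pq: "p \<in> Hom T V W" "p \<in> cone_in T N" "q \<in> Hom T V W'" "f \<cdot> p = t \<cdot> q"
    "roof N V X X (s \<cdot> p) (h \<cdot> q)" "Cmp (quot N) c (roof_cls s f) = roof_cls (s \<cdot> p) (h \<cdot> q)"
    using roof_comp_square[OF r r'(1)] r'(2) by metis
  have hq: "h \<cdot> q \<in> cone_in T N" using cone_in_if_roof_cls_eq_idn[OF pq(5)] pq(6) c(2) by simp
  obtain V' p' q' where pq': "p' \<in> Hom T V' W'" "q' \<in> Hom T V' W"
    "roof N V' Y Y (t \<cdot> p') (f \<cdot> q')" "Cmp (quot N) (roof_cls s f) c = roof_cls (t \<cdot> p') (f \<cdot> q')"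
    using roof_comp_square[OF r'(1) r] r'(2) by metis
  have fq: "f \<cdot> q' \<in> cone_in T N" using cone_in_if_roof_cls_eq_idn[OF pq'(3)] pq'(4) c(3) by simp
  show ?thesis
  proof (rule cone_in_if_epi_mono[OF N sf(3) pq'(2) fq])
    fix D n assume n: "n \<in> Hom T D W" "f \<cdot> n = Zer T D Y"
    \<comment> \<open>\<open>n\<close> is moved along the denominator \<open>p\<close> to
      \<open>l\<close>. From \<open>f n = 0\<close> and \<open>f p = t q\<close> the arrow
      \<open>q l\<close> is null; as \<open>h q\<close> has cone in \<open>N\<close>, so is
      \<open>l\<close>, and then \<open>n\<close>.\<close>
    obtain D' m l where ml: "m \<in> Hom T D' D" "m \<in> cone_in T N" "l \<in> Hom T D' V" "n \<cdot> m = p \<cdot> l"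
      by (rule ore[OF N n(1) pq(1,2)])
    note ql = cmp_hom[OF ml(3) pq(3)]
    have "t \<cdot> (q \<cdot> l) = Zer T D' Y"
      using cmp_assoc[OF ml(3) pq(3) th(1)] pq(4)[symmetric] cmp_assoc[OF ml(3) pq(1) sf(3)] ml(4)[symmetric]
        cmp_assoc[OF ml(1) n(1) sf(3)] n(2) cmp_zer_left[OF ml(1) sf(5)] by simp
    then have "null_mod N (t \<cdot> (q \<cdot> l))" using null_mod_zer[OF N] sf(5) hom_obD(1)[OF ml(3)] by simp
    then have "null_mod N (q \<cdot> l)" using null_mod_cancel_left[OF N _ ql th(1,2)] by blast
    then have "null_mod N ((h \<cdot> q) \<cdot> l)"
      using null_mod_comp_left[OF N _ ql th(3)] cmp_assoc[OF ml(3) pq(3) th(3)] by simp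
    then have "null_mod N l" using null_mod_cancel_left[OF N _ ml(3) cmp_hom[OF pq(3) th(3)] hq] by blast
    then have "null_mod N (n \<cdot> m)" using null_mod_comp_left[OF N _ ml(3) pq(1)] ml(4) by simp
    then show "null_mod N n" using null_mod_cancel_right[OF N _ ml(1) n(1) ml(2)] by blast
  qed
qed

text \<open>The suspension of a class is an image of sets, so both inclusions need an argument:
  roofs equivalent to the identity are suspended and, conversely, desuspended together with their
  comparison arrows.\<close>

lemma quotient_susp_idn:
  assumes "X \<in> Ob T"
  shows "SAr (quot N) (Idn (quot N) X) = Idn (quot N) (SOb T X)"
proof -
  note i = idn_hom[OF assms] and SX = susp_ob_ob[OF assms]
  note i' = idn_hom[OF SX]
  have "map_prod (SAr T) (SAr T) ` roof_cls (Idn T X) (Idn T X) =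
      roof_cls (Idn T (SOb T X)) (Idn T (SOb T X))" (is "?L = ?R")
  proof (intro equalityI subsetI)
    fix z assume "z \<in> ?L"
    then obtain s f where sf: "z = (SAr T s, SAr T f)" "(s, f) \<in> roof_cls (Idn T X) (Idn T X)" by auto
    obtain W where r: "roof N W X X s f" "((Idn T X, Idn T X), (s, f)) \<in> roof_rel T N"
      using mem_roof_cls[OF roof_idn[OF i] sf(2)] by blast
    obtain V a b where ab: "a \<in> Hom T V X" "b \<in> Hom T V W" "Idn T X \<cdot> a = s \<cdot> b" "a \<in> cone_in T N"
        "Idn T X \<cdot> a = f \<cdot> b"
      using roof_relE2[OF r(2) roof_idn[OF i] r(1)] by metis
    note h = roofD[OF r(1)]
    have r': "roof N (SOb T W) (SOb T X) (SOb T X) (SAr T s) (SAr T f)"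
      unfolding roof_def using susp_hom h cone_in_susp[OF N h(1)] by blast
    have "SAr T s \<cdot> SAr T b = SAr T a" "SAr T f \<cdot> SAr T b = SAr T a"
      using susp_cmp[OF ab(2) h(1)] susp_cmp[OF ab(2) h(3)] ab by simp_all
    then have "((Idn T (SOb T X), Idn T (SOb T X)), (SAr T s, SAr T f)) \<in> roof_rel T N"
      using roof_relI[OF roof_idn[OF i'] r' susp_hom[OF ab(1)] susp_hom[OF ab(2)]]
        susp_hom[OF ab(1)] cone_in_susp[OF N ab(1)] ab(4) by simp
    then show "z \<in> ?R" using sf(1) by (simp add: roof_class_def)
  next
    fix z assume "z \<in> ?R"
    then obtain s f where sf: "z = (s, f)" "(s, f) \<in> ?R" by (cases z) auto
    obtain W where r: "roof N W (SOb T X) (SOb T X) s f"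
        "((Idn T (SOb T X), Idn T (SOb T X)), (s, f)) \<in> roof_rel T N"
      using mem_roof_cls[OF roof_idn[OF i'] sf(2)] by blast
    obtain V a b where ab: "a \<in> Hom T V (SOb T X)" "b \<in> Hom T V W" "Idn T (SOb T X) \<cdot> a = s \<cdot> b"
        "a \<in> cone_in T N" "Idn T (SOb T X) \<cdot> a = f \<cdot> b"
      using roof_relE2[OF r(2) roof_idn[OF i'] r(1)] by metis
    note h = roofD[OF r(1)]
    obtain W0 where W0: "W0 \<in> Ob T" "SOb T W0 = W" using desuspend_ob h(6) by blast
    obtain V0 where V0: "V0 \<in> Ob T" "SOb T V0 = V" using desuspend_ob hom_obD(1)[OF ab(1)] by blast
    obtain s0 where s0: "s0 \<in> Hom T W0 X" "SAr T s0 = s" using desuspend_ar h(1) W0 assms by blast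
    obtain f0 where f0: "f0 \<in> Hom T W0 X" "SAr T f0 = f" using desuspend_ar h(3) W0 assms by blast
    obtain a0 where a0: "a0 \<in> Hom T V0 X" "SAr T a0 = a" using desuspend_ar ab(1) V0 assms by blast
    obtain b0 where b0: "b0 \<in> Hom T V0 W0" "SAr T b0 = b" using desuspend_ar ab(2) V0 W0 by blast
    have eqs: "Idn T X \<cdot> a0 = s0 \<cdot> b0" "Idn T X \<cdot> a0 = f0 \<cdot> b0"
      using susp_inj[OF a0(1) cmp_hom[OF b0(1) s0(1)]] susp_inj[OF a0(1) cmp_hom[OF b0(1) f0(1)]]
        susp_cmp[OF b0(1) s0(1)] susp_cmp[OF b0(1) f0(1)] s0 f0 a0 b0 ab by simp_all
    have "roof N W0 X X s0 f0"
      unfolding roof_def using s0 f0 cone_in_susp[OF N s0(1)] h(2) by simp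
    then have "((Idn T X, Idn T X), (s0, f0)) \<in> roof_rel T N"
      using roof_relI[OF roof_idn[OF i] _ a0(1) b0(1) eqs(1) _ eqs(2)]
        cone_in_susp[OF N a0(1)] a0 ab(4) by simp
    then have "(s0, f0) \<in> roof_cls (Idn T X) (Idn T X)" by (simp add: roof_class_def)
    then show "z \<in> ?L" using sf(1) s0(2) f0(2) by force
  qed
  then show ?thesis using quotient_arrow_eq[OF i] quotient_arrow_eq[OF i'] by simp
qed

end

end

section \<open>Transfer between a category and its Verdier quotient\<close>

context triangulated_category
begin

lemma Verdier_sel [simp]:
  "Ob (Verdier_quotient T N) = Ob T" "Ar (Verdier_quotient T N) = Ar (quot N)"
  "Dom (Verdier_quotient T N) = Dom (quot N)" "Cod (Verdier_quotient T N) = Cod (quot N)"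
  "Idn (Verdier_quotient T N) = Idn (quot N)" "Cmp (Verdier_quotient T N) = Cmp (quot N)"
  "Zer (Verdier_quotient T N) = Zer (quot N)" "SOb (Verdier_quotient T N) = SOb T"
  "Tri (Verdier_quotient T N) = quotient_triangles T N"
  by (simp_all add: Verdier_quotient_def quotient_category_def suspended_category.defs triangulated.defs)

lemma Verdier_Hom [simp]: "Hom (Verdier_quotient T N) X Y = Hom (quot N) X Y"
  by (auto simp: Hom_def)

context
  fixes N assumes N: "thick T N"
begin

abbreviation (input) "verd \<equiv> Verdier_quotient T N"
abbreviation (input) "qarr \<equiv> quotient_arrow T N"

text \<open>The isomorphism required by \<open>quotient_triangles\<close> consists of identities.
  The unit laws and \<open>quotient_susp_idn\<close> make its squares commute.\<close>

lemma image_Tri: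
  assumes "triangle X Y Z u v w"
  shows "(qarr u, qarr v, qarr w) \<in> Tri verd"
proof -
  note t = triangleD[OF assms]
  note q = quotient_arrow_hom[OF N t(1)] quotient_arrow_hom[OF N t(2)] quotient_arrow_hom[OF N t(3)]
  have cand: "candidate_triangle (quot N) (qarr u, qarr v, qarr w)"
    using q by (auto simp: candidate_triangle_def)
  have i: "Idn (quot N) A \<in> Hom (quot N) A A" if "A \<in> Ob T" for A
    using quotient_arrow_hom[OF N idn_hom[OF that]] by simp
  have iso: "iso_arrow (quot N) (Idn (quot N) A)" if "A \<in> Ob T" for A
    using iso_arrow_iff[OF i[OF that]] quotient_idn_left[OF N i[OF that]] i[OF that] by metis
  have "triangle_morphism (quot N) (Idn (quot N) X, Idn (quot N) Y, Idn (quot N) Z)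
      (qarr u, qarr v, qarr w) (qarr u, qarr v, qarr w)"
    unfolding triangle_morphism_def
    using q[THEN Hom_DomD] i[OF t(5)] i[OF t(6)] i[OF t(7)] q[THEN quotient_idn_left[OF N]]
      q[THEN quotient_idn_right[OF N]] quotient_susp_idn[OF N t(5)] by (simp del: quotient_sel)
  then have "triangles_isomorphic (quot N) (qarr u, qarr v, qarr w) (qarr u, qarr v, qarr w)"
    unfolding triangles_isomorphic_def using iso t(5-7) by blast
  then show ?thesis using cand t(4) by (auto simp: quotient_triangles_def)
qed

lemma zero_object_Verdier:
  assumes "zero_object T Z"
  shows "zero_object verd Z"
proof -
  have Z: "Z \<in> Ob T" using assms zero_object_iff by blast
  have to: "c = qarr (Zer T X Z)" if X: "X \<in> Ob T" and c: "c \<in> Hom (quot N) X Z" for X c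
  proof -
    obtain W s f where r: "roof N W X Z s f" "c = roof_cls N s f"
      using c quotient_Hom_iff[OF N, of c X Z] by metis
    note h = roofD[OF N r(1)] and z = zer_hom[OF X Z]
    have f: "f = Zer T W Z" using hom_to_zero assms h(3) by blast
    have "((s, f), (Idn T X, Zer T X Z)) \<in> roof_rel T N"
      by (rule roof_relI[OF N r(1) roof_idn[OF N z] idn_hom[OF h(6)] h(1)])
        (use h f cmp_zer_left[OF h(1) Z] in simp_all)
    then show ?thesis
      using r(2) roof_cls_eq_iff[OF N r(1) roof_idn[OF N z]] quotient_arrow_eq[OF N z] by simp
  qed
  have "from": "c = qarr (Zer T Z X)" if X: "X \<in> Ob T" and c: "c \<in> Hom (quot N) Z X" for X c
  proof -
    obtain W s f where r: "roof N W Z X s f" "c = roof_cls N s f"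
      using c quotient_Hom_iff[OF N, of c Z X] by metis
    note h = roofD[OF N r(1)] and z = zer_hom[OF Z X] and zW = zer_hom[OF Z h(6)] and i = idn_hom[OF Z]
    \<comment> \<open>Endomorphisms of a zero object all agree, so the zero arrow is a section of
      the denominator and can serve as comparison arrow.\<close>
    have s: "s \<cdot> Zer T Z W = Idn T Z" 
      using hom_to_zero[OF assms cmp_hom[OF zW h(1)]] hom_to_zero[OF assms i] by simp
    have "((s, f), (Idn T Z, Zer T Z X)) \<in> roof_rel T N"
      by (rule roof_relI[OF N r(1) roof_idn[OF N z] zW i])
        (use s i z cone_in_idn[OF N Z] cmp_zer_right[OF h(3) Z] in simp_all)
    then show ?thesis
      using r(2) roof_cls_eq_iff[OF N r(1) roof_idn[OF N z]] quotient_arrow_eq[OF N z] by simp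
  qed
  show ?thesis
    unfolding zero_object_def
    using Z to "from" quotient_arrow_hom[OF N zer_hom] by auto
qed

context
  fixes U assumes U: "thick T U" and NU: "N \<subseteq> U"
begin

lemma roof_cone_in: "roof N W X Y s f \<Longrightarrow> s \<in> cone_in T U"
  using roofD(2)[OF N] cone_in_mono[OF NU] by blast

text \<open>Both legs of the roof have cone in \<open>U\<close>, so its apex lies in
  \<open>U\<close> exactly when either end does.\<close>

lemma iso_objects_iff:
  assumes "iso_arrow (quot N) c" "c \<in> Hom (quot N) X Y"
  shows "X \<in> U \<longleftrightarrow> Y \<in> U"
proof -
  obtain W s f where r: "roof N W X Y s f" "c = roof_cls N s f"
    using assms quotient_Hom_iff[OF N, of c X Y] by metis
  note h = roofD[OF N r(1)]
  have "f \<in> cone_in T U"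
    using cone_in_if_iso_roof[OF N r(1)] assms(1) r(2) cone_in_mono[OF NU] by blast
  then show ?thesis
    using cone_in_objects_iff[OF U h(1) roof_cone_in[OF r(1)]] cone_in_objects_iff[OF U h(3)] by blast
qed

text \<open>The identity of \<open>X\<close> is represented by a roof whose numerator
  \<open>g b\<close> passes through \<open>W1\<close>, which lies in \<open>U\<close> along with
  \<open>Y\<close>. So \<open>g b\<close> is null and also has cone in \<open>U\<close>.\<close>

lemma quotient_retract:
  assumes i: "i \<in> Hom (quot N) X Y" and p: "p \<in> Hom (quot N) Y X"
    and pi: "Cmp (quot N) p i = Idn (quot N) X" and Y: "Y \<in> U"
  shows "X \<in> U"
proof -
  obtain W s f where r: "roof N W X Y s f" "i = roof_cls N s f"
    using i quotient_Hom_iff[OF N, of i X Y] by metis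
  obtain W1 t g where r': "roof N W1 Y X t g" "p = roof_cls N t g"
    using p quotient_Hom_iff[OF N, of p Y X] by metis
  note h = roofD[OF N r(1)] and h' = roofD[OF N r'(1)]
  obtain A a b where ab: "a \<in> Hom T A W" "b \<in> Hom T A W1" "roof N A X X (s \<cdot> a) (g \<cdot> b)"
    "Cmp (quot N) p i = roof_cls N (s \<cdot> a) (g \<cdot> b)"
    using roof_comp_square[OF N r(1) r'(1)] r(2) r'(2) by metis
  have gb: "g \<cdot> b \<in> cone_in T U"
    using cone_in_if_roof_cls_eq_idn[OF N ab(3)] ab(4) pi cone_in_mono[OF NU] by auto
  have "W1 \<in> U" using cone_in_objects_iff[OF U h'(1) roof_cone_in[OF r'(1)]] Y by blast
  then have "null_mod U (g \<cdot> b)" 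
    using null_mod_comp_left[OF U null_mod_if_target[OF U ab(2)] ab(2) h'(3)] by blast
  then show ?thesis using in_if_null_mod_cone_in(2)[OF U _ gb cmp_hom[OF ab(2) h'(3)]] by blast
qed

lemma quotient_triangle_cases:
  assumes "(u', v', w') \<in> Tri verd"
  obtains X Y Z u v w a b c X' Y' Z' where "triangle X Y Z u v w"
    "u' \<in> Hom (quot N) X' Y'" "v' \<in> Hom (quot N) Y' Z'" "w' \<in> Hom (quot N) Z' (SOb T X')"
    "a \<in> Hom (quot N) X X'" "b \<in> Hom (quot N) Y Y'" "c \<in> Hom (quot N) Z Z'"
    "iso_arrow (quot N) a" "iso_arrow (quot N) b" "iso_arrow (quot N) c"
    "Cmp (quot N) b (qarr u) = Cmp (quot N) u' a"
proof -
  have "candidate_triangle (quot N) (u', v', w')"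
    and "\<exists>(u, v, w) \<in> Tri T. triangles_isomorphic (quot N) (qarr u, qarr v, qarr w) (u', v', w')"
    using assms by (auto simp: quotient_triangles_def)
  then obtain X' Y' Z' u v w a b c where c: "u' \<in> Hom (quot N) X' Y'" "v' \<in> Hom (quot N) Y' Z'"
    "w' \<in> Hom (quot N) Z' (SOb T X')" "(u, v, w) \<in> Tri T"
    and m: "triangle_morphism (quot N) (a, b, c) (qarr u, qarr v, qarr w) (u', v', w')"
    and iso: "iso_arrow (quot N) a" "iso_arrow (quot N) b" "iso_arrow (quot N) c"
    unfolding candidate_triangle_def triangles_isomorphic_def by fastforce
  obtain X Y Z where t: "triangle X Y Z u v w" using triangle_if_Tri c(4) by blast
  note q = triangleD(1-3)[OF t, THEN quotient_arrow_hom[OF N]]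
  show thesis
    using that[OF t c(1-3) _ _ _ iso] m q[THEN Hom_DomD] c(1-3)[THEN Hom_DomD]
    unfolding triangle_morphism_def by (simp del: quotient_sel)
qed

text \<open>Triangles of the quotient are isomorphic to images of triangles, and
  \<open>iso_objects_iff\<close> carries membership across. Through this a thick subcategory of
  \<open>T\<close> containing \<open>S\<close> and the kernel bounds \<open>Thick\<close> in the
  local category.\<close>

lemma thick_Verdier: "thick verd U"
  unfolding thick_def
proof (intro conjI allI impI ballI)
  show "U \<subseteq> Ob verd" using thick_sub[OF U] by auto
  obtain Z where "zero_object T Z" by (rule a_zero_object)
  then show "\<exists>Z\<in>U. zero_object verd Z" using zero_object_Verdier thick_zero[OF U] by blast
  show "X \<in> U \<longleftrightarrow> SOb verd X \<in> U" if "X \<in> Ob verd" for X using thick_susp[OF U] that by simp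
  show "Cod verd f \<in> U" if "iso_arrow verd f \<and> Dom verd f \<in> U" for f
    using that iso_objects_iff[of f "Dom verd f" "Cod verd f"] Ar_HomI[of f "quot N"] by (simp add: iso_arrow_def del: quotient_sel)
next
  fix u' v' w' assume "(u', v', w') \<in> Tri verd"
  then obtain X Y Z u v w a b c X' Y' Z' where t: "triangle X Y Z u v w" and
    h: "u' \<in> Hom (quot N) X' Y'" "v' \<in> Hom (quot N) Y' Z'" "w' \<in> Hom (quot N) Z' (SOb T X')" and
    ab: "a \<in> Hom (quot N) X X'" "b \<in> Hom (quot N) Y Y'" "c \<in> Hom (quot N) Z Z'" and
    iso: "iso_arrow (quot N) a" "iso_arrow (quot N) b" "iso_arrow (quot N) c"
    by (rule quotient_triangle_cases)
  have d: "Dom verd u' = X'" "Cod verd u' = Y'" "Cod verd v' = Z'" using h by (auto simp: Hom_def)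
  have e: "X \<in> U \<longleftrightarrow> X' \<in> U" "Y \<in> U \<longleftrightarrow> Y' \<in> U" "Z \<in> U \<longleftrightarrow> Z' \<in> U"
    using iso_objects_iff iso ab by blast+
  show "Cod verd v' \<in> U" if "Dom verd u' \<in> U \<and> Cod verd u' \<in> U"
    using thick_triangle(1)[OF U t] that d e by metis
  show "Dom verd u' \<in> U" if "Cod verd u' \<in> U \<and> Cod verd v' \<in> U"
    using thick_triangle(2)[OF U t] that d e by metis
  show "Cod verd u' \<in> U" if "Dom verd u' \<in> U \<and> Cod verd v' \<in> U"
    using thick_triangle(3)[OF U t] that d e by metis
next
  fix X X' Y assume "direct_sum_of verd X X' Y \<and> Y \<in> U"
  then show "X \<in> U" "X' \<in> U"
    unfolding direct_sum_of_def using quotient_retract by (auto simp del: quotient_sel)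
qed

text \<open>A triangle on the image of \<phi> is merely isomorphic to the image of a triangle on
  another arrow \<open>u\<close>. The square relating them, expanded to roofs, consists of arrows
  with cone in \<open>U\<close> apart from \<phi>, and two-out-of-three isolates \<phi>.\<close>

lemma cone_in_if_quotient_cone:
  assumes phi: "\<phi> \<in> Hom T A B" and tri: "(qarr \<phi>, v', w') \<in> Tri verd" and cod: "Cod verd v' \<in> U"
  shows "\<phi> \<in> cone_in T U"
proof -
  obtain X Y Z u v w a b c X' Y' Z' where t: "triangle X Y Z u v w" and
    h: "qarr \<phi> \<in> Hom (quot N) X' Y'" "v' \<in> Hom (quot N) Y' Z'" and
    ab: "a \<in> Hom (quot N) X X'" "b \<in> Hom (quot N) Y Y'" "c \<in> Hom (quot N) Z Z'" and
    iso: "iso_arrow (quot N) a" "iso_arrow (quot N) b" "iso_arrow (quot N) c" and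
    sq: "Cmp (quot N) b (qarr u) = Cmp (quot N) (qarr \<phi>) a"
    by (rule quotient_triangle_cases[OF tri])
  note u = triangleD(1)[OF t]
  have X': "X' = A" "Y' = B" using h(1) quotient_arrow_hom[OF N phi] unfolding Hom_def by auto
  have "Z \<in> U" using iso_objects_iff[OF iso(3) ab(3)] cod Hom_CodD[OF h(2)] by simp
  then have uU: "u \<in> cone_in T U" using cone_in_iff[OF U t] by blast
  obtain W s f where r: "roof N W X A s f" "a = roof_cls N s f"
    using ab(1) X' quotient_Hom_iff[OF N, of a X A] by metis
  obtain W' s' g where r': "roof N W' Y B s' g" "b = roof_cls N s' g"
    using ab(2) X' quotient_Hom_iff[OF N, of b Y B] by metis
  note sf = roofD[OF N r(1)] and sg = roofD[OF N r'(1)]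
  have fU: "f \<in> cone_in T U" and gU: "g \<in> cone_in T U"
    using cone_in_if_iso_roof[OF N r(1)] cone_in_if_iso_roof[OF N r'(1)] iso(1,2) r(2) r'(2)
      cone_in_mono[OF NU] by blast+
  obtain E p q where pq: "p \<in> Hom T E X" "p \<in> cone_in T N" "q \<in> Hom T E W'" "u \<cdot> p = s' \<cdot> q"
    by (rule ore[OF N u sg(1,2)])
  have 1: "Cmp (quot N) b (qarr u) = roof_cls N (Idn T X \<cdot> p) (g \<cdot> q)"
    using roof_comp_eq[OF N roof_idn[OF N u] r'(1) pq] quotient_arrow_eq[OF N u] r'(2) by simp
  have 2: "Cmp (quot N) (qarr \<phi>) a = roof_cls N (s \<cdot> Idn T W) (\<phi> \<cdot> f)"
    using roof_comp_eq[OF N r(1) roof_idn[OF N phi] idn_hom[OF sf(6)] cone_in_idn[OF N sf(6)] sf(3)]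
      quotient_arrow_eq[OF N phi] r(2) sf(3) by simp
  have rp: "roof N E X B p (g \<cdot> q)" and rs: "roof N W X B s (\<phi> \<cdot> f)"
    using pq sf cmp_hom[OF pq(3) sg(3)] cmp_hom[OF sf(3) phi] unfolding roof_def by simp_all
  have "((p, g \<cdot> q), (s, \<phi> \<cdot> f)) \<in> roof_rel T N"
    using 1 2 sq roof_cls_eq_iff[OF N rp rs] pq(1) sf(1) by simp
  then obtain D x y where xy: "x \<in> Hom T D E" "y \<in> Hom T D W" "p \<cdot> x = s \<cdot> y" "x \<in> cone_in T N"
    "y \<in> cone_in T N" "(g \<cdot> q) \<cdot> x = (\<phi> \<cdot> f) \<cdot> y"
    by (rule roof_relE2[OF N _ rp rs])
  have pU: "p \<in> cone_in T U" and xU: "x \<in> cone_in T U" and yU: "y \<in> cone_in T U" and s'U: "s' \<in> cone_in T U"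
    using pq(2) xy(4,5) sg(2) cone_in_mono[OF NU] by blast+
  have "s' \<cdot> q \<in> cone_in T U" using cone_in_two_of_three(1)[OF U pq(1) u pU uU] pq(4) by simp
  then have qU: "q \<in> cone_in T U" using cone_in_two_of_three(3)[OF U pq(3) sg(1) s'U] by blast
  have "g \<cdot> q \<in> cone_in T U" using cone_in_two_of_three(1)[OF U pq(3) sg(3) qU gU] .
  then have "(\<phi> \<cdot> f) \<cdot> y \<in> cone_in T U"
    using cone_in_two_of_three(1)[OF U xy(1) cmp_hom[OF pq(3) sg(3)] xU] xy(6) by simp
  then have "\<phi> \<cdot> f \<in> cone_in T U"
    using cone_in_two_of_three(2)[OF U xy(2) cmp_hom[OF sf(3) phi] yU] by blast
  then show ?thesis using cone_in_two_of_three(2)[OF U sf(3) phi fU] by blast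
qed

end

end

end

section \<open>Homogeneous ideals\<close>

lemma (in abelian_monoid) finsum_superset:
  assumes "finite F" "A \<subseteq> F" "f \<in> F \<rightarrow> carrier G" "\<And>i. i \<in> F - A \<Longrightarrow> f i = \<zero>"
  shows "finsum G f F = finsum G f A"
proof -
  have "finsum G f (A \<union> (F - A)) = finsum G f A \<oplus> finsum G f (F - A)"
    by (rule finsum_Un_disjoint) (use assms finite_subset in blast)+
  moreover have "finsum G f (F - A) = finsum G (\<lambda>i. \<zero>) (F - A)"
    by (rule finsum_cong') (use assms in auto)
  moreover have "A \<union> (F - A) = F" "f \<in> A \<rightarrow> carrier G" using assms by auto
  ultimately show ?thesis using finsum_closed by simp
qed

lemma (in ring) finsum_in_subgroup:
  assumes "additive_subgroup H R" "\<And>i. i \<in> F \<Longrightarrow> f i \<in> H"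
  shows "finsum R f F \<in> H"
proof -
  interpret H: additive_subgroup H R by (rule assms(1))
  have carr: "f i \<in> carrier R" if "i \<in> F" for i using assms(2)[OF that] H.a_Hcarr by blast
  show ?thesis
    using assms(2) carr
  proof (induction F rule: infinite_finite_induct)
    case (insert x F)
    then show ?case by (subst finsum_insert) auto
  qed auto
qed

context graded_comm_ring
begin

lemma G_carrier: "r \<in> G n \<Longrightarrow> r \<in> carrier R"
  using degree_subgroup additive_subgroup.a_Hcarr by metis

lemma G_zero: "\<zero> \<in> G n"
  and G_add: "\<lbrakk>r \<in> G n; s \<in> G n\<rbrakk> \<Longrightarrow> r \<oplus> s \<in> G n"
  and G_minus: "r \<in> G n \<Longrightarrow> \<ominus> r \<in> G n"
  using degree_subgroup additive_subgroup.zero_closed additive_subgroup.a_closed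
    additive_subgroup.a_inv_closed[OF degree_subgroup] by metis+

lemma G_pow: "r \<in> G n \<Longrightarrow> r [^] (k::nat) \<in> G (int k * n)"
proof (induction k)
  case 0
  then show ?case by (simp add: degree_one)
next
  case (Suc k)
  then show ?case
    using degree_mult[OF Suc.IH[OF Suc.prems] Suc.prems] by (simp add: algebra_simps)
qed

definition hcomp :: "'a \<Rightarrow> int \<Rightarrow> 'a" where
  "hcomp x = (THE c. homogeneous_decomposition R G x c)"

lemma hcomp_decomposition: "x \<in> carrier R \<Longrightarrow> homogeneous_decomposition R G x (hcomp x)"
  unfolding hcomp_def by (rule theI'[OF direct_sum])

lemma decomposition_carrier:
  assumes "homogeneous_decomposition R G x c"
  shows "x \<in> carrier R"
  using assms G_carrier unfolding homogeneous_decomposition_def by (auto intro!: finsum_closed)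

lemma hcomp_unique: "homogeneous_decomposition R G x c \<Longrightarrow> c = hcomp x"
  using direct_sum[OF decomposition_carrier] hcomp_decomposition[OF decomposition_carrier] by blast

lemma hcomp_G: "x \<in> carrier R \<Longrightarrow> hcomp x n \<in> G n"
  using hcomp_decomposition by (auto simp: homogeneous_decomposition_def)

lemma hcomp_carrier: "x \<in> carrier R \<Longrightarrow> hcomp x n \<in> carrier R"
  using hcomp_G G_carrier by blast

abbreviation "hsupp x \<equiv> {n. hcomp x n \<noteq> \<zero>}"

lemma finite_hsupp: "x \<in> carrier R \<Longrightarrow> finite (hsupp x)"
  using hcomp_decomposition by (auto simp: homogeneous_decomposition_def)

lemma hcomp_sum:
  assumes "x \<in> carrier R" "finite F" "hsupp x \<subseteq> F"
  shows "x = finsum R (hcomp x) F"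
proof -
  have "x = finsum R (hcomp x) (hsupp x)"
    using hcomp_decomposition[OF assms(1)] by (simp add: homogeneous_decomposition_def)
  also have "\<dots> = finsum R (hcomp x) F"
    by (rule finsum_superset[symmetric]) (use assms hcomp_carrier in auto)
  finally show ?thesis .
qed

lemma hcomp_eqI:
  assumes "\<And>n. c n \<in> G n" "finite F" "\<And>n. n \<notin> F \<Longrightarrow> c n = \<zero>" "x = finsum R c F"
  shows "hcomp x = c"
proof (rule hcomp_unique[symmetric])
  have "{n. c n \<noteq> \<zero>} \<subseteq> F" using assms(3) by blast
  moreover have "finsum R c F = finsum R c {n. c n \<noteq> \<zero>}"
    by (rule finsum_superset) (use assms G_carrier in auto)
  ultimately show "homogeneous_decomposition R G x c"
    unfolding homogeneous_decomposition_def using assms finite_subset by auto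
qed

lemma hcomp_homogeneous:
  assumes "r \<in> G d"
  shows "hcomp r = (\<lambda>n. if n = d then r else \<zero>)"
  by (rule hcomp_eqI[where F = "{d}"]) (use assms G_zero G_carrier in auto)

lemma hcomp_zero: "hcomp \<zero> n = \<zero>"
  using hcomp_homogeneous[OF G_zero] by simp

lemma hcomp_add:
  assumes "x \<in> carrier R" "y \<in> carrier R"
  shows "hcomp (x \<oplus> y) n = hcomp x n \<oplus> hcomp y n"
proof -
  let ?F = "hsupp x \<union> hsupp y"
  have F: "finite ?F" using finite_hsupp assms by blast
  have "hcomp (x \<oplus> y) = (\<lambda>n. hcomp x n \<oplus> hcomp y n)"
  proof (rule hcomp_eqI[OF _ F])
    show "x \<oplus> y = finsum R (\<lambda>n. hcomp x n \<oplus> hcomp y n) ?F"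
      using finsum_addf[of "hcomp x" ?F "hcomp y"] hcomp_sum[OF assms(1) F] hcomp_sum[OF assms(2) F]
        hcomp_carrier assms by auto
  qed (use hcomp_G G_add assms in auto)
  then show ?thesis by simp
qed

lemma hcomp_mult_left:
  assumes "r \<in> G d" "x \<in> carrier R"
  shows "hcomp (r \<otimes> x) n = r \<otimes> hcomp x (n - d)"
proof -
  let ?F = "(\<lambda>n. n + d) ` hsupp x"
  note r = G_carrier[OF assms(1)]
  have "hcomp (r \<otimes> x) = (\<lambda>n. r \<otimes> hcomp x (n - d))"
  proof (rule hcomp_eqI[where F = ?F])
    show "r \<otimes> hcomp x (n - d) \<in> G n" for n
      using degree_mult[OF assms(1) hcomp_G[OF assms(2), of "n - d"]] by simp
    show "finite ?F" using finite_hsupp assms(2) by blast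
    show "r \<otimes> hcomp x (n - d) = \<zero>" if "n \<notin> ?F" for n
    proof -
      have "n - d \<notin> hsupp x" using that by (auto simp: image_iff dest: spec[of _ "n - d"])
      then show ?thesis using r by simp
    qed
    have "finsum R (\<lambda>n. r \<otimes> hcomp x (n - d)) ?F = finsum R (\<lambda>n. r \<otimes> hcomp x n) (hsupp x)"
      by (subst finsum_reindex) (use hcomp_carrier[OF assms(2)] r in auto)
    also have "\<dots> = r \<otimes> finsum R (hcomp x) (hsupp x)"
      by (rule finsum_rdistr[symmetric]) (use finite_hsupp hcomp_carrier r assms(2) in auto)
    also have "\<dots> = r \<otimes> x" using hcomp_sum[OF assms(2) finite_hsupp[OF assms(2)]] by simp
    finally show "r \<otimes> x = finsum R (\<lambda>n. r \<otimes> hcomp x (n - d)) ?F" ..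
  qed
  then show ?thesis by simp
qed

lemma hcomp_mult_right:
  assumes "r \<in> G d" "x \<in> carrier R"
  shows "hcomp (x \<otimes> r) n = hcomp x (n - d) \<otimes> r"
proof -
  let ?F = "(\<lambda>n. n + d) ` hsupp x"
  note r = G_carrier[OF assms(1)]
  have "hcomp (x \<otimes> r) = (\<lambda>n. hcomp x (n - d) \<otimes> r)"
  proof (rule hcomp_eqI[where F = ?F])
    show "hcomp x (n - d) \<otimes> r \<in> G n" for n
      using degree_mult[OF hcomp_G[OF assms(2), of "n - d"] assms(1)] by simp
    show "finite ?F" using finite_hsupp assms(2) by blast
    show "hcomp x (n - d) \<otimes> r = \<zero>" if "n \<notin> ?F" for n
    proof -
      have "n - d \<notin> hsupp x" using that by (auto simp: image_iff dest: spec[of _ "n - d"])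
      then show ?thesis using r by simp
    qed
    have "finsum R (\<lambda>n. hcomp x (n - d) \<otimes> r) ?F = finsum R (\<lambda>n. hcomp x n \<otimes> r) (hsupp x)"
      by (subst finsum_reindex) (use hcomp_carrier[OF assms(2)] r in auto)
    also have "\<dots> = finsum R (hcomp x) (hsupp x) \<otimes> r"
      by (rule finsum_ldistr[symmetric]) (use finite_hsupp hcomp_carrier r assms(2) in auto)
    also have "\<dots> = x \<otimes> r" using hcomp_sum[OF assms(2) finite_hsupp[OF assms(2)]] by simp
    finally show "x \<otimes> r = finsum R (\<lambda>n. hcomp x (n - d) \<otimes> r) ?F" ..
  qed
  then show ?thesis by simp
qed

lemma hcomp_minus:
  assumes "x \<in> carrier R"
  shows "hcomp (\<ominus> x) n = \<ominus> hcomp x n"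
  using hcomp_add[OF assms, of "\<ominus> x" n] hcomp_zero[of n] assms hcomp_carrier
  by (metis a_inv_closed minus_equality r_neg a_comm)

lemma minus_one_mult: "x \<in> carrier R \<Longrightarrow> (\<ominus> \<one>) \<otimes> x = \<ominus> x"
  by (simp add: l_minus)

section \<open>Homogeneous ideals described degree by degree\<close>

definition homogeneous_family :: "(int \<Rightarrow> 'a set) \<Rightarrow> bool" where
  "homogeneous_family J \<longleftrightarrow> (\<forall>n. J n \<subseteq> G n \<and> \<zero> \<in> J n \<and> (\<forall>x\<in>J n. \<forall>y\<in>J n. x \<oplus> y \<in> J n)) \<and>
     (\<forall>m n. \<forall>r\<in>G m. \<forall>x\<in>J n. r \<otimes> x \<in> J (m + n))"

definition family_ideal :: "(int \<Rightarrow> 'a set) \<Rightarrow> 'a set" where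
  "family_ideal J = {x \<in> carrier R. \<forall>n. hcomp x n \<in> J n}"

text \<open>Negatives come from multiplying by minus one in degree 0, right multiples from graded
  commutativity, and multiples by arbitrary elements from summing over homogeneous
  components.\<close>

lemma homogeneous_ideal_family_ideal:
  assumes J: "homogeneous_family J"
  shows "homogeneous_ideal R G (family_ideal J)"
proof -
  have JG: "x \<in> G n" if "x \<in> J n" for x n using J that by (auto simp: homogeneous_family_def)
  have J0: "\<zero> \<in> J n" for n using J by (auto simp: homogeneous_family_def)
  have Jadd: "x \<oplus> y \<in> J n" if "x \<in> J n" "y \<in> J n" for x y n
    using J that by (auto simp: homogeneous_family_def)
  have Jl: "r \<otimes> x \<in> J (m + n)" if "r \<in> G m" "x \<in> J n" for r x m n
    using J that by (auto simp: homogeneous_family_def)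
  have Jm: "\<ominus> x \<in> J n" if "x \<in> J n" for x n
    using Jl[OF G_minus[OF degree_one] that] minus_one_mult G_carrier[OF JG[OF that]] by simp
  have Jr: "x \<otimes> r \<in> J (n + m)" if "r \<in> G m" "x \<in> J n" for r x m n
    using graded_commute[OF JG[OF that(2)] that(1)] Jl[OF that] Jm[OF Jl[OF that]]
    by (simp add: add.commute split: if_splits)
  let ?P = "family_ideal J"
  have hom: "x \<in> ?P" if "x \<in> J n" for x n
    unfolding family_ideal_def using hcomp_homogeneous[OF JG[OF that]] that J0 G_carrier[OF JG[OF that]] by simp
  have sub: "subgroup ?P (add_monoid R)"
  proof (rule add.subgroupI)
    show "?P \<subseteq> carrier R" by (auto simp: family_ideal_def)
    show "?P \<noteq> {}" using hom J0 by blast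
    show "\<ominus> a \<in> ?P" if "a \<in> ?P" for a
      using that hcomp_minus Jm by (auto simp: family_ideal_def)
    show "a \<oplus> b \<in> ?P" if "a \<in> ?P" "b \<in> ?P" for a b
      using that hcomp_add Jadd by (auto simp: family_ideal_def)
  qed
  then have asub: "additive_subgroup ?P R" by (rule additive_subgroupI)
  have carr: "x \<in> carrier R" if "x \<in> ?P" for x using that by (auto simp: family_ideal_def)
  have hl: "r \<otimes> x \<in> ?P" and hr: "x \<otimes> r \<in> ?P" if r: "r \<in> G d" and x: "x \<in> ?P" for r x d
  proof -
    have x': "x \<in> carrier R" "\<And>n. hcomp x n \<in> J n" using x by (auto simp: family_ideal_def)
    have "r \<otimes> hcomp x (n - d) \<in> J n" "hcomp x (n - d) \<otimes> r \<in> J n" for n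
      using Jl[OF r x'(2), of "n - d"] Jr[OF r x'(2), of "n - d"] by simp_all
    then show "r \<otimes> x \<in> ?P" "x \<otimes> r \<in> ?P"
      using hcomp_mult_left[OF r x'(1)] hcomp_mult_right[OF r x'(1)] x'(1) G_carrier[OF r]
      by (auto simp: family_ideal_def)
  qed
  have ideal: "ideal ?P R"
  proof (rule idealI[OF ring_axioms sub])
    fix a x assume a: "a \<in> ?P" and x: "x \<in> carrier R"
    note s = hcomp_sum[OF x finite_hsupp[OF x] subset_refl]
    have "x \<otimes> a = finsum R (\<lambda>n. hcomp x n \<otimes> a) (hsupp x)"
      by (subst s) (rule finsum_ldistr, use finite_hsupp x hcomp_carrier carr a in auto)
    also have "\<dots> \<in> ?P" by (rule finsum_in_subgroup[OF asub hl[OF hcomp_G[OF x] a]])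
    finally show "x \<otimes> a \<in> ?P" .
    have "a \<otimes> x = finsum R (\<lambda>n. a \<otimes> hcomp x n) (hsupp x)"
      by (subst s) (rule finsum_rdistr, use finite_hsupp x hcomp_carrier carr a in auto)
    also have "\<dots> \<in> ?P" by (rule finsum_in_subgroup[OF asub hr[OF hcomp_G[OF x] a]])
    finally show "a \<otimes> x \<in> ?P" .
  qed
  show ?thesis
    unfolding homogeneous_ideal_def
    using ideal hcomp_unique hom by (fastforce simp: family_ideal_def)
qed

lemma homogeneous_mem_family_ideal:
  assumes J: "homogeneous_family J" and x: "x \<in> G n"
  shows "x \<in> family_ideal J \<longleftrightarrow> x \<in> J n"
proof -
  have "\<zero> \<in> J m" for m using J by (auto simp: homogeneous_family_def)
  then show ?thesis
    unfolding family_ideal_def using hcomp_homogeneous[OF x] G_carrier[OF x] by auto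
qed

lemma homogeneous_idealD:
  assumes "homogeneous_ideal R G P"
  shows "ideal P R" "P \<subseteq> carrier R" "x \<in> P \<Longrightarrow> hcomp x n \<in> P"
proof -
  show i: "ideal P R" using assms by (auto simp: homogeneous_ideal_def)
  show c: "P \<subseteq> carrier R" using ideal.Icarr[OF i] by (intro subsetI)
  show "hcomp x n \<in> P" if "x \<in> P"
    using that assms hcomp_decomposition c by (auto simp: homogeneous_ideal_def)
qed

lemma homogeneous_ideal_memI:
  assumes "homogeneous_ideal R G P" "x \<in> carrier R" "\<And>n. hcomp x n \<in> P"
  shows "x \<in> P"
proof -
  interpret P: ideal P R by (rule homogeneous_idealD(1)[OF assms(1)])
  show ?thesis
    by (subst hcomp_sum[OF assms(2) finite_hsupp[OF assms(2)] subset_refl])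
      (rule finsum_in_subgroup[OF P.additive_subgroup_axioms assms(3)])
qed

text \<open>Primality need only be tested on homogeneous elements: look at the product of the components
  of highest degree outside \<open>P\<close>.\<close>

lemma SpecI_homogeneous:
  assumes P: "homogeneous_ideal R G P" and one: "\<one> \<notin> P"
    and prime: "\<And>m n a b. \<lbrakk>a \<in> G m; b \<in> G n; a \<otimes> b \<in> P\<rbrakk> \<Longrightarrow> a \<in> P \<or> b \<in> P"
  shows "P \<in> Spec R G"
proof -
  interpret P: ideal P R by (rule homogeneous_idealD(1)[OF P])
  have "a \<in> P \<or> b \<in> P" if a: "a \<in> carrier R" and b: "b \<in> carrier R" and ab: "a \<otimes> b \<in> P" for a b
  proof (rule ccontr)
    assume neg: "\<not> (a \<in> P \<or> b \<in> P)"
    define bad where "bad x = {n. hcomp x n \<notin> P}" for x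
    have bad: "finite (bad x)" if "x \<in> carrier R" for x
      by (rule finite_subset[OF _ finite_hsupp[OF that]]) (auto simp: bad_def)
    have ne: "bad a \<noteq> {}" "bad b \<noteq> {}"
      using homogeneous_ideal_memI[OF P] a b neg by (auto simp: bad_def)
    define n m where "n = Max (bad a)" and "m = Max (bad b)"
    have n: "hcomp a n \<notin> P" "\<And>i. i > n \<Longrightarrow> hcomp a i \<in> P"
      using Max_in[OF bad[OF a] ne(1)] Max_ge[OF bad[OF a]] unfolding n_def by (force simp: bad_def)+
    have m: "hcomp b m \<notin> P" "\<And>i. i > m \<Longrightarrow> hcomp b i \<in> P"
      using Max_in[OF bad[OF b] ne(2)] Max_ge[OF bad[OF b]] unfolding m_def by (force simp: bad_def)+
    \<comment> \<open>These are the terms of the component of \<open>a \<otimes> b\<close> in degree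
      \<open>n + m\<close>. For \<open>i > n\<close> the first factor is in \<open>P\<close>, for
      \<open>i < n\<close> the second, so only the term at \<open>i = n\<close> is in doubt.\<close>
    let ?c = "\<lambda>i. hcomp a i \<otimes> hcomp b (n + m - i)"
    let ?F = "hsupp a - {n}"
    have c: "?c i \<in> carrier R" for i using hcomp_carrier a b by simp
    have hc: "hcomp (finsum R (\<lambda>i. hcomp a i \<otimes> b) F) (n + m) = finsum R ?c F" if "finite F" for F
      using that
    proof (induction F)
      case empty
      then show ?case using hcomp_zero by simp
    next
      case (insert i F)
      have "finsum R (\<lambda>i. hcomp a i \<otimes> b) F \<in> carrier R" using hcomp_carrier a b by (auto intro: finsum_closed)
      then show ?case
        using insert hcomp_carrier a b c hcomp_add hcomp_mult_left[OF hcomp_G[OF a] b]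
        by (simp add: finsum_insert)
    qed
    have nF: "n \<in> hsupp a" using n(1) by auto
    have "a \<otimes> b = finsum R (\<lambda>i. hcomp a i \<otimes> b) (hsupp a)"
      by (subst hcomp_sum[OF a finite_hsupp[OF a] subset_refl])
        (rule finsum_ldistr, use finite_hsupp a b hcomp_carrier in auto)
    then have "finsum R ?c (hsupp a) \<in> P"
      using hc[OF finite_hsupp[OF a]] homogeneous_idealD(3)[OF P ab, of "n + m"] by simp
    moreover have "finsum R ?c (hsupp a) = finsum R ?c (insert n ?F)"
      using nF by (intro arg_cong[where f = "finsum R ?c"]) blast
    moreover have "finsum R ?c (insert n ?F) = ?c n \<oplus> finsum R ?c ?F"
      by (rule finsum_insert) (use finite_hsupp[OF a] hcomp_carrier a b in auto)
    moreover have "?c i \<in> P" if "i \<in> ?F" for i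
    proof (cases "i > n")
      case True
      then show ?thesis using n(2) P.I_r_closed hcomp_carrier[OF b] by blast
    next
      case False
      then have "n + m - i > m" using that by auto
      then show ?thesis using m(2) P.I_l_closed hcomp_carrier[OF a] by blast
    qed
    then have s: "finsum R ?c ?F \<in> P" by (rule finsum_in_subgroup[OF P.additive_subgroup_axioms])
    ultimately have "?c n \<oplus> finsum R ?c ?F \<in> P" by (simp only:)
    from P.a_closed[OF this P.a_inv_closed[OF s]]
    have "?c n \<oplus> finsum R ?c ?F \<oplus> \<ominus> finsum R ?c ?F \<in> P" .
    then have "?c n \<in> P" using c[of n] P.Icarr[OF s] by (simp only: a_assoc a_inv_closed r_neg r_zero)
    then have "hcomp a n \<otimes> hcomp b m \<in> P" by simp
    then show False using prime[OF hcomp_G[OF a] hcomp_G[OF b]] n(1) m(1) by blast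
  qed
  then show ?thesis using P one one_closed by (auto simp: Spec_def)
qed

lemma radical_family:
  assumes P: "homogeneous_ideal R G P"
  shows "homogeneous_family (\<lambda>n. {r \<in> G n. \<exists>k::nat. r [^] k \<in> P})"
proof -
  interpret P: ideal P R by (rule homogeneous_idealD(1)[OF P])
  note carr = G_carrier
  \<comment> \<open>The factor \<open>x\<close> is what makes induction on \<open>k + l\<close>
    possible: passing to \<open>a \<otimes> x\<close> lowers \<open>k\<close>, passing to
    \<open>b \<otimes> x\<close> lowers \<open>l\<close>, and the two results add up to one more
    power of the sum.\<close>
  have sum: "\<exists>j::nat. (a \<oplus> b) [^] j \<otimes> x \<in> P"
    if "a \<in> G n" "b \<in> G n" "x \<in> G e" "a [^] (k::nat) \<otimes> x \<in> P" "b [^] (l::nat) \<otimes> x \<in> P"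
    for a b x n e k l
    using that
  proof (induction "k + l" arbitrary: k l x e)
    case 0
    then have "(a \<oplus> b) [^] (0::nat) \<otimes> x \<in> P" by simp
    then show ?case by blast
  next
    case (Suc N)
    note a = Suc.prems(1) and b = Suc.prems(2) and x = Suc.prems(3)
    note ca = carr[OF a] and cb = carr[OF b] and cx = carr[OF x]
    show ?case
    proof (cases "k = 0 \<or> l = 0")
      case True
      then have "(a \<oplus> b) [^] (0::nat) \<otimes> x \<in> P" using Suc.prems(4,5) cx by auto
      then show ?thesis by blast
    next
      case False
      then obtain k' l' where kl: "k = Suc k'" "l = Suc l'" by (metis not0_implies_Suc)
      have comm: "u [^] (i::nat) \<otimes> (v \<otimes> x) \<in> P"
        if u: "u \<in> G n" and v: "v \<in> G n" and ux: "u [^] i \<otimes> x \<in> P" for u v i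
      proof -
        have "v \<otimes> (u [^] i \<otimes> x) \<in> P" using P.I_l_closed[OF ux carr[OF v]] .
        then have "(v \<otimes> u [^] i) \<otimes> x \<in> P" using carr[OF u] carr[OF v] cx by (simp add: m_assoc)
        moreover have "v \<otimes> u [^] i = u [^] i \<otimes> v \<or> v \<otimes> u [^] i = \<ominus> (u [^] i \<otimes> v)"
          using graded_commute[OF v G_pow[OF u]] by metis
        moreover have "y \<in> P" if "\<ominus> y \<in> P" "y \<in> carrier R" for y
          using P.I_l_closed[OF that(1), of "\<ominus> \<one>"] that(2) by (simp add: l_minus r_minus)
        ultimately have "(u [^] i \<otimes> v) \<otimes> x \<in> P"
          using carr[OF u] carr[OF v] cx by (metis l_minus m_closed nat_pow_closed)
        then show ?thesis using carr[OF u] carr[OF v] cx by (simp add: m_assoc)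
      qed
      have "a [^] k' \<otimes> (a \<otimes> x) \<in> P" "b [^] l' \<otimes> (b \<otimes> x) \<in> P"
        using Suc.prems(4,5) kl ca cb cx by (simp_all add: m_assoc)
      moreover have "N = k' + l" "N = k + l'" using Suc.hyps(2) kl by simp_all
      ultimately obtain i j :: nat
        where i: "(a \<oplus> b) [^] i \<otimes> (a \<otimes> x) \<in> P" and j: "(a \<oplus> b) [^] j \<otimes> (b \<otimes> x) \<in> P"
        using Suc.hyps(1)[OF _ a b degree_mult[OF a x] _ comm[OF b a Suc.prems(5)]]
          Suc.hyps(1)[OF _ a b degree_mult[OF b x] comm[OF a b Suc.prems(4)]] by metis
      note cab = a_closed[OF ca cb]
      have 1: "(a \<oplus> b) [^] (i + j) \<otimes> (a \<otimes> x) \<in> P"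
        using P.I_l_closed[OF i nat_pow_closed[OF cab, of j]] ca cb cx
        unfolding add.commute[of i j] by (simp add: nat_pow_mult[symmetric] m_assoc)
      have 2: "(a \<oplus> b) [^] (i + j) \<otimes> (b \<otimes> x) \<in> P"
        using P.I_l_closed[OF j nat_pow_closed[OF cab, of i]] ca cb cx
        by (simp add: nat_pow_mult[symmetric] m_assoc)
      have "(a \<oplus> b) [^] Suc (i + j) \<otimes> x \<in> P"
        using P.a_closed[OF 1 2] ca cb cx by (simp add: m_assoc l_distr r_distr)
      then show ?thesis by blast
    qed
  qed
  \<comment> \<open>Here each step absorbs one factor \<open>r \<otimes> x\<close> into
    \<open>y\<close> and moves \<open>r\<close> past a power of \<open>x\<close>.\<close>
  have mult: "(r \<otimes> x) [^] k \<otimes> y \<in> P"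
    if "r \<in> G m" "x \<in> G n" "y \<in> G e" "x [^] (k::nat) \<otimes> y \<in> P" for r x y m n e k
    using that
  proof (induction k arbitrary: y e)
    case (Suc k)
    note cr = carr[OF Suc.prems(1)] and cx = carr[OF Suc.prems(2)] and cy = carr[OF Suc.prems(3)]
    have "r \<otimes> (x [^] k \<otimes> (x \<otimes> y)) \<in> P"
      using P.I_l_closed[OF Suc.prems(4) cr] cr cx cy by (simp add: m_assoc)
    then have *: "(r \<otimes> x [^] k) \<otimes> (x \<otimes> y) \<in> P" using cr cx cy by (simp add: m_assoc)
    have "x [^] k \<otimes> r = r \<otimes> x [^] k \<or> x [^] k \<otimes> r = \<ominus> (r \<otimes> x [^] k)"
      using graded_commute[OF G_pow[OF Suc.prems(2)] Suc.prems(1)] by metis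
    moreover have "\<ominus> ((r \<otimes> x [^] k) \<otimes> (x \<otimes> y)) \<in> P"
      using P.I_l_closed[OF *, of "\<ominus> \<one>"] cr cx cy by (simp add: l_minus)
    ultimately have "(x [^] k \<otimes> r) \<otimes> (x \<otimes> y) \<in> P" using * cr cx cy by (auto simp: l_minus)
    then have "x [^] k \<otimes> ((r \<otimes> x) \<otimes> y) \<in> P" using cr cx cy by (simp add: m_assoc)
    then have "(r \<otimes> x) [^] k \<otimes> ((r \<otimes> x) \<otimes> y) \<in> P"
      using Suc.IH Suc.prems(1-3) degree_mult by metis
    then show ?case using cr cx cy by (simp add: m_assoc)
  qed simp
  show ?thesis
    unfolding homogeneous_family_def
  proof (intro conjI allI ballI)
    show "{r \<in> G n. \<exists>k::nat. r [^] k \<in> P} \<subseteq> G n" for n by blast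
    have "\<zero> [^] (1::nat) \<in> P" by simp
    then show "\<zero> \<in> {r \<in> G n. \<exists>k::nat. r [^] k \<in> P}" for n using G_zero by blast
  next
    fix n x y assume "x \<in> {r \<in> G n. \<exists>k::nat. r [^] k \<in> P}" "y \<in> {r \<in> G n. \<exists>k::nat. r [^] k \<in> P}"
    then obtain k l :: nat where h: "x \<in> G n" "y \<in> G n" "x [^] k \<in> P" "y [^] l \<in> P" by blast
    then obtain j :: nat where "(x \<oplus> y) [^] j \<otimes> \<one> \<in> P" using sum[OF h(1,2) degree_one, of k l] carr by auto
    then show "x \<oplus> y \<in> {r \<in> G n. \<exists>k::nat. r [^] k \<in> P}" using h carr G_add by auto
  next
    fix m n r x assume r: "r \<in> G m" and "x \<in> {r \<in> G n. \<exists>k::nat. r [^] k \<in> P}"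
    then obtain k :: nat where h: "x \<in> G n" "x [^] k \<in> P" by blast
    then have "(r \<otimes> x) [^] k \<otimes> \<one> \<in> P" using mult[OF r h(1) degree_one, of k] carr by auto
    then show "r \<otimes> x \<in> {r \<in> G (m + n). \<exists>k::nat. r [^] k \<in> P}" using r h carr degree_mult by auto
  qed
qed

end

section \<open>Consequences of the noetherian hypothesis\<close>

context noetherian_graded_comm_ring
begin

text \<open>The union of a chain is again a homogeneous ideal; its finitely many generators lie in
  one member, which therefore is the union and belongs to the family, as Zorn's lemma
  requires.\<close>

lemma homogeneous_ideal_maximal:
  assumes "\<F> \<noteq> {}" "\<And>I. I \<in> \<F> \<Longrightarrow> homogeneous_ideal R G I"
  shows "\<exists>M\<in>\<F>. \<forall>I\<in>\<F>. M \<subseteq> I \<longrightarrow> I = M"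
proof (rule subset_Zorn_nonempty[OF assms(1)])
  fix \<C> assume ne: "\<C> \<noteq> {}" and chain: "subset.chain \<F> \<C>"
  have sub: "\<C> \<subseteq> \<F>" using chain by (simp add: subset.chain_def)
  have "\<C> \<subseteq> {I. ideal I R}"
    using subsetD[OF sub, THEN assms(2), THEN homogeneous_idealD(1)] by (intro subsetI CollectI)
  then have "subset.chain {I. ideal I R} \<C>" using chain by (simp add: subset.chain_def)
  from chain_Union_is_ideal[OF this] have ideal: "ideal (\<Union>\<C>) R" unfolding if_not_P[OF ne] .
  have "c n \<in> \<Union>\<C>" if "x \<in> \<Union>\<C>" "homogeneous_decomposition R G x c" for x c n
    using that assms(2) sub unfolding homogeneous_ideal_def by blast
  then have "homogeneous_ideal R G (\<Union>\<C>)" unfolding homogeneous_ideal_def using ideal by blast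
  then obtain A where A: "A \<subseteq> carrier R" "finite A" "\<Union>\<C> = Idl A" using homogeneous_finitely_gen by metis
  have "A \<subseteq> \<Union>\<C>" using A genideal_self by auto
  then obtain B where B: "B \<in> \<C>" "A \<subseteq> B" using finite_subset_Union_chain[OF A(2) _ ne chain] by metis
  have "\<Union>\<C> \<subseteq> B" using genideal_minimal[OF _ B(2)] A(3) assms(2) sub B(1) homogeneous_idealD(1) by blast
  then have "\<Union>\<C> = B" using B(1) by blast
  then show "\<Union>\<C> \<in> \<F>" using B(1) sub by auto
qed

text \<open>Finite generation does not promise homogeneous generators, as Koszul objects require.
  The nonzero components of the given ones lie in \<open>P\<close> and still generate it.\<close>

lemma homogeneous_generators:
  assumes P: "homogeneous_ideal R G P"
  obtains rs :: "(int \<times> 'a) list" where "\<forall>(d, r) \<in> set rs. r \<in> G d" "P = Idl (snd ` set rs)"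
proof -
  obtain A where A: "A \<subseteq> carrier R" "finite A" "P = Idl A" using homogeneous_finitely_gen[OF P] by blast
  let ?B = "\<Union>x\<in>A. (\<lambda>n. (n, hcomp x n)) ` hsupp x"
  have "finite ?B" by (intro finite_UN_I finite_imageI finite_hsupp A(2)) (rule subsetD[OF A(1)])
  from finite_list[OF this] obtain rs where rs: "set rs = ?B" ..
  have G: "\<forall>(d, r) \<in> set rs. r \<in> G d" using rs A(1) hcomp_G by auto
  have B: "snd ` ?B \<subseteq> carrier R" using A(1) hcomp_carrier by auto
  have AP: "A \<subseteq> P" using A genideal_self by auto
  have "snd ` ?B \<subseteq> P" using AP homogeneous_idealD(3)[OF P] by auto
  then have 1: "Idl (snd ` ?B) \<subseteq> P" using genideal_minimal homogeneous_idealD(1)[OF P] by blast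
  interpret I: ideal "Idl (snd ` ?B)" R by (rule genideal_ideal[OF B])
  have "x \<in> Idl (snd ` ?B)" if x: "x \<in> A" for x
  proof -
    have c: "x \<in> carrier R" using x A(1) by blast
    have "hcomp x n \<in> Idl (snd ` ?B)" if n: "n \<in> hsupp x" for n
    proof -
      have "(n, hcomp x n) \<in> ?B" using x n by blast
      then have "hcomp x n \<in> snd ` ?B" by force
      then show ?thesis using genideal_self[OF B] by blast
    qed
    then have "finsum R (hcomp x) (hsupp x) \<in> Idl (snd ` ?B)"
      by (rule finsum_in_subgroup[OF I.additive_subgroup_axioms])
    then show ?thesis using hcomp_sum[OF c finite_hsupp[OF c] subset_refl] by simp
  qed
  then have "P \<subseteq> Idl (snd ` ?B)" unfolding A(3) by (intro genideal_minimal[OF I.ideal_axioms] subsetI)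
  then have "P = Idl (snd ` set rs)" unfolding rs using 1 by (intro equalityI)
  then show thesis by (rule that[OF G])
qed

end

section \<open>The action of the graded ring\<close>

context triangulated_category
begin

lemma susp_ob_invariant:
  assumes "\<And>X. X \<in> Ob T \<Longrightarrow> p (SOb T X) \<longleftrightarrow> p X" "X \<in> Ob T"
  shows "p (SOb_pow T n X) \<longleftrightarrow> p X"
proof (induction n rule: int_induct[where k = 0])
  case (step1 i)
  then show ?case using assms(1)[OF susp_pow_ob[OF assms(2)]] susp_ob_Suc[OF assms(2), of i] by simp
next
  case (step2 i)
  then show ?case using assms(1)[OF susp_pow_ob[OF assms(2)], of "i - 1"] susp_ob_Suc[OF assms(2), of "i - 1"] by simp
qed simp

lemma susp_ar_invariant:
  assumes "\<And>f X Y. f \<in> Hom T X Y \<Longrightarrow> p (SAr T f) \<longleftrightarrow> p f" "f \<in> Hom T X Y"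
  shows "p (SAr_pow T n f) \<longleftrightarrow> p f"
proof (induction n rule: int_induct[where k = 0])
  case (step1 i)
  then show ?case using assms(1)[OF susp_pow_hom[OF assms(2)]] susp_ar_Suc[OF assms(2), of i] by simp
next
  case (step2 i)
  then show ?case using assms(1)[OF susp_pow_hom[OF assms(2)], of "i - 1"] susp_ar_Suc[OF assms(2), of "i - 1"] by simp
qed simp

lemma thick_susp_pow: "\<lbrakk>thick T U; X \<in> Ob T\<rbrakk> \<Longrightarrow> SOb_pow T n X \<in> U \<longleftrightarrow> X \<in> U"
  by (rule susp_ob_invariant[where p = "\<lambda>X. X \<in> U"]) (auto simp: thick_susp)

lemma cone_in_susp_pow: "\<lbrakk>thick T U; f \<in> Hom T X Y\<rbrakk> \<Longrightarrow> SAr_pow T n f \<in> cone_in T U \<longleftrightarrow> f \<in> cone_in T U"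
  by (rule susp_ar_invariant[where p = "\<lambda>f. f \<in> cone_in T U"]) (auto simp: cone_in_susp)

lemma null_mod_susp_pow: "\<lbrakk>thick T U; f \<in> Hom T X Y\<rbrakk> \<Longrightarrow> null_mod U (SAr_pow T n f) \<longleftrightarrow> null_mod U f"
  by (rule susp_ar_invariant[where p = "null_mod U"]) (auto simp: null_mod_susp)

lemma desuspend_ob_pow:
  assumes "X \<in> Ob T"
  obtains X' where "X' \<in> Ob T" "SOb_pow T n X' = X"
proof
  show "SOb_pow T (- n) X \<in> Ob T" using susp_pow_ob assms by blast
  show "SOb_pow T n (SOb_pow T (- n) X) = X" using susp_ob_add[OF assms, of n "- n"] by simp
qed

lemma desuspend_ar_pow:
  assumes "f \<in> Hom T (SOb_pow T n X) (SOb_pow T n Y)" "X \<in> Ob T" "Y \<in> Ob T"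
  obtains f' where "f' \<in> Hom T X Y" "SAr_pow T n f' = f"
proof
  show "SAr_pow T (- n) f \<in> Hom T X Y"
    using susp_pow_hom[OF assms(1), of "- n"] susp_ob_add[OF assms(2), of "- n" n]
      susp_ob_add[OF assms(3), of "- n" n] by simp
  show "SAr_pow T n (SAr_pow T (- n) f) = f" using susp_ar_add[OF assms(1), of n "- n"] by simp
qed

text \<open>The suspension of a triangle is a triangle only up to sign. Desuspending
  \<open>f\<close> and factoring it in the original triangle avoids those signs.\<close>

lemma factor_fibre_pow:
  assumes "triangle X Y Z u v w" "f \<in> Hom T W (SOb_pow T n Y)"
    and "SAr_pow T n v \<cdot> f = Zer T W (SOb_pow T n Z)"
  obtains g where "g \<in> Hom T W (SOb_pow T n X)" "f = SAr_pow T n u \<cdot> g"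
proof -
  note t = triangleD[OF assms(1)]
  obtain W' where W': "W' \<in> Ob T" "SOb_pow T n W' = W" using desuspend_ob_pow hom_obD(1)[OF assms(2)] by blast
  obtain f' where f': "f' \<in> Hom T W' Y" "SAr_pow T n f' = f"
    using desuspend_ar_pow[of f n W' Y] assms(2) W' t(6) by blast
  note vf = cmp_hom[OF f'(1) t(2)]
  have "SAr_pow T n (v \<cdot> f') = SAr_pow T n (Zer T W' Z)"
    using susp_pow_cmp[OF f'(1) t(2)] f'(2) assms(3) susp_pow_zer[OF W'(1) t(7)] W'(2) by simp
  then have "SAr_pow T (- n) (SAr_pow T n (v \<cdot> f')) = SAr_pow T (- n) (SAr_pow T n (Zer T W' Z))" by simp
  then have "v \<cdot> f' = Zer T W' Z"
    using susp_ar_add[OF vf, of "- n" n] susp_ar_add[OF zer_hom[OF W'(1) t(7)], of "- n" n] by simp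
  then obtain g where g: "g \<in> Hom T W' X" "f' = u \<cdot> g" using factor_fibre[OF assms(1) f'(1)] by blast
  show thesis
    using that[OF _ _] susp_pow_hom[OF g(1), of n] W'(2) susp_pow_cmp[OF g(1) t(1), of n] g(2) f'(2) by simp
qed

text \<open>Working modulo the zero objects recovers \<open>T\<close> itself, so results on
  \<open>null_mod\<close> apply to actual vanishing; \<open>thick_local_kernel\<close> uses them in
  this way.\<close>

lemma thick_zero_objects: "thick T {Z. zero_object T Z}"
proof (rule thickI)
  show "SOb T X \<in> {Z. zero_object T Z} \<longleftrightarrow> X \<in> {Z. zero_object T Z}" if "X \<in> Ob T" for X
    using susp_zero_object[OF that] by simp
  show "X \<in> {Z. zero_object T Z}" if ret: "retract X Y" and Y0: "Y \<in> {Z. zero_object T Z}" for X Y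
  proof -
    obtain i p where ip: "i \<in> Hom T X Y" "p \<in> Hom T Y X" "p \<cdot> i = Idn T X"
      using ret unfolding retract_def by blast
    then have "Idn T X = Zer T X X"
      using hom_to_zero[of Y i X] Y0 cmp_zer_right[OF ip(2) hom_obD(1)[OF ip(1)]] by simp
    then show ?thesis using hom_obD(1)[OF ip(1)] by (simp add: zero_object_iff)
  qed
  show "Y \<in> {Z. zero_object T Z}"
    if tri: "triangle X Y Z u v w" and "X \<in> {Z. zero_object T Z}" "Z \<in> {Z. zero_object T Z}" for X Y Z u v w
  proof -
    note t = triangleD[OF tri]
    have "v \<cdot> Idn T Y = Zer T Y Z" using hom_to_zero[OF _ t(2)] t(2) that(3) by simp
    then obtain g where g: "g \<in> Hom T Y X" "Idn T Y = u \<cdot> g" using factor_fibre[OF tri idn_hom[OF t(6)]] by blast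
    then have "Idn T Y = Zer T Y Y" using hom_to_zero[OF _ g(1)] that(2) cmp_zer_right[OF t(1,6)] by simp
    then show ?thesis using t(6) by (simp add: zero_object_iff)
  qed
qed (auto simp: zero_object_iff)

lemma null_mod_zero_objects:
  assumes "f \<in> Hom T X Y"
  shows "null_mod {Z. zero_object T Z} f \<longleftrightarrow> f = Zer T X Y"
proof
  assume "null_mod {Z. zero_object T Z} f"
  then obtain W s where s: "s \<in> cone_in T {Z. zero_object T Z}" "s \<in> Hom T W X" "f \<cdot> s = Zer T W Y"
    by (rule null_modE[OF thick_zero_objects _ assms])
  obtain C v w where tri: "triangle W X C s v w" "zero_object T C" using cone_inE[OF s(1,2)] by blast
  obtain g where g: "g \<in> Hom T C Y" "f = g \<cdot> v" using factor_cone[OF tri(1) assms s(3)] by blast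
  then show "f = Zer T X Y"
    using hom_to_zero[OF tri(2) triangleD(2)[OF tri(1)]] cmp_zer_right[OF g(1)] hom_obD(1)[OF assms] by simp
next
  assume "f = Zer T X Y"
  then show "null_mod {Z. zero_object T Z} f"
    using null_mod_zer[OF thick_zero_objects] hom_obD[OF assms] by simp
qed

end

context graded_comm_ring
begin

lemma Spec_homogeneous: "P \<in> Spec R G \<Longrightarrow> homogeneous_ideal R G P"
  by (simp add: Spec_def)

lemma Spec_one:
  assumes "P \<in> Spec R G"
  shows "\<one> \<notin> P"
proof -
  have "ideal P R" "P \<noteq> carrier R" using assms by (simp_all add: Spec_def homogeneous_ideal_def)
  then show ?thesis using ideal.one_imp_carrier by metis
qed

lemma Spec_mult:
  assumes "P \<in> Spec R G" "a \<in> G m" "b \<in> G n" "a \<notin> P" "b \<notin> P"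
  shows "a \<otimes> b \<notin> P"
proof -
  have "\<forall>a\<in>carrier R. \<forall>b\<in>carrier R. a \<otimes> b \<in> P \<longrightarrow> a \<in> P \<or> b \<in> P"
    using assms(1) by (simp add: Spec_def)
  then show ?thesis using assms(4,5) G_carrier[OF assms(2)] G_carrier[OF assms(3)] by metis
qed

end

section \<open>The action on suspensions, extensions and cones\<close>

context linear_triangulated_category
begin

lemma act_hom: "\<lbrakk>r \<in> G n; X \<in> Ob T\<rbrakk> \<Longrightarrow> \<phi> n r X \<in> Hom T X (SOb_pow T n X)"
  using action_centre by (auto simp: graded_centre_def)

lemma act_natural:
  "\<lbrakk>r \<in> G n; f \<in> Hom T X Y\<rbrakk> \<Longrightarrow> \<phi> n r Y \<cdot> f = SAr_pow T n f \<cdot> \<phi> n r X"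
  using action_centre unfolding graded_centre_def by blast

lemma act_susp:
  "\<lbrakk>r \<in> G n; X \<in> Ob T\<rbrakk> \<Longrightarrow> \<phi> n r (SOb T X) = SAr T (\<phi> n r X) \<or> \<phi> n r (SOb T X) = Neg T (SAr T (\<phi> n r X))"
proof -
  assume "r \<in> G n" "X \<in> Ob T"
  then have "\<phi> n r (SOb T X) = (if even n then SAr T (\<phi> n r X) else Neg T (SAr T (\<phi> n r X)))"
    using action_centre[of r n] by (simp add: graded_centre_def)
  then show ?thesis by simp
qed

lemma act_susp_pow:
  assumes r: "r \<in> G d" and Y: "Y \<in> Ob T"
  shows "\<phi> d r (SOb_pow T k Y) = SAr_pow T k (\<phi> d r Y) \<or> \<phi> d r (SOb_pow T k Y) = Neg T (SAr_pow T k (\<phi> d r Y))"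
proof (induction k rule: int_induct[where k = 0])
  case (step1 i)
  note aY = act_hom[OF r Y]
  show ?case
    using step1(2) act_susp[OF r susp_pow_ob[OF Y, of i]] susp_ob_Suc[OF Y, of i] susp_ar_Suc[OF aY, of i]
      susp_neg[OF susp_pow_hom[OF aY, of i]] neg_neg[OF susp_hom[OF susp_pow_hom[OF aY, of i]]] by auto
next
  case (step2 i)
  let ?Y = "SOb_pow T (i - 1) Y" and ?B = "SAr_pow T (i - 1) (\<phi> d r Y)"
  have O: "?Y \<in> Ob T" using susp_pow_ob Y by blast
  note aY = act_hom[OF r Y]
  note h = act_hom[OF r O] and h' = susp_pow_hom[OF aY, of "i - 1"]
  have e: "SOb_pow T i Y = SOb T ?Y" "SAr_pow T i (\<phi> d r Y) = SAr T ?B"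
    using susp_ob_Suc[OF Y, of "i - 1"] susp_ar_Suc[OF aY, of "i - 1"] by simp_all
  have "\<phi> d r (SOb T ?Y) = SAr T ?B \<or> \<phi> d r (SOb T ?Y) = Neg T (SAr T ?B)"
    using step2(2) unfolding e .
  then have "SAr T (\<phi> d r ?Y) = SAr T ?B \<or> SAr T (\<phi> d r ?Y) = Neg T (SAr T ?B)"
    using act_susp[OF r O] neg_neg[OF susp_hom[OF h]] neg_neg[OF susp_hom[OF h']] by metis
  then show ?case
    using susp_inj[OF h h'] susp_inj[OF h neg_hom[OF h']] susp_neg[OF h'] by metis
qed simp

text \<open>The action on a suspended object is the suspended action up to sign. The properties of
  interest ignore signs and suspensions, so no sign has to be tracked.\<close>

lemma act_invariant:
  assumes r: "r \<in> G n" and X: "X \<in> Ob T"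
    and "\<And>f A B. f \<in> Hom T A B \<Longrightarrow> p (Neg T f) \<longleftrightarrow> p f" "\<And>f A B. f \<in> Hom T A B \<Longrightarrow> p (SAr T f) \<longleftrightarrow> p f"
  shows "p (\<phi> n r (SOb_pow T k X)) \<longleftrightarrow> p (\<phi> n r X)"
proof (rule susp_ob_invariant[where p = "\<lambda>X. p (\<phi> n r X)", OF _ X])
  show "p (\<phi> n r (SOb T A)) \<longleftrightarrow> p (\<phi> n r A)" if A: "A \<in> Ob T" for A
    using act_susp[OF r A] assms(3)[OF susp_hom[OF act_hom[OF r A]]] assms(4)[OF act_hom[OF r A]] by auto
qed

lemma cone_in_act_susp_pow:
  "\<lbrakk>thick T U; r \<in> G n; X \<in> Ob T\<rbrakk> \<Longrightarrow> \<phi> n r (SOb_pow T k X) \<in> cone_in T U \<longleftrightarrow> \<phi> n r X \<in> cone_in T U"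
  by (rule act_invariant[where p = "\<lambda>f. f \<in> cone_in T U"]) (auto simp: cone_in_susp cone_in_neg)

lemma null_mod_act_susp_pow:
  "\<lbrakk>thick T U; r \<in> G n; X \<in> Ob T\<rbrakk> \<Longrightarrow> null_mod U (\<phi> n r (SOb_pow T k X)) \<longleftrightarrow> null_mod U (\<phi> n r X)"
  by (rule act_invariant[where p = "null_mod U"]) (auto simp: null_mod_susp null_mod_neg)

lemma act_zero:
  assumes "X \<in> Ob T"
  shows "\<phi> n \<zero> X = Zer T X (SOb_pow T n X)"
  using zer_if_add_self[OF act_hom[OF G_zero assms]] action_add[OF G_zero G_zero assms, of n] by simp

lemma cone_in_act_pre:
  assumes U: "thick T U" and r: "r \<in> G n" and s: "s \<in> Hom T W X" "s \<in> cone_in T U"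
    and c: "\<phi> n r X \<in> cone_in T U"
  shows "\<phi> n r W \<in> cone_in T U"
proof -
  note W = hom_obD(1)[OF s(1)] and X = hom_obD(2)[OF s(1)]
  have "SAr_pow T n s \<cdot> \<phi> n r W \<in> cone_in T U"
    using cone_in_two_of_three(1)[OF U s(1) act_hom[OF r X] s(2) c] act_natural[OF r s(1)] by simp
  then show ?thesis
    using cone_in_two_of_three(3)[OF U act_hom[OF r W] susp_pow_hom[OF s(1)]] cone_in_susp_pow[OF U s(1)] s(2)
    by blast
qed

lemma cone_in_act_mult:
  assumes U: "thick T U" and r: "r \<in> G m" and s: "s \<in> G n" and X: "X \<in> Ob T"
    and "\<phi> m r X \<in> cone_in T U" "\<phi> n s X \<in> cone_in T U"
  shows "\<phi> (m + n) (r \<otimes> s) X \<in> cone_in T U"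
  using cone_in_two_of_three(1)[OF U act_hom[OF s X] susp_pow_hom[OF act_hom[OF r X]] assms(6)]
    cone_in_susp_pow[OF U act_hom[OF r X]] assms(5) action_mult[OF r s X] by simp

lemma cone_in_act_pow:
  assumes U: "thick T U" and r: "r \<in> G n" and X: "X \<in> Ob T" and "\<phi> n r X \<in> cone_in T U"
  shows "\<phi> (int k * n) (r [^] k) X \<in> cone_in T U"
proof (induction k)
  case 0
  then show ?case using action_one[OF X] cone_in_idn[OF U X] by simp
next
  case (Suc k)
  then show ?case
    using cone_in_act_mult[OF U G_pow[OF r] r X Suc assms(4)] by (simp add: algebra_simps)
qed

text \<open>On \<open>Y\<close> the element \<open>r'\<close> dies after \<open>v\<close> and a
  denominator \<open>s\<close>, so \<open>r' s\<close> factors through \<open>u\<close>. The rest of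
  the product then acts through \<open>X\<close>, where \<open>r\<close> is null.\<close>

lemma null_mod_act_extension:
  assumes U: "thick T U" and tri: "triangle X Y Z u v w"
    and r: "r \<in> G m" "null_mod U (\<phi> m r X)" and r': "r' \<in> G n" "null_mod U (\<phi> n r' Z)"
  shows "null_mod U (\<phi> (m + n) (r \<otimes> r') Y)"
proof -
  note t = triangleD[OF tri]
  note aX = act_hom[OF r(1) t(5)] and aY = act_hom[OF r(1) t(6)]
  note bY = act_hom[OF r'(1) t(6)] and bZ = act_hom[OF r'(1) t(7)]
  note sv = susp_pow_hom[OF t(2), of n] and su = susp_pow_hom[OF t(1), of n]
  have "null_mod U (SAr_pow T n v \<cdot> \<phi> n r' Y)"
    using null_mod_comp_right[OF U r'(2) t(2) bZ] act_natural[OF r'(1) t(2)] by simp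
  then obtain W s where s: "s \<in> cone_in T U" "s \<in> Hom T W Y"
      "(SAr_pow T n v \<cdot> \<phi> n r' Y) \<cdot> s = Zer T W (SOb_pow T n Z)"
    using null_modE[OF U _ cmp_hom[OF bY sv]] by blast
  note bs = cmp_hom[OF s(2) bY]
  have "SAr_pow T n v \<cdot> (\<phi> n r' Y \<cdot> s) = Zer T W (SOb_pow T n Z)"
    using s(3) cmp_assoc[OF s(2) bY sv] by simp
  then obtain g where g: "g \<in> Hom T W (SOb_pow T n X)" "\<phi> n r' Y \<cdot> s = SAr_pow T n u \<cdot> g"
    using factor_fibre_pow[OF tri bs] by blast
  note saX = susp_pow_hom[OF aX, of n] and saY = susp_pow_hom[OF aY, of n]
  note ssu = susp_pow_hom[OF susp_pow_hom[OF t(1), of m], of n]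
  have "null_mod U (SAr_pow T n (\<phi> m r X))" using null_mod_susp_pow[OF U aX] r(2) by blast
  then have "null_mod U (SAr_pow T n (\<phi> m r X) \<cdot> g)" using null_mod_comp_right[OF U _ g(1) saX] by blast
  then have *: "null_mod U (SAr_pow T n (SAr_pow T m u) \<cdot> (SAr_pow T n (\<phi> m r X) \<cdot> g))"
    using null_mod_comp_left[OF U _ cmp_hom[OF g(1) saX] ssu] by blast
  have "\<phi> (m + n) (r \<otimes> r') Y \<cdot> s = SAr_pow T n (\<phi> m r Y) \<cdot> (SAr_pow T n u \<cdot> g)"
    using action_mult[OF r(1) r'(1) t(6)] cmp_assoc[OF s(2) bY saY] g(2) by simp
  also have "\<dots> = SAr_pow T n (\<phi> m r Y \<cdot> u) \<cdot> g"
    using cmp_assoc[OF g(1) su saY] susp_pow_cmp[OF t(1) aY] by simp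
  also have "\<dots> = SAr_pow T n (SAr_pow T m u) \<cdot> (SAr_pow T n (\<phi> m r X) \<cdot> g)"
    using act_natural[OF r(1) t(1)] susp_pow_cmp[OF aX susp_pow_hom[OF t(1)]] cmp_assoc[OF g(1) saX ssu] by simp
  finally have "null_mod U (\<phi> (m + n) (r \<otimes> r') Y \<cdot> s)" using * by simp
  then show ?thesis
    using null_mod_cancel_right[OF U _ s(2) act_hom[OF degree_mult[OF r(1) r'(1)] t(6)] s(1)] by blast
qed

text \<open>On its own cone \<open>r\<close> may act nontrivially, but it vanishes after
  precomposition with \<open>v\<close>, hence equals \<open>h w\<close>; and \<open>w\<close>
  followed by \<open>r\<close> on the next term vanishes too. So applying \<open>r\<close> twice
  gives zero.\<close>

lemma act_square_cone_zero:
  assumes r: "r \<in> G d" and tri: "triangle Y (SOb_pow T d Y) Z (\<phi> d r Y) v w"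
  shows "\<phi> (d + d) (r \<otimes> r) Z = Zer T Z (SOb_pow T (d + d) Z)"
proof -
  note t = triangleD[OF tri]
  note aZ = act_hom[OF r t(7)] and aY = act_hom[OF r t(5)]
  have neg: "f = Zer T A B \<longleftrightarrow> Neg T f = Zer T A B" if "f \<in> Hom T A B" for f A B
    using neg_neg[OF that] neg_zer[OF hom_obD[OF that]] by metis
  note sgn = act_susp_pow[OF r t(5)]
  have comm: "SOb_pow T d (SOb_pow T k A) = SOb_pow T k (SOb_pow T d A)" if "A \<in> Ob T" for A k
    using susp_ob_add[OF that, of d k] susp_ob_add[OF that, of k d] by (simp add: add.commute)
  note aSY = act_hom[OF r t(6)]
  note sv = susp_pow_hom[OF t(2), of d] and saY = susp_pow_hom[OF aY, of d]
  have "SAr_pow T d v \<cdot> SAr_pow T d (\<phi> d r Y) = Zer T (SOb_pow T d Y) (SOb_pow T d Z)"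
    using susp_pow_cmp[OF aY t(2), of d] triangle_comp_zero[OF tri] susp_pow_zer[OF t(5,7), of d] by simp
  then have "SAr_pow T d v \<cdot> \<phi> d r (SOb_pow T d Y) = Zer T (SOb_pow T d Y) (SOb_pow T d Z)"
    using sgn[of d] cmp_neg_right[OF saY sv] neg_zer[OF t(6) susp_pow_ob[OF t(7)]] by auto
  then have "\<phi> d r Z \<cdot> v = Zer T (SOb_pow T d Y) (SOb_pow T d Z)"
    using act_natural[OF r t(2)] by simp
  then obtain h where h: "h \<in> Hom T (SOb T Y) (SOb_pow T d Z)" "\<phi> d r Z = h \<cdot> w"
    using factor_cone[OF triangle_rotate[OF tri] aZ] by blast
  note SY = susp_ob_ob[OF t(5)]
  note sw = susp_pow_hom[OF t(3), of d] and sh = susp_pow_hom[OF h(1), of d]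
  have "Neg T (SAr T (\<phi> d r Y)) \<cdot> w = Zer T Z (SOb T (SOb_pow T d Y))"
    using triangle_comp_zero[OF triangle_rotate[OF triangle_rotate[OF tri]]] .
  moreover have "Neg T (SAr T (\<phi> d r Y)) \<cdot> w = Neg T (SAr T (\<phi> d r Y) \<cdot> w)"
    by (rule cmp_neg_left[OF t(3) susp_hom[OF aY]])
  ultimately have "\<phi> d r (SOb T Y) \<cdot> w = Zer T Z (SOb T (SOb_pow T d Y))"
    using act_susp[OF r t(5)] neg[OF cmp_hom[OF t(3) susp_hom[OF aY]]] by auto
  then have sw0: "SAr_pow T d w \<cdot> \<phi> d r Z = Zer T Z (SOb_pow T d (SOb T Y))"
    using act_natural[OF r t(3)] comm[OF t(5), of 1] by simp
  have "\<phi> (d + d) (r \<otimes> r) Z = SAr_pow T d (h \<cdot> w) \<cdot> \<phi> d r Z"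
    using action_mult[OF r r t(7)] h(2) by simp
  also have "\<dots> = SAr_pow T d h \<cdot> (SAr_pow T d w \<cdot> \<phi> d r Z)"
    using susp_pow_cmp[OF t(3) h(1)] cmp_assoc[OF aZ sw sh] by simp
  also have "\<dots> = Zer T Z (SOb_pow T (d + d) Z)"
    using sw0 cmp_zer_right[OF sh t(7)] susp_ob_add[OF t(7), of d d] by simp
  finally show ?thesis .
qed

lemma annihilator_family:
  assumes U: "thick T U" and Y: "Y \<in> Ob T"
  shows "homogeneous_family (\<lambda>n. {r \<in> G n. null_mod U (\<phi> n r Y)})"
  unfolding homogeneous_family_def
proof (intro conjI allI ballI)
  show "\<zero> \<in> {r \<in> G n. null_mod U (\<phi> n r Y)}" for n
    using G_zero act_zero[OF Y] null_mod_zer[OF U Y susp_pow_ob[OF Y]] by simp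
  show "x \<oplus> y \<in> {r \<in> G n. null_mod U (\<phi> n r Y)}"
    if "x \<in> {r \<in> G n. null_mod U (\<phi> n r Y)}" "y \<in> {r \<in> G n. null_mod U (\<phi> n r Y)}" for n x y
    using that G_add action_add[OF _ _ Y] null_mod_add[OF U _ _ act_hom[OF _ Y] act_hom[OF _ Y]] by auto
  show "r \<otimes> x \<in> {r \<in> G (m + n). null_mod U (\<phi> (m + n) r Y)}"
    if "r \<in> G m" "x \<in> {r \<in> G n. null_mod U (\<phi> n r Y)}" for m n r x
    using that degree_mult action_mult[OF _ _ Y]
      null_mod_comp_left[OF U _ act_hom[OF _ Y] susp_pow_hom[OF act_hom[OF _ Y]]] by auto
qed blast

section \<open>The kernel of localisation at a prime\<close>

lemma vanishing_localisation:
  assumes Q: "Q \<in> Spec R G" and X: "X \<in> Ob T" and van: "localisation_vanishes R G Q (End_star T \<phi> X)"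
  shows "\<exists>d. \<exists>r\<in>G d. r \<notin> Q \<and> \<phi> d r X = Zer T X (SOb_pow T d X)"
proof -
  let ?M = "End_star T \<phi> X"
  note one = Spec_one[OF Q]
  have f1: "(0, \<one>, Idn T X) \<in> fractions G Q ?M 0" "(0, \<one>, GZero ?M 0) \<in> fractions G Q ?M 0"
    using degree_one one idn_hom[OF X] zer_hom[OF X X] by (simp_all add: fractions_def Hom_star_def)
  have refl: "((0, \<one>, Idn T X), (0, \<one>, Idn T X)) \<in> fraction_rel R G Q ?M 0"
    unfolding fraction_rel_def using f1(1) degree_one one
    by (auto intro!: exI[of _ 0] bexI[of _ \<one>])
  \<comment> \<open>The identity, as a fraction of degree 0, equals zero. Both denominators are one,
    so the two multipliers in \<open>fraction_rel\<close> coincide, and this common element kills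
    \<open>X\<close>.\<close>
  have "fraction_rel R G Q ?M 0 `` {(0, \<one>, Idn T X)} = localisation_zero R G Q ?M 0"
    using van f1(1) unfolding localisation_vanishes_def localisation_at_def by (metis quotientI singletonD)
  then have "((0, \<one>, GZero ?M 0), (0, \<one>, Idn T X)) \<in> fraction_rel R G Q ?M 0"
    using refl by (auto simp: localisation_zero_def)
  then obtain e a b where ab: "a \<in> G e" "b \<in> G e" "a \<otimes> \<one> = b \<otimes> \<one>" "a \<otimes> \<one> \<notin> Q"
    "GAct ?M e a 0 (GZero ?M 0) = GAct ?M e b 0 (Idn T X)"
    unfolding fraction_rel_def by auto
  then have "b = a" using G_carrier by simp
  then have "\<phi> e a X \<cdot> Idn T X = \<phi> e a X \<cdot> Zer T X X" using ab(5) by (simp add: Hom_star_def)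
  then have "\<phi> e a X = Zer T X (SOb_pow T e X)"
    using act_hom[OF ab(1) X] cmp_zer_right[OF act_hom[OF ab(1) X] X] by simp
  then show ?thesis using ab(1,4) G_carrier by auto
qed

text \<open>Any two fractions are identified by bringing them to a common denominator with an extra
  factor \<open>r\<close>, which makes both numerators zero.\<close>

lemma localisation_vanishesI:
  assumes Q: "Q \<in> Spec R G" and X: "X \<in> Ob T"
    and r: "r \<in> G d" "r \<notin> Q" "\<phi> d r X = Zer T X (SOb_pow T d X)"
  shows "localisation_vanishes R G Q (End_star T \<phi> X)"
proof -
  let ?M = "End_star T \<phi> X"
  note prime = Spec_mult[OF Q] and one = Spec_one[OF Q]
  have kill: "GAct ?M (d + e) (r \<otimes> a) k m = Zer T X (SOb_pow T k (SOb_pow T (d + e) X))"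
    if a: "a \<in> G e" and m: "m \<in> Hom T X (SOb_pow T k X)" for a e k m
  proof -
    have "\<phi> (d + e) (r \<otimes> a) X = Zer T X (SOb_pow T (d + e) X)"
      using action_mult[OF r(1) a X] r(3) susp_pow_zer[OF X susp_pow_ob[OF X], of e d]
        cmp_zer_left[OF act_hom[OF a X] susp_pow_ob[OF susp_pow_ob[OF X]], of e d] susp_ob_add[OF X, of e d]
      by (simp add: add.commute)
    then show ?thesis
      using susp_pow_zer[OF X susp_pow_ob[OF X]] cmp_zer_left[OF m] susp_pow_ob[OF susp_pow_ob[OF X]]
      by (simp add: Hom_star_def)
  qed
  have rel: "(x, y) \<in> fraction_rel R G Q ?M n"
    if x: "x \<in> fractions G Q ?M n" and y: "y \<in> fractions G Q ?M n" for x y n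
  proof -
    obtain e s m where x': "x = (e, s, m)" "s \<in> G e" "s \<notin> Q" "m \<in> Hom T X (SOb_pow T (n + e) X)"
      using x by (auto simp: fractions_def Hom_star_def)
    obtain e' s' m' where y': "y = (e', s', m')" "s' \<in> G e'" "s' \<notin> Q" "m' \<in> Hom T X (SOb_pow T (n + e') X)"
      using y by (auto simp: fractions_def Hom_star_def)
    \<comment> \<open>\<open>b\<close> absorbs the sign of graded commutativity, so that
      \<open>s' \<otimes> s = b \<otimes> s'\<close> holds exactly.\<close>
    define b where "b = (if even (e * e') then s else \<ominus> s)"
    have b: "b \<in> G e" using x'(2) G_minus by (simp add: b_def)
    have "s' \<otimes> s = b \<otimes> s'"
      using graded_commute[OF y'(2) x'(2)] G_carrier[OF x'(2)] G_carrier[OF y'(2)]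
      by (simp add: b_def l_minus mult.commute)
    then have eq: "(r \<otimes> s') \<otimes> s = (r \<otimes> b) \<otimes> s'"
      using G_carrier[OF x'(2)] G_carrier[OF y'(2)] G_carrier[OF b] G_carrier[OF r(1)] by (simp add: m_assoc)
    have "(r \<otimes> s') \<otimes> s \<notin> Q"
      using prime[OF degree_mult[OF r(1) y'(2)] x'(2) prime[OF r(1) y'(2) r(2) y'(3)] x'(3)] .
    moreover have "GAct ?M (d + e') (r \<otimes> s') (n + e) m = GAct ?M (d + e) (r \<otimes> b) (n + e') m'"
      using kill[OF y'(2) x'(4)] kill[OF b y'(4)] susp_ob_add[OF X, of "n + e" "d + e'"]
        susp_ob_add[OF X, of "n + e'" "d + e"] by (simp add: algebra_simps)
    moreover have "d + e' + e = d + e + e'" by simp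
    ultimately have "\<exists>i i'. \<exists>a\<in>G i. \<exists>b\<in>G i'. i + e = i' + e' \<and> a \<otimes> s = b \<otimes> s' \<and> a \<otimes> s \<notin> Q \<and>
        GAct ?M i a (n + e) m = GAct ?M i' b (n + e') m'"
      using degree_mult[OF r(1) y'(2)] degree_mult[OF r(1) b] eq by metis
    then show ?thesis using x y unfolding x'(1) y'(1) fraction_rel_def by simp
  qed
  have "localisation_at R G Q ?M n = {localisation_zero R G Q ?M n}" for n
  proof -
    have z: "(0, \<one>, GZero ?M n) \<in> fractions G Q ?M n"
      using degree_one one zer_hom[OF X susp_pow_ob[OF X]] by (simp add: fractions_def Hom_star_def)
    have "fraction_rel R G Q ?M n `` {x} = fractions G Q ?M n" if "x \<in> fractions G Q ?M n" for x
      using rel[OF that] by (auto simp: fraction_rel_def)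
    then show ?thesis
      using z unfolding localisation_at_def localisation_zero_def quotient_def by auto
  qed
  then show ?thesis by (simp add: localisation_vanishes_def)
qed

text \<open>The condition at \<open>P\<close> alone suffices: a killing element outside
  \<open>P\<close> is outside every prime contained in \<open>P\<close>.\<close>

lemma local_kernel_iff:
  assumes P: "P \<in> Spec R G"
  shows "X \<in> local_kernel R G T \<phi> P \<longleftrightarrow>
    X \<in> Ob T \<and> (\<exists>d. \<exists>r\<in>G d. r \<notin> P \<and> \<phi> d r X = Zer T X (SOb_pow T d X))"
proof
  assume "X \<in> local_kernel R G T \<phi> P"
  then show "X \<in> Ob T \<and> (\<exists>d. \<exists>r\<in>G d. r \<notin> P \<and> \<phi> d r X = Zer T X (SOb_pow T d X))"
    using vanishing_localisation[OF P] P unfolding local_kernel_def by blast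
next
  assume "X \<in> Ob T \<and> (\<exists>d. \<exists>r\<in>G d. r \<notin> P \<and> \<phi> d r X = Zer T X (SOb_pow T d X))"
  then show "X \<in> local_kernel R G T \<phi> P"
    using localisation_vanishesI unfolding local_kernel_def by blast
qed

lemma local_kernel_iff_null:
  assumes P: "P \<in> Spec R G"
  shows "X \<in> local_kernel R G T \<phi> P \<longleftrightarrow>
    X \<in> Ob T \<and> (\<exists>d. \<exists>r\<in>G d. r \<notin> P \<and> null_mod {Z. zero_object T Z} (\<phi> d r X))"
  using local_kernel_iff[OF P] null_mod_zero_objects[OF act_hom] by blast

text \<open>For an extension, the elements killing the two ends multiply to one killing the middle,
  and primality keeps the product outside \<open>P\<close>.\<close>

lemma thick_local_kernel:
  assumes P: "P \<in> Spec R G"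
  shows "thick T (local_kernel R G T \<phi> P)"
proof (rule thickI)
  let ?N = "local_kernel R G T \<phi> P"
  let ?z = "{Z. zero_object T Z}"
  note z = thick_zero_objects
  note iff = local_kernel_iff_null[OF P]
  note prime = Spec_mult[OF P] and one = Spec_one[OF P]
  show "?N \<subseteq> Ob T" using iff by blast
  show "Z \<in> ?N" if Z: "zero_object T Z" for Z
  proof -
    have ZO: "Z \<in> Ob T" using Z zero_object_iff by blast
    have "null_mod ?z (\<phi> 0 \<one> Z)" using null_mod_if_source[OF z act_hom[OF degree_one ZO]] Z by simp
    then show ?thesis using iff ZO degree_one one by blast
  qed
  show "SOb T X \<in> ?N \<longleftrightarrow> X \<in> ?N" if X: "X \<in> Ob T" for X
    using iff null_mod_act_susp_pow[OF z _ X, of _ _ 1] X susp_ob_ob[OF X] by auto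
  show "X \<in> ?N" if ret: "retract X Y" and YN: "Y \<in> ?N" for X Y
  proof -
    obtain i p where ip: "i \<in> Hom T X Y" "p \<in> Hom T Y X" "p \<cdot> i = Idn T X"
      using ret unfolding retract_def by blast
    note X = hom_obD(1)[OF ip(1)] and Y = hom_obD(2)[OF ip(1)]
    obtain d r where r: "r \<in> G d" "r \<notin> P" "null_mod ?z (\<phi> d r Y)" using YN iff by blast
    note aY = act_hom[OF r(1) Y] and aX = act_hom[OF r(1) X] and sp = susp_pow_hom[OF ip(2), of d]
    have "null_mod ?z (SAr_pow T d p \<cdot> \<phi> d r Y)" by (rule null_mod_comp_left[OF z r(3) aY sp])
    then have "null_mod ?z ((SAr_pow T d p \<cdot> \<phi> d r Y) \<cdot> i)"
      by (rule null_mod_comp_right[OF z _ ip(1) cmp_hom[OF aY sp]])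
    moreover have "(SAr_pow T d p \<cdot> \<phi> d r Y) \<cdot> i = \<phi> d r X"
      using act_natural[OF r(1) ip(2)] cmp_assoc[OF ip(1,2) aX] ip(3) aX by simp
    ultimately show ?thesis using iff X r(1,2) by auto
  qed
  show "Y \<in> ?N" if tri: "triangle X Y Z u v w" and XZ: "X \<in> ?N" "Z \<in> ?N" for X Y Z u v w
  proof -
    obtain m r where r: "r \<in> G m" "r \<notin> P" "null_mod ?z (\<phi> m r X)" using XZ(1) iff by blast
    obtain n r' where r': "r' \<in> G n" "r' \<notin> P" "null_mod ?z (\<phi> n r' Z)" using XZ(2) iff by blast
    show ?thesis
      using iff triangleD(6)[OF tri] null_mod_act_extension[OF z tri r(1,3) r'(1,3)]
        degree_mult[OF r(1) r'(1)] prime[OF r(1) r'(1) r(2) r'(2)] by blast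
  qed
qed

end

section \<open>The local-to-global principle\<close>

context linear_triangulated_category
begin

abbreviation (input) "loc_kernel \<equiv> local_kernel R G T \<phi>"
abbreviation (input) "loc_cat \<equiv> local_category R G T \<phi>"
abbreviation (input) "loc_act \<equiv> local_action R G T \<phi>"

lemma local_Koszul_in_thick:
  assumes P: "P \<in> Spec R G" and U: "thick (loc_cat P) U"
    and K: "Koszul (loc_cat P) (loc_act P) A rs K" and rs: "\<forall>(d, r) \<in> set rs. r \<in> G d" and A: "A \<in> U"
  shows "K \<in> U"
  using K rs A
proof (induction rule: Koszul.induct)
  case (Koszul_Nil X)
  then show ?case by simp
next
  case (Koszul_Cons X d r v w rs Y)
  note N = thick_local_kernel[OF P]
  have X: "X \<in> Ob T" using Koszul_Cons.hyps(1) by (simp add: local_category_def)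
  have r: "r \<in> G d" using Koszul_Cons.prems(1) by simp
  have h: "loc_act P d r X \<in> Hom (loc_cat P) X (SOb_pow T d X)"
    using quotient_arrow_hom[OF N act_hom[OF r X]] by (simp add: local_category_def local_action_def)
  have "SOb_pow T d X \<in> U \<longleftrightarrow> X \<in> U"
  proof (rule susp_ob_invariant[where p = "\<lambda>X. X \<in> U", OF _ X])
    show "SOb T B \<in> U \<longleftrightarrow> B \<in> U" if "B \<in> Ob T" for B
      using thick_susp[OF U, of B] that by (simp add: local_category_def)
  qed
  then have "Dom (loc_cat P) (loc_act P d r X) \<in> U" "Cod (loc_cat P) (loc_act P d r X) \<in> U"
    using Koszul_Cons.prems(2) Hom_DomD[OF h] Hom_CodD[OF h] by simp_all
  then have "Cod (loc_cat P) v \<in> U"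
    using thick_coneD[OF U Koszul_Cons.hyps(2)] by blast
  then show ?case using Koszul_Cons.IH Koszul_Cons.prems(1) by simp
qed

text \<open>The cones are taken in \<open>T\<close> and pushed to the local category by
  \<open>image_Tri\<close>.\<close>

lemma local_Koszul_exists:
  assumes P: "P \<in> Spec R G" and rs: "\<forall>(d, r) \<in> set rs. r \<in> G d" and A: "A \<in> Ob T"
  shows "\<exists>K. Koszul (loc_cat P) (loc_act P) A rs K"
  using rs A
proof (induction rs arbitrary: A)
  case Nil
  then have "Koszul (loc_cat P) (loc_act P) A [] A" by (intro Koszul.Koszul_Nil) (simp add: local_category_def)
  then show ?case by blast
next
  case (Cons a rs)
  obtain d r where a: "a = (d, r)" by (cases a)
  have r: "r \<in> G d" using Cons.prems a by simp
  note N = thick_local_kernel[OF P]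
  obtain Z v w where tri: "triangle A (SOb_pow T d A) Z (\<phi> d r A) v w"
    using cone_exists act_hom[OF r Cons.prems(2)] by blast
  note v = triangleD(2)[OF tri]
  have cod: "Cod (loc_cat P) (quotient_arrow T (loc_kernel P) v) = Z"
    using Hom_CodD[OF quotient_arrow_hom[OF N v]] by (simp add: local_category_def)
  obtain K where "Koszul (loc_cat P) (loc_act P) Z rs K"
    using Cons triangleD(7)[OF tri] by auto
  then have "Koszul (loc_cat P) (loc_act P) (Cod (loc_cat P) (quotient_arrow T (loc_kernel P) v)) rs K"
    by (simp only: cod)
  moreover have "A \<in> Ob (loc_cat P)" using Cons.prems(2) by (simp add: local_category_def)
  moreover have "(loc_act P d r A, quotient_arrow T (loc_kernel P) v, quotient_arrow T (loc_kernel P) w)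
      \<in> Tri (loc_cat P)"
    using image_Tri[OF N tri] by (simp only: local_category_def local_action_def)
  ultimately have "Koszul (loc_cat P) (loc_act P) A ((d, r) # rs) K"
    by (intro Koszul.Koszul_Cons)
  then show ?case using a by blast
qed

definition annihilator :: "'o set \<Rightarrow> 'o \<Rightarrow> 'r set" where
  "annihilator S Y = family_ideal (\<lambda>n. {r \<in> G n. null_mod S (\<phi> n r Y)})"

text \<open>This is the ideal \<open>I(Y)\<close> of the overview: its homogeneous elements are
  those acting nilpotently on \<open>Y\<close> modulo \<open>S\<close>.\<close>

definition radical :: "'o set \<Rightarrow> 'o \<Rightarrow> 'r set" where
  "radical S Y = family_ideal (\<lambda>n. {r \<in> G n. \<exists>k::nat. r [^] k \<in> annihilator S Y})"

text \<open>An arrow from \<open>\<Sigma>\<^sup>n Y\<close> to \<open>Z\<close> in \<open>T/S\<close> is a fraction \<open>f \<circ> s\<inverse>\<close> whose numerator starts at a member of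
  \<open>denominator_sources S Y\<close>. So \<open>orthogonal S Y\<close> consists of the \<open>Z\<close> to which no suspension of \<open>Y\<close> has
  nonzero arrows in \<open>T/S\<close>; this formulation avoids composing fractions.\<close>

definition denominator_sources :: "'o set \<Rightarrow> 'o \<Rightarrow> 'o set" where
  "denominator_sources S Y = {W. \<exists>n. \<exists>s \<in> Hom T W (SOb_pow T n Y). s \<in> cone_in T S}"

definition orthogonal :: "'o set \<Rightarrow> 'o \<Rightarrow> 'o set" where
  "orthogonal S Y = {Z \<in> Ob T. \<forall>W\<in>denominator_sources S Y. \<forall>f \<in> Hom T W Z. null_mod S f}"

context
  fixes S assumes S: "thick T S"
begin

section \<open>The prime attached to an object\<close>

lemma mem_annihilator:
  "\<lbrakk>Y \<in> Ob T; r \<in> G n\<rbrakk> \<Longrightarrow> r \<in> annihilator S Y \<longleftrightarrow> null_mod S (\<phi> n r Y)"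
  unfolding annihilator_def using homogeneous_mem_family_ideal[OF annihilator_family[OF S]] by simp

lemma radical_homogeneous:
  assumes "Y \<in> Ob T"
  shows "homogeneous_family (\<lambda>n. {r \<in> G n. \<exists>k::nat. r [^] k \<in> annihilator S Y})"
    and "homogeneous_ideal R G (radical S Y)"
proof -
  show h: "homogeneous_family (\<lambda>n. {r \<in> G n. \<exists>k::nat. r [^] k \<in> annihilator S Y})"
    unfolding annihilator_def
    by (rule radical_family[OF homogeneous_ideal_family_ideal[OF annihilator_family[OF S assms]]])
  show "homogeneous_ideal R G (radical S Y)"
    unfolding radical_def by (rule homogeneous_ideal_family_ideal[OF h])
qed

lemma mem_radical:
  assumes "Y \<in> Ob T" "r \<in> G n"
  shows "r \<in> radical S Y \<longleftrightarrow> (\<exists>k::nat. null_mod S (\<phi> (int k * n) (r [^] k) Y))"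
  unfolding radical_def
  using homogeneous_mem_family_ideal[OF radical_homogeneous(1)[OF assms(1)] assms(2)] assms
    mem_annihilator[OF assms(1) G_pow[OF assms(2)]] by simp

text \<open>After one rotation \<open>Z\<close> is an extension of \<open>SOb T Y\<close> by
  \<open>SOb_pow T d Y\<close>, so a power null on \<open>Y\<close> is squared to become null on
  \<open>Z\<close>. The exponent 2 for \<open>r\<close> itself comes from
  \<open>act_square_cone_zero\<close>.\<close>

lemma radical_cone:
  assumes r: "r \<in> G d" and tri: "triangle Y (SOb_pow T d Y) Z (\<phi> d r Y) v w"
  shows "radical S Y \<subseteq> radical S Z" "r \<in> radical S Z"
proof -
  note t = triangleD[OF tri]
  have "a \<in> radical S Z" if a: "a \<in> G n" "a \<in> radical S Y" for a n
  proof -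
    obtain k :: nat where k: "null_mod S (\<phi> (int k * n) (a [^] k) Y)"
      using a mem_radical[OF t(5)] by blast
    note ak = G_pow[OF a(1), of k]
    have "null_mod S (\<phi> (int k * n) (a [^] k) (SOb_pow T d Y))" "null_mod S (\<phi> (int k * n) (a [^] k) (SOb T Y))"
      using null_mod_act_susp_pow[OF S ak t(5), of d] null_mod_act_susp_pow[OF S ak t(5), of 1] k by simp_all
    then have "null_mod S (\<phi> (int k * n + int k * n) (a [^] k \<otimes> a [^] k) Z)"
      using null_mod_act_extension[OF S triangle_rotate[OF tri] ak _ ak] by blast
    then have "null_mod S (\<phi> (int (k + k) * n) (a [^] (k + k)) Z)"
      using nat_pow_mult[OF G_carrier[OF a(1)], of k k] by (simp add: algebra_simps)
    then show ?thesis using mem_radical[OF t(7) a(1)] by blast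
  qed
  then have "hcomp x n \<in> radical S Z" if "x \<in> radical S Y" for x n
    using that homogeneous_idealD(2,3)[OF radical_homogeneous(2)[OF t(5)]] hcomp_G by blast
  then show "radical S Y \<subseteq> radical S Z"
    using homogeneous_ideal_memI[OF radical_homogeneous(2)[OF t(7)]]
      homogeneous_idealD(2)[OF radical_homogeneous(2)[OF t(5)]] by blast
  have "null_mod S (\<phi> (int 2 * d) (r [^] (2::nat)) Z)"
    using act_square_cone_zero[OF r tri] null_mod_zer[OF S t(7) susp_pow_ob[OF t(7)], of "d + d"] G_carrier[OF r]
    by (simp add: numeral_2_eq_2 algebra_simps)
  then show "r \<in> radical S Z" using mem_radical[OF t(7) r] by blast
qed

lemma radical_prime:
  assumes Y: "Y \<in> Ob T" "Y \<notin> S"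
    and inv: "\<And>d r. \<lbrakk>r \<in> G d; r \<notin> radical S Y\<rbrakk> \<Longrightarrow> \<phi> d r Y \<in> cone_in T S"
  shows "radical S Y \<in> Spec R G"
proof (rule SpecI_homogeneous[OF radical_homogeneous(2)[OF Y(1)]])
  have notboth: "r \<notin> radical S Y" if r: "r \<in> G d" "\<phi> d r Y \<in> cone_in T S" for d r
  proof
    assume "r \<in> radical S Y"
    then obtain k :: nat where "null_mod S (\<phi> (int k * d) (r [^] k) Y)" using mem_radical[OF Y(1) r(1)] by blast
    then have "Y \<in> S"
      using in_if_null_mod_cone_in(1)[OF S _ cone_in_act_pow[OF S r(1) Y(1) r(2)] act_hom[OF G_pow[OF r(1)] Y(1)]]
      by blast
    then show False using Y(2) by blast
  qed
  show "\<one> \<notin> radical S Y"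
    using notboth[OF degree_one] action_one[OF Y(1)] cone_in_idn[OF S Y(1)] by simp
  show "a \<in> radical S Y \<or> b \<in> radical S Y" if "a \<in> G m" "b \<in> G n" "a \<otimes> b \<in> radical S Y" for m n a b
    using notboth[OF degree_mult[OF that(1,2)]] cone_in_act_mult[OF S that(1,2) Y(1)] inv that by blast
qed

section \<open>The right orthogonal of an object\<close>

lemma denominator_sources_pre:
  assumes "W \<in> denominator_sources S Y" "s \<in> Hom T W' W" "s \<in> cone_in T S"
  shows "W' \<in> denominator_sources S Y"
proof -
  obtain n t where t: "t \<in> Hom T W (SOb_pow T n Y)" "t \<in> cone_in T S"
    using assms(1) unfolding denominator_sources_def by blast
  show ?thesis
    unfolding denominator_sources_def
    using cmp_hom[OF assms(2) t(1)] cone_in_two_of_three(1)[OF S assms(2) t(1) assms(3) t(2)] by blast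
qed

lemma thick_orthogonal:
  assumes Y: "Y \<in> Ob T"
  shows "thick T (orthogonal S Y)"
  unfolding orthogonal_def
proof (rule thick_right_orthogonal[OF S])
  show "denominator_sources S Y \<subseteq> Ob T" unfolding denominator_sources_def using hom_obD(1) by blast
  show "W' \<in> denominator_sources S Y" if "W \<in> denominator_sources S Y" "s \<in> Hom T W' W" "s \<in> cone_in T S" for W W' s
    by (rule denominator_sources_pre[OF that])
  show "SOb T W \<in> denominator_sources S Y \<longleftrightarrow> W \<in> denominator_sources S Y" if W: "W \<in> Ob T" for W
  proof
    assume "W \<in> denominator_sources S Y"
    then obtain n t where t: "t \<in> Hom T W (SOb_pow T n Y)" "t \<in> cone_in T S"
      unfolding denominator_sources_def by blast
    have "SAr T t \<in> Hom T (SOb T W) (SOb_pow T (n + 1) Y)" "SAr T t \<in> cone_in T S"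
      using susp_hom[OF t(1)] susp_ob_Suc[OF Y] cone_in_susp[OF S t(1)] t(2) by simp_all
    then show "SOb T W \<in> denominator_sources S Y" unfolding denominator_sources_def by blast
  next
    assume "SOb T W \<in> denominator_sources S Y"
    then obtain n t where t: "t \<in> Hom T (SOb T W) (SOb_pow T n Y)" "t \<in> cone_in T S"
      unfolding denominator_sources_def by blast
    have "t \<in> Hom T (SOb T W) (SOb T (SOb_pow T (n - 1) Y))"
      using t(1) susp_ob_Suc[OF Y, of "n - 1"] by simp
    then obtain t' where t': "t' \<in> Hom T W (SOb_pow T (n - 1) Y)" "SAr T t' = t"
      using desuspend_ar W susp_pow_ob[OF Y] by metis
    then show "W \<in> denominator_sources S Y"
      unfolding denominator_sources_def using cone_in_susp[OF S t'(1)] t(2) by blast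
  qed
qed

lemma subset_orthogonal: "S \<subseteq> orthogonal S Y"
  unfolding orthogonal_def using null_mod_if_target[OF S] thick_sub[OF S] by blast

text \<open>For \<open>f : W -> N\<close>, naturality turns the vanishing of \<open>r\<close> on
  \<open>N\<close> into that of a suspension of \<open>f\<close> composed with \<open>r\<close> on
  \<open>W\<close>. There \<open>r\<close> is invertible modulo \<open>S\<close>, as it is on
  \<open>Y\<close>, and can be cancelled.\<close>

lemma local_kernel_subset_orthogonal:
  assumes P: "P \<in> Spec R G" and Y: "Y \<in> Ob T"
    and inv: "\<And>d r. \<lbrakk>r \<in> G d; r \<notin> P\<rbrakk> \<Longrightarrow> \<phi> d r Y \<in> cone_in T S"
  shows "loc_kernel P \<subseteq> orthogonal S Y"
proof
  fix N assume "N \<in> loc_kernel P"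
  then obtain d r where N: "N \<in> Ob T" and r: "r \<in> G d" "r \<notin> P" "\<phi> d r N = Zer T N (SOb_pow T d N)"
    using local_kernel_iff[OF P] by blast
  have "null_mod S f" if W: "W \<in> denominator_sources S Y" and f: "f \<in> Hom T W N" for W f
  proof -
    obtain n s where s: "s \<in> Hom T W (SOb_pow T n Y)" "s \<in> cone_in T S"
      using W unfolding denominator_sources_def by blast
    note WO = hom_obD(1)[OF f]
    have rW: "\<phi> d r W \<in> cone_in T S"
      using cone_in_act_pre[OF S r(1) s] cone_in_act_susp_pow[OF S r(1) Y] inv[OF r(1,2)] by blast
    have "SAr_pow T d f \<cdot> \<phi> d r W = Zer T W (SOb_pow T d N)"
      using act_natural[OF r(1) f] r(3) cmp_zer_left[OF f susp_pow_ob[OF N]] by simp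
    then have "null_mod S (SAr_pow T d f \<cdot> \<phi> d r W)"
      using null_mod_zer[OF S WO susp_pow_ob[OF N]] by simp
    then have "null_mod S (SAr_pow T d f)"
      using null_mod_cancel_right[OF S _ act_hom[OF r(1) WO] susp_pow_hom[OF f] rW] by blast
    then show ?thesis using null_mod_susp_pow[OF S f] by blast
  qed
  then show "N \<in> orthogonal S Y" using N unfolding orthogonal_def by blast
qed

text \<open>What \<open>q\<close> kills comes from its fibre, which is orthogonal along with the
  cone. After a denominator \<open>h\<close> factors through that fibre by an arrow which must be
  null.\<close>

lemma null_mod_cancel_orthogonal:
  assumes Y: "Y \<in> Ob T" and q: "q \<in> Hom T A B" "q \<in> cone_in T (orthogonal S Y)"
    and W: "W \<in> denominator_sources S Y" and h: "h \<in> Hom T W A" and qh: "null_mod S (q \<cdot> h)"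
  shows "null_mod S h"
proof -
  obtain C v w where tri: "triangle A B C q v w" "C \<in> orthogonal S Y" using cone_inE q by blast
  obtain D e where D: "D \<in> Ob T" "SOb T D = C" "triangle D A B e q v" using triangle_fibre tri(1) by blast
  have DV: "D \<in> orthogonal S Y" using thick_susp[OF thick_orthogonal[OF Y] D(1)] D(2) tri(2) by blast
  obtain W' s where s: "s \<in> cone_in T S" "s \<in> Hom T W' W" "(q \<cdot> h) \<cdot> s = Zer T W' B"
    by (rule null_modE[OF S qh cmp_hom[OF h q(1)]])
  have "q \<cdot> (h \<cdot> s) = Zer T W' B" using s(3) cmp_assoc[OF s(2) h q(1)] by simp
  then obtain g where g: "g \<in> Hom T W' D" "h \<cdot> s = e \<cdot> g" using factor_fibre[OF D(3) cmp_hom[OF s(2) h]] by blast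
  have "null_mod S g" using DV denominator_sources_pre[OF W s(2,1)] g(1) unfolding orthogonal_def by blast
  then have "null_mod S (h \<cdot> s)" using null_mod_comp_left[OF S _ g(1) triangleD(1)[OF D(3)]] g(2) by simp
  then show ?thesis using null_mod_cancel_right[OF S _ s(2) h s(1)] by blast
qed

text \<open>On \<open>denominator_sources S Y\<close> the element \<open>r\<close> acts nilpotently modulo \<open>S\<close>, whereas modulo \<open>orthogonal S Y\<close>
  it acts invertibly on \<open>Z\<close>; so all arrows from the former to \<open>Z\<close> are null.\<close>

lemma orthogonal_if_radical_cone:
  assumes Y: "Y \<in> Ob T" and r: "r \<in> G d" "r \<in> radical S Y"
    and Z: "Z \<in> Ob T" "\<phi> d r Z \<in> cone_in T (orthogonal S Y)"
  shows "Z \<in> orthogonal S Y"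
proof -
  have step: "null_mod S f"
    if W: "W \<in> denominator_sources S Y" and "f \<in> Hom T W Z" "null_mod S (\<phi> (int k * d) (r [^] k) Z \<cdot> f)" for W f k
    using that(2,3)
  proof (induction k)
    case 0
    then show ?case using action_one[OF Z(1)] by simp
  next
    case (Suc k)
    note f = Suc.prems(1)
    note rk = G_pow[OF r(1), of k]
    note aZ = act_hom[OF r(1) Z(1)] and akZ = act_hom[OF rk Z(1)]
    note saZ = susp_pow_hom[OF aZ, of "int k * d"]
    \<comment> \<open>The new factor is split off on the left, so that the outermost arrow is a
      suspension of the action of \<open>r\<close> on \<open>Z\<close>, which can be
      cancelled.\<close>
    have "r [^] Suc k = r \<otimes> r [^] k" using nat_pow_Suc2[OF G_carrier[OF r(1)]] .
    moreover have "int (Suc k) * d = d + int k * d" by (simp add: algebra_simps)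
    ultimately have "\<phi> (int (Suc k) * d) (r [^] Suc k) Z =
        SAr_pow T (int k * d) (\<phi> d r Z) \<cdot> \<phi> (int k * d) (r [^] k) Z"
      using action_mult[OF r(1) rk Z(1)] by simp
    then have "null_mod S (SAr_pow T (int k * d) (\<phi> d r Z) \<cdot> (\<phi> (int k * d) (r [^] k) Z \<cdot> f))"
      using Suc.prems(2) cmp_assoc[OF f akZ saZ] by simp
    moreover have "SAr_pow T (int k * d) (\<phi> d r Z) \<in> cone_in T (orthogonal S Y)"
      using cone_in_susp_pow[OF thick_orthogonal[OF Y] aZ] Z(2) by blast
    ultimately have "null_mod S (\<phi> (int k * d) (r [^] k) Z \<cdot> f)"
      using null_mod_cancel_orthogonal[OF Y saZ _ W cmp_hom[OF f akZ]] by blast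
    then show ?case using Suc.IH f by blast
  qed
  obtain k :: nat where k: "null_mod S (\<phi> (int k * d) (r [^] k) Y)" using mem_radical[OF Y r(1)] r(2) by blast
  note rk = G_pow[OF r(1), of k]
  have "null_mod S f" if W: "W \<in> denominator_sources S Y" and f: "f \<in> Hom T W Z" for W f
  proof -
    obtain n s where s: "s \<in> Hom T W (SOb_pow T n Y)" "s \<in> cone_in T S"
      using W unfolding denominator_sources_def by blast
    note WO = hom_obD(1)[OF f] and SY = susp_pow_ob[OF Y, of n]
    note aW = act_hom[OF rk WO]
    have "null_mod S (\<phi> (int k * d) (r [^] k) (SOb_pow T n Y))"
      using null_mod_act_susp_pow[OF S rk Y] k by blast
    then have "null_mod S (\<phi> (int k * d) (r [^] k) (SOb_pow T n Y) \<cdot> s)"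
      using null_mod_comp_right[OF S _ s(1) act_hom[OF rk SY]] by blast
    then have "null_mod S (SAr_pow T (int k * d) s \<cdot> \<phi> (int k * d) (r [^] k) W)"
      using act_natural[OF rk s(1)] by simp
    then have "null_mod S (\<phi> (int k * d) (r [^] k) W)"
      using null_mod_cancel_left[OF S _ aW susp_pow_hom[OF s(1)]] cone_in_susp_pow[OF S s(1)] s(2) by blast
    then have "null_mod S (SAr_pow T (int k * d) f \<cdot> \<phi> (int k * d) (r [^] k) W)"
      using null_mod_comp_left[OF S _ aW susp_pow_hom[OF f]] by blast
    then have "null_mod S (\<phi> (int k * d) (r [^] k) Z \<cdot> f)"
      using act_natural[OF rk f] by simp
    then show ?thesis by (rule step[OF W f])
  qed
  then show ?thesis using Z(1) unfolding orthogonal_def by blast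
qed

text \<open>The construction is undone from its last cone backwards. Each cone lives in
  \<open>T_P\<close>; \<open>cone_in_if_quotient_cone\<close> brings it to \<open>T\<close>, where
  \<open>orthogonal_if_radical_cone\<close> removes it.\<close>

lemma orthogonal_if_local_Koszul:
  assumes P: "P \<in> Spec R G" and Y: "Y \<in> Ob T" and rad: "P \<subseteq> radical S Y"
    and inv: "\<And>d r. \<lbrakk>r \<in> G d; r \<notin> P\<rbrakk> \<Longrightarrow> \<phi> d r Y \<in> cone_in T S"
    and K: "Koszul (loc_cat P) (loc_act P) A rs K" and rs: "\<forall>(d, r) \<in> set rs. r \<in> G d \<and> r \<in> P"
    and KV: "K \<in> orthogonal S Y"
  shows "A \<in> orthogonal S Y"
  using K rs KV
proof (induction rule: Koszul.induct)
  case (Koszul_Nil X)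
  then show ?case by simp
next
  case (Koszul_Cons X d r v w rs K)
  have X: "X \<in> Ob T" using Koszul_Cons.hyps(1) by (simp add: local_category_def)
  have r: "r \<in> G d" "r \<in> radical S Y" using Koszul_Cons.prems(1) rad by auto
  have "Cod (loc_cat P) v \<in> orthogonal S Y" using Koszul_Cons.IH Koszul_Cons.prems by simp
  then have "\<phi> d r X \<in> cone_in T (orthogonal S Y)"
    using cone_in_if_quotient_cone[OF thick_local_kernel[OF P] thick_orthogonal[OF Y]
        local_kernel_subset_orthogonal[OF P Y inv] act_hom[OF r(1) X]] Koszul_Cons.hyps(2)
    unfolding local_category_def local_action_def by blast
  then show ?case by (rule orthogonal_if_radical_cone[OF Y r X])
qed

end

end

text \<open>Allowing any list of homogeneous elements of \<open>P\<close> treats both local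
  conditions at once: the empty list yields \<open>X\<close> itself, a list of generators yields
  \<open>X(P)\<close>.\<close>

lemma (in linear_triangulated_category) local_global_membership:
  assumes noeth: "noetherian_graded_comm_ring R G" and S: "thick T S" and X: "X \<in> Ob T"
    and loc: "\<And>P. P \<in> Spec R G \<Longrightarrow> \<exists>rs K. (\<forall>(d, r) \<in> set rs. r \<in> G d \<and> r \<in> P) \<and>
      Koszul (local_category R G T \<phi> P) (local_action R G T \<phi> P) X rs K \<and> K \<in> Thick (local_category R G T \<phi> P) S"
  shows "X \<in> S"
proof (rule ccontr)
  assume XS: "X \<notin> S"
  interpret noetherian_graded_comm_ring R G by (rule noeth)
  let ?A = "{Y \<in> Ob T. Y \<in> Thick T {X} \<and> Y \<notin> S}"
  have "X \<in> ?A" using X XS by (auto simp: Thick_def)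
  then have "radical S ` ?A \<noteq> {}" by blast
  moreover have "homogeneous_ideal R G I" if "I \<in> radical S ` ?A" for I
    using that radical_homogeneous(2)[OF S] by blast
  ultimately obtain Y where Y: "Y \<in> Ob T" "Y \<in> Thick T {X}" "Y \<notin> S"
    and max: "\<And>Z. \<lbrakk>Z \<in> ?A; radical S Y \<subseteq> radical S Z\<rbrakk> \<Longrightarrow> radical S Z = radical S Y"
    using homogeneous_ideal_maximal[of "radical S ` ?A"] by auto
  have inv: "\<phi> d r Y \<in> cone_in T S" if r: "r \<in> G d" "r \<notin> radical S Y" for d r
  proof -
    obtain Z v w where tri: "triangle Y (SOb_pow T d Y) Z (\<phi> d r Y) v w"
      using cone_exists act_hom[OF r(1) Y(1)] by blast
    have "Z \<in> Thick T {X}"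
      unfolding Thick_def
    proof (rule InterI)
      fix U assume U: "U \<in> {S. thick T S \<and> {X} \<subseteq> S}"
      then have "thick T U" "Y \<in> U" using Y(2) by (auto simp: Thick_def)
      then show "Z \<in> U" using thick_triangle(1)[OF _ tri] thick_susp_pow[OF _ Y(1)] by blast
    qed
    \<comment> \<open>The radical of \<open>Z\<close> contains that of \<open>Y\<close> and also
      \<open>r\<close>, so \<open>Z\<close> outside \<open>S\<close> would contradict
      maximality.\<close>
    moreover have "radical S Z \<noteq> radical S Y" using radical_cone(2)[OF S r(1) tri] r(2) by blast
    ultimately have "Z \<in> S" using max[of Z] radical_cone(1)[OF S r(1) tri] triangleD(7)[OF tri] by blast
    then show ?thesis by (rule cone_inI[OF tri])
  qed
  let ?P = "radical S Y"
  have P: "?P \<in> Spec R G" by (rule radical_prime[OF S Y(1,3) inv])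
  have V: "thick T (orthogonal S Y)" by (rule thick_orthogonal[OF S Y(1)])
  obtain rs K where K: "\<forall>(d, r) \<in> set rs. r \<in> G d \<and> r \<in> ?P"
    "Koszul (local_category R G T \<phi> ?P) (local_action R G T \<phi> ?P) X rs K"
    "K \<in> Thick (local_category R G T \<phi> ?P) S"
    using loc[OF P] by blast
  have "thick (local_category R G T \<phi> ?P) (orthogonal S Y)"
    unfolding local_category_def
    by (rule thick_Verdier[OF thick_local_kernel[OF P] V local_kernel_subset_orthogonal[OF S P Y(1) inv]])
  then have KV: "K \<in> orthogonal S Y" using K(3) subset_orthogonal[OF S] unfolding Thick_def by blast
  have "X \<in> orthogonal S Y"
    by (rule orthogonal_if_local_Koszul[OF S P Y(1) subset_refl _ K(2,1) KV]) (rule inv)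
  then have YV: "Y \<in> orthogonal S Y" using Y(2) V unfolding Thick_def by blast
  \<comment> \<open>In degree 0 the identity is a denominator for \<open>Y\<close>. Hence
    \<open>Y\<close>, being orthogonal to itself, has a null identity.\<close>
  have i: "Idn T Y \<in> Hom T Y (SOb_pow T 0 Y)" using idn_hom[OF Y(1)] by simp
  have "Y \<in> denominator_sources S Y"
    unfolding denominator_sources_def using i cone_in_idn[OF S Y(1)] by blast
  then have "null_mod S (Idn T Y)" using YV idn_hom[OF Y(1)] unfolding orthogonal_def by blast
  then show False
    using in_if_null_mod_cone_in(1)[OF S _ cone_in_idn[OF S Y(1)] idn_hom[OF Y(1)]] Y(3) by blast
qed

theorem theorem5p10:
  fixes R :: "('r, 'k) ring_scheme" and G :: "int \<Rightarrow> 'r set"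
    and T :: "('o, 'm, 'z) triangulated_scheme" and \<phi> :: "int \<Rightarrow> 'r \<Rightarrow> 'o \<Rightarrow> 'm"
    and S :: "'o set" and X :: 'o
  assumes "noetherian_graded_comm_ring R G"
    and "linear_triangulated_category R G T \<phi>"
    and "thick T S"
    and "X \<in> Ob T"
  defines "T_loc \<equiv> local_category R G T \<phi>"
    and "S_loc \<equiv> local_category R G (full_subcategory T S) \<phi>"
  shows
    "(X \<in> S \<longleftrightarrow> (\<forall>P \<in> Spec R G. X \<in> Thick (T_loc P) (Ob (S_loc P)))) \<and>
     (X \<in> S \<longleftrightarrow> (\<forall>P \<in> Spec R G. \<forall>K \<in> local_Koszul_objects R G T \<phi> X P.
                   K \<in> Thick (T_loc P) (Ob (S_loc P)))) \<and>
     (X \<in> S \<longleftrightarrow> (\<forall>P \<in> Spec R G. \<exists>K \<in> local_Koszul_objects R G T \<phi> X P.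
                   K \<in> Thick (T_loc P) (Ob (S_loc P))))"
proof -
  interpret noetherian_graded_comm_ring R G by (rule assms(1))
  interpret linear_triangulated_category R G T \<phi> by (rule assms(2))
  have Ob_S: "Ob (S_loc P) = S" for P
    by (simp add: S_loc_def local_category_def Verdier_quotient_def quotient_category_def
        suspended_category.defs triangulated.defs full_subcategory_def)
  have Koszul_iff: "K \<in> local_Koszul_objects R G T \<phi> X P \<longleftrightarrow>
      (\<exists>rs. (\<forall>(d, r) \<in> set rs. r \<in> G d) \<and> P = genideal R (snd ` set rs) \<and> Koszul (T_loc P) (local_action R G T \<phi> P) X rs K)"
    for P K
    by (simp add: local_Koszul_objects_def Koszul_objects_def T_loc_def)
  have 12: "X \<in> Thick (T_loc P) (Ob (S_loc P))" if "X \<in> S" for P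
    using that by (auto simp: Ob_S Thick_def)
  have 13: "K \<in> Thick (T_loc P) (Ob (S_loc P))"
    if XS: "X \<in> S" and P: "P \<in> Spec R G" and K: "K \<in> local_Koszul_objects R G T \<phi> X P" for P K
  proof -
    obtain rs where rs: "\<forall>(d, r) \<in> set rs. r \<in> G d" "Koszul (T_loc P) (local_action R G T \<phi> P) X rs K"
      using K Koszul_iff by blast
    have "K \<in> U" if "thick (T_loc P) U" "S \<subseteq> U" for U
      using local_Koszul_in_thick[OF P _ _ rs(1), of U X K] rs(2) that XS by (auto simp: T_loc_def)
    then show ?thesis by (auto simp: Ob_S Thick_def)
  qed
  \<comment> \<open>Without this the universal form of the Koszul condition could hold
    vacuously.\<close>
  have ex: "\<exists>K. K \<in> local_Koszul_objects R G T \<phi> X P" if P: "P \<in> Spec R G" for P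
  proof -
    obtain rs :: "(int \<times> 'r) list" where rs: "\<forall>(d, r) \<in> set rs. r \<in> G d" "P = genideal R (snd ` set rs)"
      using homogeneous_generators Spec_homogeneous[OF P] by metis
    obtain K where "Koszul (T_loc P) (local_action R G T \<phi> P) X rs K"
      using local_Koszul_exists[OF P rs(1) assms(4)] by (auto simp: T_loc_def)
    then show ?thesis using rs Koszul_iff by blast
  qed
  have 21: "X \<in> S" if "\<forall>P \<in> Spec R G. X \<in> Thick (T_loc P) (Ob (S_loc P))"
  proof (rule local_global_membership[OF assms(1,3,4)])
    fix P assume "P \<in> Spec R G"
    moreover have "Koszul (T_loc P) (local_action R G T \<phi> P) X [] X"
      using assms(4) by (intro Koszul_Nil) (simp add: T_loc_def local_category_def)
    ultimately show "\<exists>rs K. (\<forall>(d, r) \<in> set rs. r \<in> G d \<and> r \<in> P) \<and>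
        Koszul (local_category R G T \<phi> P) (local_action R G T \<phi> P) X rs K \<and> K \<in> Thick (local_category R G T \<phi> P) S"
      using that by (intro exI[of _ "[]"] exI[of _ X]) (simp add: Ob_S T_loc_def)
  qed
  have 31: "X \<in> S"
    if loc: "\<forall>P \<in> Spec R G. \<exists>K \<in> local_Koszul_objects R G T \<phi> X P. K \<in> Thick (T_loc P) (Ob (S_loc P))"
  proof (rule local_global_membership[OF assms(1,3,4)])
    fix P assume P: "P \<in> Spec R G"
    obtain K rs where K: "K \<in> Thick (T_loc P) S" and rs: "\<forall>(d, r) \<in> set rs. r \<in> G d"
      "P = genideal R (snd ` set rs)" "Koszul (T_loc P) (local_action R G T \<phi> P) X rs K"
      using loc P Koszul_iff by (metis Ob_S)
    have "snd ` set rs \<subseteq> carrier R" using rs(1) G_carrier by auto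
    then have "snd ` set rs \<subseteq> P" using genideal_self rs(2) by metis
    then have "\<forall>(d, r) \<in> set rs. r \<in> G d \<and> r \<in> P" using rs(1) by force
    then show "\<exists>rs K. (\<forall>(d, r) \<in> set rs. r \<in> G d \<and> r \<in> P) \<and>
        Koszul (local_category R G T \<phi> P) (local_action R G T \<phi> P) X rs K \<and> K \<in> Thick (local_category R G T \<phi> P) S"
      using K rs(3) unfolding T_loc_def by blast
  qed
  have 32: "X \<in> S"
    if "\<forall>P \<in> Spec R G. \<forall>K \<in> local_Koszul_objects R G T \<phi> X P. K \<in> Thick (T_loc P) (Ob (S_loc P))"
    using 31 ex that by meson
  show ?thesis
    using 12 13 21 31 32 ex by meson
qed

end
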